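(* There exists a universal constant $\gamma>0$ such that the following holds. Let $g:\mathbb{R}^2\times\mathbb{R}^2\to\mathbb{C}$ be a function in $L^2(\mathbb{R}^2\times\mathbb{R}^2)$ such that $g(x,y)$ is radial in $x\in\mathbb{R}^2$ and in $y\in\mathbb{R}^2$, that is, $g(x,y)$ depends only on $|x|$ and $|y|$. Let $u(x,y,t)$ be the solution of the Schrödinger equation $\partial_t u=i\Delta u$ in $\mathbb{R}^2\times\mathbb{R}^2=\mathbb{R}^4$ (with $\Delta$ the Laplacian in all four variables $(x,y)$) with initial data $u(x,y,0)=g(x,y)$. Then $$\int_{\mathbb{R}}\int_{\mathbb{R}^2}|u(x,x,t)|^2\,dx\,dt\leq \frac14\int_{\mathbb{R}^2\times\mathbb{R}^2}|g(x,y)|^2\,dx\,dy-\frac{\gamma}{4}\,\mathrm{Dist}^2_{L^2(\mathbb{R}^4)}\left(g,L^2_{rad}(\mathbb{R}^4)\right).$$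
   Context: $L^2_{rad}(\mathbb{R}^4)$ is the space of functions in $L^2(\mathbb{R}^4)$ that depend only on the Euclidean norm of $(x,y)\in\mathbb{R}^4$. For $g\in L^2(\mathbb{R}^4)$ and $\mathcal{F}\subset L^2(\mathbb{R}^4)$, $\mathrm{Dist}_{L^2(\mathbb{R}^4)}(g,\mathcal{F})=\inf\{\|g-h\|_{L^2(\mathbb{R}^4)}:h\in\mathcal{F}\}$. The solution with initial data $g\in L^2$ is $u(\cdot,\cdot,t)=e^{it\Delta}g$. For Schwartz $g$ the diagonal restriction $u(x,x,t)$ is taken pointwise; for general $g$ the map $g\mapsto u(x,x,t)\in L^2(\mathbb{R}^2\times\mathbb{R})$ is understood as the continuous extension from Schwartz data. *)

theory Defs
  imports "HOL-Analysis.Analysis"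
begin

text \<open>
  Elements of \<open>L\<^sup>2\<close> are represented by Lebesgue measurable functions; properties of such elements are
  therefore stated almost everywhere.
\<close>

definition L2 :: "('a::euclidean_space \<Rightarrow> complex) set" where
  "L2 = {f. f \<in> borel_measurable lebesgue \<and> integrable lebesgue (\<lambda>x. (cmod (f x))\<^sup>2)}"

definition L2_norm :: "('a::euclidean_space \<Rightarrow> complex) \<Rightarrow> real" where
  "L2_norm f = sqrt (\<integral>x. (cmod (f x))\<^sup>2 \<partial>lebesgue)"

definition L2_dist ::
    "('a::euclidean_space \<Rightarrow> complex) \<Rightarrow> ('a \<Rightarrow> complex) set \<Rightarrow> real" where
  "L2_dist g F = (INF h\<in>F. L2_norm (\<lambda>x. g x - h x))"

definition L2_rad :: "('a::euclidean_space \<Rightarrow> complex) set" where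
  "L2_rad = {f \<in> L2. \<exists>F :: real \<Rightarrow> complex. AE x in lebesgue. f x = F (norm x)}"

fun iterated_derivative ::
    "'a::euclidean_space list \<Rightarrow> ('a \<Rightarrow> complex) \<Rightarrow> 'a \<Rightarrow> complex" where
  "iterated_derivative [] f = f"
| "iterated_derivative (v # vs) f =
     (\<lambda>x. frechet_derivative (iterated_derivative vs f) (at x) v)"

definition schwartz :: "('a::euclidean_space \<Rightarrow> complex) \<Rightarrow> bool" where
  "schwartz f \<longleftrightarrow>
     (\<forall>vs. set vs \<subseteq> Basis \<longrightarrow>
        (\<forall>x. iterated_derivative vs f differentiable (at x)) \<and>
        (\<forall>k::nat. bounded (range (\<lambda>x. norm x ^ k *\<^sub>R iterated_derivative vs f x))))"

definition fourier :: "('a::euclidean_space \<Rightarrow> complex) \<Rightarrow> 'a \<Rightarrow> complex" where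
  "fourier f \<xi> = (\<integral>x. cis (- (x \<bullet> \<xi>)) * f x \<partial>lborel)"

text \<open>
  The operator \<open>exp (i t \<Delta>)\<close> on Schwartz functions: with the above normalisation of the
  Fourier transform, \<open>\<Delta>\<close> is the multiplier \<open>- |\<xi>|\<^sup>2\<close>, so the solution of
  \<open>\<partial>\<^sub>t u = i \<Delta> u\<close> has Fourier transform \<open>exp (- i t |\<xi>|\<^sup>2)\<close> times that of the initial datum.
\<close>

definition schroedinger :: "real \<Rightarrow> ('a::euclidean_space \<Rightarrow> complex) \<Rightarrow> 'a \<Rightarrow> complex" where
  "schroedinger t f x =
     (\<integral>\<xi>. cis (x \<bullet> \<xi>) * (cis (- (t * (norm \<xi>)\<^sup>2)) * fourier f \<xi>) \<partial>lborel)
       / (2 * pi) ^ DIM('a)"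

definition diagonal ::
    "((real^2) \<times> (real^2) \<Rightarrow> complex) \<Rightarrow> (real^2) \<times> real \<Rightarrow> complex" where
  "diagonal f = (\<lambda>(x, t). schroedinger t f (x, x))"

text \<open>
  \<open>diagonal_trace g h\<close> says that \<open>h\<close> is the value at \<open>g\<close> of the extension by continuity, from
  Schwartz data to \<open>L\<^sup>2\<close>, of the map \<open>diagonal\<close>: it is the \<open>L\<^sup>2\<close> limit of \<open>diagonal f\<close> as the
  Schwartz function \<open>f\<close> tends to \<open>g\<close> in \<open>L\<^sup>2\<close>.  Since Schwartz functions are dense, \<open>h\<close> is
  determined up to null sets.
\<close>

definition diagonal_trace ::
    "((real^2) \<times> (real^2) \<Rightarrow> complex) \<Rightarrow> ((real^2) \<times> real \<Rightarrow> complex) \<Rightarrow> bool" where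
  "diagonal_trace g h \<longleftrightarrow> h \<in> L2 \<and>
     (\<forall>\<epsilon>>0. \<exists>\<delta>>0. \<forall>f. schwartz f \<and> L2_norm (\<lambda>z. f z - g z) < \<delta> \<longrightarrow>
        diagonal f \<in> L2 \<and> L2_norm (\<lambda>p. diagonal f p - h p) < \<epsilon>)"

end

theory Submission
  imports Defs "HOL-Probability.Probability"
begin

text \<open>
  Write \<open>F\<close> for the Fourier transform of the datum.  The restriction of the solution to the diagonal
  is the space-time Fourier transform of the integrals of \<open>F\<close> over the circles on which \<open>\<xi> + \<eta>\<close> and
  \<open>|\<xi>|\<^sup>2 + |\<eta>|\<^sup>2\<close> are constant.  By Plancherel, the deficit in the inequality with constant \<open>1/4\<close> is
  therefore at least the mean square oscillation of \<open>F\<close> along these circles.  If \<open>F\<close> depends on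
  \<open>|\<xi>|\<close> and \<open>|\<eta>|\<close> only, then on the sphere \<open>|\<xi>|\<^sup>2 + |\<eta>|\<^sup>2 = q\<close> it is a function of
  \<open>v = |\<xi>|\<^sup>2 - |\<eta>|\<^sup>2\<close>, uniformly distributed on \<open>[-q, q]\<close>, and the pairs \<open>(v, v')\<close> of values met by a
  random circle have a joint density bounded below by a multiple of the uniform density on the
  square.  So the oscillation dominates the variance of \<open>F\<close> on each sphere, that is, the
  distance from \<open>F\<close> to the radial functions.  This is carried out for linear combinations of Gaussians
  \<open>exp (- a |x|\<^sup>2 - b |y|\<^sup>2)\<close>, which are dense by Stone-Weierstrass.
\<close>

section \<open>Gaussians and the Plancherel inequality\<close>

text \<open>The bound \<open>pi / q\<close> for the joint density scales with the radius in such a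
  way that, after integration over a sphere, the resulting constant is the same for every
  \<open>q\<close>; this makes the gap uniform. Together with the mass \<open>2 * pi\<close> of the
  circles and the powers of \<open>2 * pi\<close> from the Fourier normalisation it gives \<gamma> =
  1 / (2 pi). Plancherel enters three times, always as an upper bound: for the restriction, for the
  datum, and for the distance to the radial functions. The third is an upper bound because the
  radial competitor is built on the frequency side, by averaging \<open>F\<close> over spheres and
  transforming the average. For this to work the datum has to be recovered from \<open>F\<close> by
  a second transform, and the transform of the average has to be radial. On Gaussians both are
  explicit computations, which is why they are the approximating class. The trace on the diagonal is
  defined by testing against all Schwartz functions, biradial or not. Hence the inequality without
  the gap is needed for all of them, and this is what forces a study of the decay of their Fourier
  transforms.\<close>

lemma
  fixes f :: "'a::euclidean_space \<Rightarrow> real \<Rightarrow> 'b::{real_normed_field,banach,second_countable_topology}"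
  assumes f: "\<And>b. b \<in> Basis \<Longrightarrow> integrable lborel (f b)"
  shows integrable_lborel_prod: "integrable lborel (\<lambda>x::'a. \<Prod>b\<in>Basis. f b (x \<bullet> b))"
    and integral_lborel_prod:
      "(\<integral>x. (\<Prod>b\<in>Basis. f b ((x::'a) \<bullet> b)) \<partial>lborel) = (\<Prod>b\<in>Basis. \<integral>x. f b x \<partial>lborel)"
proof -
  interpret product_sigma_finite "\<lambda>b::'a. lborel::real measure" ..
  have m [measurable]: "(\<lambda>x::'a. \<Prod>b\<in>Basis. f b (x \<bullet> b)) \<in> borel_measurable borel"
  proof (rule borel_measurable_prod)
    fix b :: 'a assume "b \<in> Basis"
    hence "f b \<in> borel_measurable borel" using borel_measurable_integrable[OF f] by simp
    thus "(\<lambda>x::'a. f b (x \<bullet> b)) \<in> borel_measurable borel"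
      by (rule measurable_compose[rotated]) measurable
  qed
  have T: "(\<lambda>f. \<Sum>b\<in>Basis. f b *\<^sub>R b) \<in> (\<Pi>\<^sub>M b\<in>(Basis::'a set). lborel) \<rightarrow>\<^sub>M borel"
    by measurable
  show "integrable lborel (\<lambda>x::'a. \<Prod>b\<in>Basis. f b (x \<bullet> b))"
    unfolding lborel_eq[where 'a='a] integrable_distr_eq[OF T m]
    using product_integrable_prod[OF finite_Basis f] by (simp cong: prod.cong)
  show "(\<integral>x. (\<Prod>b\<in>Basis. f b ((x::'a) \<bullet> b)) \<partial>lborel) = (\<Prod>b\<in>Basis. \<integral>x. f b x \<partial>lborel)"
    unfolding lborel_eq[where 'a='a] integral_distr[OF T m]
    using product_integral_prod[OF finite_Basis f] by (simp cong: prod.cong)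
qed

lemma cis_measurable [measurable]: "cis \<in> borel_measurable borel"
  by (intro borel_measurable_continuous_onI continuous_intros)

lemma cnj_measurable [measurable]: "cnj \<in> borel_measurable borel"
  by (intro borel_measurable_continuous_onI continuous_intros)

text \<open>The characteristic function of the standard normal law is the case
  \<open>a = 1/2\<close>. Rescaling by \<open>c = sqrt (2 * a)\<close> gives every positive
  \<open>a\<close>, and \<open>t\<close> is chosen so that \<open>t * c = - s\<close>.\<close>

lemma has_bochner_integral_cis_gaussian:
  assumes "a > 0"
  shows "has_bochner_integral lborel (\<lambda>x::real. cis (- (x * s)) * of_real (exp (- a * x\<^sup>2)))
     (of_real (sqrt (pi / a) * exp (- s\<^sup>2 / (4 * a))))"
proof -
  define c where "c = sqrt (2 * a)"
  have c: "c > 0" "c\<^sup>2 = 2 * a" using assms by (auto simp: c_def)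
  define t where "t = - s / c"
  have "char std_normal_distribution t = of_real (exp (- t\<^sup>2 / 2))"
    by (simp add: char_std_normal_distribution)
  hence eq: "(\<integral>x. std_normal_density x *\<^sub>R iexp (t * x) \<partial>lborel) = of_real (exp (- t\<^sup>2 / 2))"
    unfolding char_def by (subst (asm) integral_density) auto
  have int: "integrable lborel (\<lambda>x. std_normal_density x *\<^sub>R iexp (t * x))"
  proof (rule Bochner_Integration.integrable_bound)
    show "integrable lborel (\<lambda>x. std_normal_density x)" by simp
  qed (auto simp: )
  have "has_bochner_integral lborel (\<lambda>x. std_normal_density x *\<^sub>R iexp (t * x)) (of_real (exp (- t\<^sup>2 / 2)))"
    using int eq by (simp add: has_bochner_integral_iff)
  from has_bochner_integral_mult_right[OF this, of "of_real (sqrt (2*pi))"]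
  have "has_bochner_integral lborel (\<lambda>x. of_real (exp (- x\<^sup>2 / 2)) * cis (t * x))
      (of_real (sqrt (2*pi)) * of_real (exp (- t\<^sup>2 / 2)))"
    by (simp add: std_normal_density_def scaleR_conv_of_real cis_conv_exp field_simps del: of_real_exp)
  hence "has_bochner_integral lborel (\<lambda>x. of_real (exp (- (0 + c * x)\<^sup>2 / 2)) * cis (t * (0 + c * x)))
      (of_real (sqrt (2*pi)) * of_real (exp (- t\<^sup>2 / 2)) /\<^sub>R \<bar>c\<bar>)"
    using c by (subst (asm) lborel_has_bochner_integral_real_affine_iff[where c=c and t=0]) auto
  moreover have "exp (- (0 + c * x)\<^sup>2 / 2) = exp (- a * x\<^sup>2)" for x
    using c by (simp add: power_mult_distrib)
  moreover have "t * (0 + c * x) = - (x * s)" for x using c by (simp add: t_def field_simps)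
  moreover have "of_real (sqrt (2*pi)) * of_real (exp (- t\<^sup>2 / 2)) /\<^sub>R \<bar>c\<bar>
      = (of_real (sqrt (pi / a) * exp (- s\<^sup>2 / (4 * a))) :: complex)"
  proof -
    have "sqrt (2*pi) / c = sqrt (pi / a)" using assms by (simp add: c_def real_sqrt_divide real_sqrt_mult)
    moreover have "t\<^sup>2 / 2 = s\<^sup>2 / (4*a)" using c by (simp add: t_def power_divide)
    ultimately show ?thesis using c
      by (simp add: scaleR_conv_of_real field_simps flip: of_real_mult of_real_divide) 
  qed
  ultimately show ?thesis by (simp add: mult.commute)
qed

text \<open>The width may vary with the basis vector: biradial data have different widths in the two
  planes of R^4.\<close>

definition gaussian :: "('a::euclidean_space \<Rightarrow> real) \<Rightarrow> 'a \<Rightarrow> real" where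
  "gaussian a x = exp (- (\<Sum>b\<in>Basis. a b * (x \<bullet> b)\<^sup>2))"

lemma gaussian_pos: "gaussian a x > 0"
  by (simp add: gaussian_def)

lemma gaussian_measurable [measurable]: "gaussian a \<in> borel_measurable borel"
  unfolding gaussian_def[abs_def] by measurable

lemma gaussian_const: "gaussian (\<lambda>_. c) x = exp (- c * (norm x)\<^sup>2)"
proof -
  have "(norm x)\<^sup>2 = (\<Sum>b\<in>Basis. (x \<bullet> b)\<^sup>2)"
    unfolding power2_norm_eq_inner by (subst euclidean_inner) (simp add: power2_eq_square)
  thus ?thesis by (simp add: gaussian_def sum_distrib_left sum_negf)
qed

lemma cis_sum: "finite A \<Longrightarrow> cis (\<Sum>i\<in>A. f i) = (\<Prod>i\<in>A. cis (f i))"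
  by (induction rule: finite_induct) (auto simp flip: cis_mult)

lemma cis_inner_gaussian:
  "cis (- (x \<bullet> \<xi>)) * of_real (gaussian a x)
    = (\<Prod>b\<in>Basis. cis (- ((x \<bullet> b) * (\<xi> \<bullet> b))) * of_real (exp (- a b * (x \<bullet> b)\<^sup>2)))"
proof -
  have "- (x \<bullet> \<xi>) = (\<Sum>b\<in>Basis. - ((x \<bullet> b) * (\<xi> \<bullet> b)))"
    by (simp add: euclidean_inner[of x \<xi>] sum_negf)
  hence 1: "cis (- (x \<bullet> \<xi>)) = (\<Prod>b\<in>Basis. cis (- ((x \<bullet> b) * (\<xi> \<bullet> b))))"
    by (simp only: cis_sum finite_Basis)
  have "gaussian a x = (\<Prod>b\<in>Basis. exp (- a b * (x \<bullet> b)\<^sup>2))"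
    by (simp add: gaussian_def exp_sum flip: sum_negf)
  thus ?thesis unfolding 1 by (simp only: of_real_prod prod.distrib)
qed

lemma
  assumes a: "\<And>b. b \<in> Basis \<Longrightarrow> a b > 0"
  shows integrable_gaussian: "integrable lborel (gaussian a)"
    and fourier_gaussian: "fourier (\<lambda>x::'a::euclidean_space. of_real (gaussian a x)) \<xi>
      = of_real ((\<Prod>b\<in>Basis. sqrt (pi / a b)) * gaussian (\<lambda>b. 1 / (4 * a b)) \<xi>)"
proof -
  note h = has_bochner_integral_cis_gaussian[OF a]
  have "integrable lborel (\<lambda>x::'a. cis (- (x \<bullet> 0)) * complex_of_real (gaussian a x))"
    unfolding cis_inner_gaussian
    by (intro integrable_lborel_prod) (use h[unfolded has_bochner_integral_iff] in blast)
  from integrable_norm[OF this] show "integrable lborel (gaussian a)"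
    by (simp add: norm_mult gaussian_pos less_imp_le)
  show "fourier (\<lambda>x. of_real (gaussian a x)) \<xi>
      = of_real ((\<Prod>b\<in>Basis. sqrt (pi / a b)) * gaussian (\<lambda>b. 1 / (4 * a b)) \<xi>)"
  proof -
    have "fourier (\<lambda>x. of_real (gaussian a x)) \<xi>
        = (\<Prod>b\<in>Basis. of_real (sqrt (pi / a b) * exp (- (\<xi> \<bullet> b)\<^sup>2 / (4 * a b))))"
      unfolding fourier_def cis_inner_gaussian
      using h[unfolded has_bochner_integral_iff] by (subst integral_lborel_prod) (auto cong: prod.cong)
    also have "gaussian (\<lambda>b. 1 / (4 * a b)) \<xi> = (\<Prod>b\<in>Basis. exp (- (\<xi> \<bullet> b)\<^sup>2 / (4 * a b)))"
      by (simp add: gaussian_def exp_sum flip: sum_negf)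
    hence "(\<Prod>b\<in>Basis. complex_of_real (sqrt (pi / a b) * exp (- (\<xi> \<bullet> b)\<^sup>2 / (4 * a b))))
       = of_real ((\<Prod>b\<in>Basis. sqrt (pi / a b)) * gaussian (\<lambda>b. 1 / (4 * a b)) \<xi>)"
      by (simp only: of_real_prod prod.distrib of_real_mult)
    finally show ?thesis .
  qed
qed

section \<open>Fourier integrals of integrable functions and their duality\<close>

lemma fourier_borel [measurable]:
  fixes F :: "'a::euclidean_space \<Rightarrow> complex"
  assumes [measurable]: "F \<in> borel_measurable borel"
  shows "fourier F \<in> borel_measurable borel"
proof -
  have "(\<lambda>\<xi>. \<integral>x. cis (- (x \<bullet> \<xi>)) * F x \<partial>lborel) \<in> borel_measurable borel"
    by (rule lborel.borel_measurable_lebesgue_integral) measurable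
  thus ?thesis by (simp add: fourier_def[abs_def])
qed

lemma integrable_cis_mult:
  fixes F :: "'a::euclidean_space \<Rightarrow> complex"
  assumes "integrable lborel F" "c \<in> borel_measurable borel"
  shows "integrable lborel (\<lambda>x. cis (c x) * F x)"
  by (rule Bochner_Integration.integrable_bound[OF assms(1)])
     (use assms borel_measurable_integrable[OF assms(1)] in \<open>auto simp: norm_mult\<close>)

text \<open>Supplies the hypothesis of Fubini whenever a bounded kernel couples two integrable
  factors: in the multiplication formula, and later for a superposition of Gaussians over a
  parameter.\<close>

lemma integrable_prod_tensor:
  fixes f :: "'a::euclidean_space \<Rightarrow> complex" and g :: "'b::euclidean_space \<Rightarrow> complex"
  assumes "integrable lborel f" "integrable lborel g"
    "K \<in> borel_measurable (lborel \<Otimes>\<^sub>M lborel)" "\<And>p. norm (K p) \<le> C"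
  shows "integrable (lborel \<Otimes>\<^sub>M lborel) (\<lambda>(x, y). K (x, y) * (f x * g y) :: complex)"
proof -
  have [measurable]: "f \<in> borel_measurable borel" "g \<in> borel_measurable borel"
    using assms(1,2) borel_measurable_integrable by fastforce+
  note assms(3)[measurable]
  have C: "C \<ge> 0" using assms(4)[of "undefined"] norm_ge_zero order_trans by blast
  have "integrable (lborel \<Otimes>\<^sub>M lborel) (\<lambda>(x, y). f x * g y)"
  proof (rule lborel_pair.Fubini_integrable)
    show "(\<lambda>(x, y). f x * g y) \<in> borel_measurable (lborel \<Otimes>\<^sub>M lborel)" by measurable
    show "integrable lborel (\<lambda>x. \<integral>y. norm (case (x, y) of (x, y) \<Rightarrow> f x * g y) \<partial>lborel)"
      using assms by (simp add: norm_mult)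
    show "AE x in lborel. integrable lborel (\<lambda>y. case (x, y) of (x, y) \<Rightarrow> f x * g y)"
      using assms by simp
  qed
  hence "integrable (lborel \<Otimes>\<^sub>M lborel) (\<lambda>p. of_real C * (case p of (x, y) \<Rightarrow> f x * g y))"
    by (intro integrable_mult_right) auto
  thus ?thesis
  proof (rule Bochner_Integration.integrable_bound)
    show "(\<lambda>(x, y). K (x, y) * (f x * g y)) \<in> borel_measurable (lborel \<Otimes>\<^sub>M lborel)" by measurable
    show "AE p in lborel \<Otimes>\<^sub>M lborel. norm (case p of (x, y) \<Rightarrow> K (x, y) * (f x * g y))
         \<le> norm (of_real C * (case p of (x, y) \<Rightarrow> f x * g y))"
      using assms(4) C by (auto simp: norm_mult intro!: mult_right_mono AE_I2)
  qed
qed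

text \<open>The kernel \<open>cis (- (x \<bullet> y))\<close> is symmetric in its arguments, so
  Fubini moves the transform from one factor to the other.\<close>

lemma fourier_multiplication_formula:
  fixes f g :: "'a::euclidean_space \<Rightarrow> complex"
  assumes f: "integrable lborel f" and g: "integrable lborel g"
  shows "(\<integral>\<xi>. fourier f \<xi> * g \<xi> \<partial>lborel) = (\<integral>x. f x * fourier g x \<partial>lborel)"
proof -
  have int: "integrable (lborel \<Otimes>\<^sub>M lborel) (\<lambda>(x, y). cis (- (x \<bullet> y)) * (f x * g y))"
    using integrable_prod_tensor[OF f g, of "\<lambda>p. cis (- (fst p \<bullet> snd p))" 1] by simp
  have "(\<integral>\<xi>. fourier f \<xi> * g \<xi> \<partial>lborel) = (\<integral>\<xi>. (\<integral>x. cis (- (x \<bullet> \<xi>)) * (f x * g \<xi>) \<partial>lborel) \<partial>lborel)"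
  proof (rule Bochner_Integration.integral_cong)
    fix \<xi>
    have "fourier f \<xi> * g \<xi> = (\<integral>x. (cis (- (x \<bullet> \<xi>)) * f x) * g \<xi> \<partial>lborel)"
      by (simp add: fourier_def)
    thus "fourier f \<xi> * g \<xi> = (\<integral>x. cis (- (x \<bullet> \<xi>)) * (f x * g \<xi>) \<partial>lborel)" by (simp add: mult.assoc)
  qed simp
  also have "\<dots> = (\<integral>x. (\<integral>\<xi>. cis (- (x \<bullet> \<xi>)) * (f x * g \<xi>) \<partial>lborel) \<partial>lborel)"
    using lborel_pair.Fubini_integral[OF int] by simp
  also have "\<dots> = (\<integral>x. f x * fourier g x \<partial>lborel)"
  proof (rule Bochner_Integration.integral_cong)
    fix x
    show "(\<integral>\<xi>. cis (- (x \<bullet> \<xi>)) * (f x * g \<xi>) \<partial>lborel) = f x * fourier g x"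
      by (simp add: fourier_def mult.left_commute inner_commute)
  qed simp
  finally show ?thesis .
qed

section \<open>Invariance of Lebesgue measure under reflections and translations\<close>

lemma lborel_distr_reflect: "distr lborel borel (\<lambda>y. x - y) = (lborel :: 'a::euclidean_space measure)"
  using lborel_affine[of "-1" x] by (simp add: density_1)

lemma nn_integral_reflect:
  fixes x :: "'a::euclidean_space"
  assumes [measurable]: "f \<in> borel_measurable borel"
  shows "(\<integral>\<^sup>+y. f (x - y) \<partial>lborel) = (\<integral>\<^sup>+y. f y \<partial>lborel)"
  using nn_integral_distr[of "\<lambda>y. x - y" lborel borel f] by (simp add: lborel_distr_reflect)

text \<open>A translation is the composition of two reflections.\<close>

lemma nn_integral_translate:
  fixes y :: "'a::euclidean_space"
  assumes [measurable]: "f \<in> borel_measurable borel"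
  shows "(\<integral>\<^sup>+x. f (x - y) \<partial>lborel) = (\<integral>\<^sup>+x. f x \<partial>lborel)"
  using nn_integral_reflect[of "\<lambda>z. f (- y - z)" 0] nn_integral_reflect[of f "- y"] by simp

lemma
  fixes x :: "'a::euclidean_space" and f :: "'a \<Rightarrow> 'b::{banach,second_countable_topology}"
  shows integrable_reflect: "integrable lborel f \<Longrightarrow> integrable lborel (\<lambda>y. f (x - y))"
    and integral_reflect: "f \<in> borel_measurable borel \<Longrightarrow>
      (\<integral>y. f (x - y) \<partial>lborel) = (\<integral>y. f y \<partial>lborel)"
proof -
  assume i: "integrable lborel f"
  hence "f \<in> borel_measurable borel" using borel_measurable_integrable by fastforce
  thus "integrable lborel (\<lambda>y. f (x - y))"
    using integrable_distr_eq[of "\<lambda>y. x - y" lborel borel f] i by (simp add: lborel_distr_reflect)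
next
  assume "f \<in> borel_measurable borel"
  thus "(\<integral>y. f (x - y) \<partial>lborel) = (\<integral>y. f y \<partial>lborel)"
    using integral_distr[of "\<lambda>y. x - y" lborel borel f] by (simp add: lborel_distr_reflect)
qed

lemma norm_fourier_le:
  assumes "integrable lborel F"
  shows "cmod (fourier F \<xi>) \<le> (\<integral>x. cmod (F x) \<partial>lborel)"
proof -
  have "cmod (fourier F \<xi>) \<le> (\<integral>x. cmod (cis (- (x \<bullet> \<xi>)) * F x) \<partial>lborel)"
    unfolding fourier_def by (rule integral_norm_bound)
  thus ?thesis by (simp add: norm_mult)
qed

section \<open>The Plancherel inequality\<close>

lemma integral_gaussian_const:
  assumes "e > 0"
  shows "(\<integral>x. gaussian (\<lambda>_. e) (x::'a::euclidean_space) \<partial>lborel) = sqrt (pi / e) ^ DIM('a)"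
proof -
  have "complex_of_real (\<integral>x. gaussian (\<lambda>_. e) (x::'a) \<partial>lborel) = fourier (\<lambda>x::'a. of_real (gaussian (\<lambda>_. e) x)) 0"
    by (simp add: fourier_def)
  also have "\<dots> = of_real (sqrt (pi / e) ^ DIM('a))"
    using assms by (subst fourier_gaussian) (auto simp: gaussian_def)
  finally show ?thesis by (simp only: of_real_eq_iff)
qed

text \<open>\<open>K\<close> is \<open>(2 * pi) ^ DIM('a)\<close> times a probability density that
  concentrates at 0 as \<open>e\<close> tends to 0. That its mass is the same for all
  \<open>e\<close> keeps the Plancherel bound uniform in the damping.\<close>

lemma fourier_gaussian_mass:
  assumes "e > 0"
  defines "K \<equiv> \<lambda>x::'a::euclidean_space. sqrt (pi / e) ^ DIM('a) * gaussian (\<lambda>b. 1 / (4 * e)) x"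
  shows "fourier (\<lambda>x. of_real (gaussian (\<lambda>_. e) x)) = (\<lambda>x. complex_of_real (K x))"
    and "(\<integral>\<^sup>+x. ennreal (K x) \<partial>lborel) = ennreal ((2 * pi) ^ DIM('a))"
proof -
  show "fourier (\<lambda>x. of_real (gaussian (\<lambda>_. e) x)) = (\<lambda>x. complex_of_real (K x))"
    using assms by (auto simp: fun_eq_iff fourier_gaussian K_def)
  have int: "integrable lborel (gaussian (\<lambda>b::'a. 1 / (4 * e)))"
    using assms by (intro integrable_gaussian) simp
  have "(\<integral>x. K x \<partial>lborel) = sqrt (pi / e) ^ DIM('a) * sqrt (pi / (1 / (4 * e))) ^ DIM('a)"
    using int assms by (simp only: K_def integral_mult_right integral_gaussian_const) (simp add: integral_gaussian_const)
  also have "\<dots> = (2 * pi) ^ DIM('a)"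
  proof -
    have "sqrt (pi / e) * sqrt (pi / (1 / (4 * e))) = sqrt ((2 * pi)\<^sup>2)"
      using assms by (simp add: real_sqrt_mult[symmetric] power2_eq_square)
    hence "sqrt (pi / e) * sqrt (pi / (1 / (4 * e))) = 2 * pi" by (simp only: real_sqrt_abs) simp
    thus ?thesis by (simp only: power_mult_distrib[symmetric])
  qed
  finally show "(\<integral>\<^sup>+x. ennreal (K x) \<partial>lborel) = ennreal ((2 * pi) ^ DIM('a))"
    using int assms by (subst nn_integral_eq_integral) (auto simp: K_def gaussian_pos less_imp_le)
qed

text \<open>
  Only the inequality in Plancherel's theorem is ever needed.  It is obtained by testing
  \<open>|fourier F|\<^sup>2\<close> against a wide Gaussian, whose Fourier transform has fixed mass.
\<close>

lemma plancherel_gaussian_le: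
  fixes F :: "'a::euclidean_space \<Rightarrow> complex"
  assumes F: "integrable lborel F" and F2: "integrable lborel (\<lambda>x. (cmod (F x))\<^sup>2)" and e: "e > 0"
  shows "(\<integral>\<^sup>+\<xi>. ennreal (gaussian (\<lambda>_. e) \<xi> * (cmod (fourier F \<xi>))\<^sup>2) \<partial>lborel)
    \<le> ennreal ((2 * pi) ^ DIM('a) * (\<integral>x. (cmod (F x))\<^sup>2 \<partial>lborel))"
proof -
  define g :: "'a \<Rightarrow> complex" where "g = (\<lambda>x. of_real (gaussian (\<lambda>_. e) x))"
  define K :: "'a \<Rightarrow> real" where "K x = sqrt (pi / e) ^ DIM('a) * gaussian (\<lambda>b. 1 / (4 * e)) x" for x
  define N where "N = (\<integral>x. (cmod (F x))\<^sup>2 \<partial>lborel)"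
  have K0: "K x \<ge> 0" for x using e by (simp add: K_def gaussian_pos less_imp_le)
  have [measurable]: "F \<in> borel_measurable borel" using borel_measurable_integrable[OF F] by simp
  have [measurable]: "g \<in> borel_measurable borel" "K \<in> borel_measurable borel"
    unfolding g_def K_def[abs_def] by measurable
  have gK: "fourier g = (\<lambda>x. of_real (K x))" and massK: "(\<integral>\<^sup>+x. ennreal (K x) \<partial>lborel) = ennreal ((2 * pi) ^ DIM('a))"
    using fourier_gaussian_mass[OF e, where 'a='a] by (simp_all add: g_def K_def)
  have g: "integrable lborel g" unfolding g_def using e by (intro integrable_of_real integrable_gaussian) 
  define M where "M = (\<integral>x. cmod (F x) \<partial>lborel)"
  have M: "cmod (fourier F \<xi>) \<le> M" for \<xi> unfolding M_def by (rule norm_fourier_le[OF F])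
  hence M0: "M \<ge> 0" using norm_ge_zero order_trans by blast
  \<comment> \<open>The transform of \<open>F\<close> is only known to be bounded; the Gaussian
    factor makes \<Psi> integrable, so that the multiplication formula applies to it.\<close>
  define \<Psi> where "\<Psi> \<xi> = g \<xi> * cnj (fourier F \<xi>)" for \<xi>
  have [measurable]: "\<Psi> \<in> borel_measurable borel" unfolding \<Psi>_def[abs_def] by measurable
  have \<Psi>: "integrable lborel \<Psi>"
  proof (rule Bochner_Integration.integrable_bound)
    show "integrable lborel (\<lambda>\<xi>. M * cmod (g \<xi>))" using g by (intro integrable_mult_right integrable_norm) auto
    have "norm (\<Psi> \<xi>) \<le> norm (M * cmod (g \<xi>))" for \<xi>
      using mult_right_mono[OF M[of \<xi>] norm_ge_zero[of "g \<xi>"]] M0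
      by (simp add: \<Psi>_def norm_mult mult.commute)
    thus "AE \<xi> in lborel. norm (\<Psi> \<xi>) \<le> norm (M * cmod (g \<xi>))" by simp
  qed measurable
  \<comment> \<open>The transform of a product is a convolution, here of the conjugate of
    \<open>F\<close> with \<open>K\<close>. It is obtained from the multiplication formula, since
    the translated and reflected conjugate of \<open>F\<close> has a modulated conjugate
    transform.\<close>
  have \<Psi>': "fourier \<Psi> x = (\<integral>y. cnj (F (x - y)) * of_real (K y) \<partial>lborel)" for x
  proof -
    have Fx: "integrable lborel (\<lambda>y. cnj (F (x - y)))"
      using integrable_reflect[OF integrable_cnj[OF F]] by simp
    have *: "fourier (\<lambda>y. cnj (F (x - y))) \<xi> = cis (- (\<xi> \<bullet> x)) * cnj (fourier F \<xi>)" for \<xi>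
    proof -
      have "fourier (\<lambda>y. cnj (F (x - y))) \<xi> = (\<integral>y. cis (- (\<xi> \<bullet> x)) * cnj (cis (- ((x - y) \<bullet> \<xi>)) * F (x - y)) \<partial>lborel)"
        unfolding fourier_def
        by (intro Bochner_Integration.integral_cong)
           (auto simp: cis_cnj cis_mult inner_diff_left inner_diff_right inner_commute simp flip: mult.assoc)
      also have "\<dots> = (\<integral>y. cis (- (\<xi> \<bullet> x)) * cnj (cis (- (y \<bullet> \<xi>)) * F y) \<partial>lborel)"
        by (rule integral_reflect) measurable
      also have "\<dots> = cis (- (\<xi> \<bullet> x)) * cnj (fourier F \<xi>)"
        unfolding fourier_def
        by (simp only: integral_mult_right_zero Bochner_Integration.integral_cnj)
      finally show ?thesis .
    qed
    have "fourier \<Psi> x = (\<integral>\<xi>. fourier (\<lambda>y. cnj (F (x - y))) \<xi> * g \<xi> \<partial>lborel)"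
      unfolding fourier_def[of \<Psi>] by (intro Bochner_Integration.integral_cong) (simp_all add: * \<Psi>_def mult_ac)
    also have "\<dots> = (\<integral>y. cnj (F (x - y)) * fourier g y \<partial>lborel)"
      by (rule fourier_multiplication_formula[OF Fx g])
    finally show ?thesis by (simp add: gK)
  qed
  have int: "integrable lborel (\<lambda>\<xi>. gaussian (\<lambda>_. e) \<xi> * (cmod (fourier F \<xi>))\<^sup>2)"
  proof (rule Bochner_Integration.integrable_bound)
    show "integrable lborel (\<lambda>\<xi>. M * cmod (\<Psi> \<xi>))" using \<Psi> by (intro integrable_mult_right integrable_norm) auto
    have sq: "(cmod (fourier F \<xi>))\<^sup>2 \<le> M * cmod (fourier F \<xi>)" for \<xi>
      using M[of \<xi>] by (simp add: power2_eq_square mult_right_mono)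
    show "AE \<xi> in lborel. norm (gaussian (\<lambda>_. e) \<xi> * (cmod (fourier F \<xi>))\<^sup>2) \<le> norm (M * cmod (\<Psi> \<xi>))"
      using M0 sq by (intro AE_I2) (auto simp: \<Psi>_def g_def norm_mult gaussian_pos less_imp_le abs_mult mult_ac)
  qed measurable
  define I where "I = (\<integral>\<xi>. gaussian (\<lambda>_. e) \<xi> * (cmod (fourier F \<xi>))\<^sup>2 \<partial>lborel)"
  have "complex_of_real I = (\<integral>\<xi>. fourier F \<xi> * \<Psi> \<xi> \<partial>lborel)"
    unfolding I_def integral_complex_of_real[symmetric]
    by (intro Bochner_Integration.integral_cong) (simp_all add: \<Psi>_def g_def complex_norm_square mult_ac del: of_real_power)
  also have "\<dots> = (\<integral>x. F x * fourier \<Psi> x \<partial>lborel)"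
    by (rule fourier_multiplication_formula[OF F \<Psi>])
  \<comment> \<open>If an integrand fails to be integrable, its Bochner integral is 0 and the bound
    is trivial; so it holds in either case.\<close>
  finally have "ennreal (norm (complex_of_real I)) \<le> (\<integral>\<^sup>+x. ennreal (norm (F x * fourier \<Psi> x)) \<partial>lborel)"
    by (metis integral_norm_bound_ennreal not_integrable_integral_eq norm_zero ennreal_0 zero_le)
  also have "\<dots> \<le> (\<integral>\<^sup>+x. (\<integral>\<^sup>+y. ennreal (cmod (F x) * cmod (F (x - y)) * K y) \<partial>lborel) \<partial>lborel)"
  proof (rule nn_integral_mono)
    fix x
    have "ennreal (norm (fourier \<Psi> x)) \<le> (\<integral>\<^sup>+y. ennreal (norm (cnj (F (x - y)) * of_real (K y))) \<partial>lborel)"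
      unfolding \<Psi>' by (metis integral_norm_bound_ennreal not_integrable_integral_eq norm_zero ennreal_0 zero_le)
    hence "ennreal (cmod (F x)) * ennreal (norm (fourier \<Psi> x)) \<le> ennreal (cmod (F x)) * (\<integral>\<^sup>+y. ennreal (norm (cnj (F (x - y)) * of_real (K y))) \<partial>lborel)"
      by (rule mult_left_mono) simp
    also have "\<dots> = (\<integral>\<^sup>+y. ennreal (cmod (F x)) * ennreal (norm (cnj (F (x - y)) * of_real (K y))) \<partial>lborel)"
      by (rule nn_integral_cmult[symmetric]) measurable
    finally show "ennreal (norm (F x * fourier \<Psi> x)) \<le> (\<integral>\<^sup>+y. ennreal (cmod (F x) * cmod (F (x - y)) * K y) \<partial>lborel)"
      by (simp add: norm_mult K0 ennreal_mult' mult.assoc)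
  qed
  \<comment> \<open>The product of the two values of \<open>F\<close> is split by
    \<open>2 u v \<le> u^2 + v^2\<close>. After exchanging the integrals, translation invariance
    turns each half into \<open>N\<close> and only the mass of \<open>K\<close> remains.\<close>
  also have "\<dots> \<le> (\<integral>\<^sup>+x. (\<integral>\<^sup>+y. ennreal (K y / 2 * (cmod (F x))\<^sup>2) + ennreal (K y / 2 * (cmod (F (x - y)))\<^sup>2) \<partial>lborel) \<partial>lborel)"
  proof (intro nn_integral_mono)
    fix x y
    have "cmod (F x) * cmod (F (x - y)) * K y \<le> K y / 2 * (cmod (F x))\<^sup>2 + K y / 2 * (cmod (F (x - y)))\<^sup>2"
      using mult_right_mono[OF sum_squares_bound[of "cmod (F x)" "cmod (F (x - y))"] K0[of y]]
      by (simp add: algebra_simps)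
    thus "ennreal (cmod (F x) * cmod (F (x - y)) * K y)
       \<le> ennreal (K y / 2 * (cmod (F x))\<^sup>2) + ennreal (K y / 2 * (cmod (F (x - y)))\<^sup>2)"
      using K0[of y] by (simp flip: ennreal_plus)
  qed
  also have "\<dots> = (\<integral>\<^sup>+y. (\<integral>\<^sup>+x. ennreal (K y / 2 * (cmod (F x))\<^sup>2) + ennreal (K y / 2 * (cmod (F (x - y)))\<^sup>2) \<partial>lborel) \<partial>lborel)"
    by (rule lborel_pair.Fubini') measurable
  also have "\<dots> = (\<integral>\<^sup>+y. ennreal (K y) * ennreal N \<partial>lborel)"
  proof (rule nn_integral_cong)
    fix y
    have a: "(\<integral>\<^sup>+x. ennreal ((cmod (F x))\<^sup>2) \<partial>lborel) = ennreal N"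
      unfolding N_def by (rule nn_integral_eq_integral[OF F2]) simp
    have b: "(\<integral>\<^sup>+x. ennreal ((cmod (F (x - y)))\<^sup>2) \<partial>lborel) = ennreal N"
      by (subst nn_integral_translate[of "\<lambda>x. ennreal ((cmod (F x))\<^sup>2)"]) (auto simp: a)
    have "(\<integral>\<^sup>+x. ennreal (K y / 2 * (cmod (F x))\<^sup>2) + ennreal (K y / 2 * (cmod (F (x - y)))\<^sup>2) \<partial>lborel)
       = ennreal (K y / 2) * ennreal N + ennreal (K y / 2) * ennreal N"
    proof -
      have eqs: "ennreal (K y / 2 * (cmod z)\<^sup>2) = ennreal (K y / 2) * ennreal ((cmod z)\<^sup>2)" for z
        using K0[of y] by (intro ennreal_mult) auto
      show ?thesis
        unfolding eqs by (subst nn_integral_add) (simp_all add: nn_integral_cmult a b)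
    qed
    also have "\<dots> = ennreal (K y) * ennreal N"
      using K0[of y] by (simp flip: distrib_right ennreal_plus)
    finally show "(\<integral>\<^sup>+x. ennreal (K y / 2 * (cmod (F x))\<^sup>2) + ennreal (K y / 2 * (cmod (F (x - y)))\<^sup>2) \<partial>lborel) = ennreal (K y) * ennreal N" .
  qed
  also have "\<dots> = ennreal ((2 * pi) ^ DIM('a) * N)"
    by (subst nn_integral_multc) (auto simp: massK ennreal_mult')
  finally have "ennreal \<bar>I\<bar> \<le> ennreal ((2 * pi) ^ DIM('a) * N)" by simp
  moreover have "(\<integral>\<^sup>+\<xi>. ennreal (gaussian (\<lambda>_. e) \<xi> * (cmod (fourier F \<xi>))\<^sup>2) \<partial>lborel) = ennreal I"
    unfolding I_def by (rule nn_integral_eq_integral[OF int]) (auto simp: gaussian_pos less_imp_le)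
  ultimately show ?thesis
    using ennreal_leI[of I "\<bar>I\<bar>"] by (simp add: N_def)
qed

text \<open>Fatou's lemma along the damping parameters \<open>1 / Suc n\<close>: the Gaussian factor
  tends to 1 while the bound does not depend on it.\<close>

lemma
  fixes F :: "'a::euclidean_space \<Rightarrow> complex"
  assumes F: "integrable lborel F" and F2: "integrable lborel (\<lambda>x. (cmod (F x))\<^sup>2)"
  shows plancherel_integrable: "integrable lborel (\<lambda>\<xi>. (cmod (fourier F \<xi>))\<^sup>2)"
    and plancherel_le: "(\<integral>\<xi>. (cmod (fourier F \<xi>))\<^sup>2 \<partial>lborel)
      \<le> (2 * pi) ^ DIM('a) * (\<integral>x. (cmod (F x))\<^sup>2 \<partial>lborel)"
proof -
  have [measurable]: "F \<in> borel_measurable borel" using borel_measurable_integrable[OF F] by simp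
  define C where "C = (2 * pi) ^ DIM('a) * (\<integral>x. (cmod (F x))\<^sup>2 \<partial>lborel)"
  have C0: "C \<ge> 0" by (simp add: C_def)
  define G where "G n \<xi> = gaussian (\<lambda>_. 1 / real (Suc n)) \<xi> * (cmod (fourier F \<xi>))\<^sup>2" for n \<xi>
  have lim: "(\<lambda>n. ennreal (G n \<xi>)) \<longlonglongrightarrow> ennreal ((cmod (fourier F \<xi>))\<^sup>2)" for \<xi>
  proof -
    have "(\<lambda>n. exp (- ((1 / real (Suc n)) * (norm \<xi>)\<^sup>2)) * (cmod (fourier F \<xi>))\<^sup>2) \<longlonglongrightarrow> exp (- (0 * (norm \<xi>)\<^sup>2)) * (cmod (fourier F \<xi>))\<^sup>2"
      by (intro tendsto_intros LIMSEQ_Suc[OF lim_1_over_n])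
    thus ?thesis by (intro tendsto_ennrealI) (simp add: G_def gaussian_const)
  qed
  have "(\<integral>\<^sup>+\<xi>. ennreal ((cmod (fourier F \<xi>))\<^sup>2) \<partial>lborel) = (\<integral>\<^sup>+\<xi>. liminf (\<lambda>n. ennreal (G n \<xi>)) \<partial>lborel)"
    using lim by (intro nn_integral_cong) (metis lim_imp_Liminf trivial_limit_sequentially)
  also have "\<dots> \<le> liminf (\<lambda>n. \<integral>\<^sup>+\<xi>. ennreal (G n \<xi>) \<partial>lborel)"
    by (rule nn_integral_liminf) (auto simp: G_def)
  also have "\<dots> \<le> liminf (\<lambda>n::nat. ennreal C)"
    unfolding G_def C_def
    by (intro Liminf_mono always_eventually allI plancherel_gaussian_le F F2) simp
  finally have le: "(\<integral>\<^sup>+\<xi>. ennreal ((cmod (fourier F \<xi>))\<^sup>2) \<partial>lborel) \<le> ennreal C" by (simp add: Liminf_const)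
  show int: "integrable lborel (\<lambda>\<xi>. (cmod (fourier F \<xi>))\<^sup>2)"
    by (rule integrableI_bounded) (auto intro: le_less_trans[OF le])
  show "(\<integral>\<xi>. (cmod (fourier F \<xi>))\<^sup>2 \<partial>lborel) \<le> (2 * pi) ^ DIM('a) * (\<integral>x. (cmod (F x))\<^sup>2 \<partial>lborel)"
    using le C0 by (subst (asm) nn_integral_eq_integral[OF int]) (auto simp del: power_mult_distrib simp: C_def)
qed

section \<open>Polar coordinates in the plane\<close>

definition e1 :: "real^2" where "e1 = axis 1 1"
definition e2 :: "real^2" where "e2 = axis 2 1"
text \<open>Rotation by a right angle, taking \<open>e1\<close> to \<open>e2\<close> and
  \<open>e2\<close> to \<open>- e1\<close>.\<close>

definition J :: "real^2 \<Rightarrow> real^2" where "J v = (v \<bullet> e1) *\<^sub>R e2 - (v \<bullet> e2) *\<^sub>R e1"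

definition rot :: "real \<Rightarrow> real^2 \<Rightarrow> real^2" where
  "rot \<phi> v = cos \<phi> *\<^sub>R v + sin \<phi> *\<^sub>R J v"

definition dir :: "real \<Rightarrow> real^2" where
  "dir \<theta> = cos \<theta> *\<^sub>R e1 + sin \<theta> *\<^sub>R e2"

lemma e12 [simp]: "e1 \<bullet> e1 = 1" "e2 \<bullet> e2 = 1" "e1 \<bullet> e2 = 0" "e2 \<bullet> e1 = 0"
  by (auto simp: e1_def e2_def inner_axis_axis)

lemma e12_expand: "v = (v \<bullet> e1) *\<^sub>R e1 + (v \<bullet> e2) *\<^sub>R e2"
  by (simp add: e1_def e2_def vec_eq_iff forall_2 inner_axis) (simp add: axis_def)

lemma inner_e12: "v \<bullet> w = (v \<bullet> e1) * (w \<bullet> e1) + (v \<bullet> e2) * (w \<bullet> e2)"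
  unfolding e1_def e2_def inner_axis by (simp add: inner_vec_def sum_2)

lemma rot_e12: "rot \<phi> v \<bullet> e1 = cos \<phi> * (v \<bullet> e1) - sin \<phi> * (v \<bullet> e2)"
  "rot \<phi> v \<bullet> e2 = sin \<phi> * (v \<bullet> e1) + cos \<phi> * (v \<bullet> e2)"
  by (simp_all add: rot_def J_def algebra_simps)

lemma dir_e12 [simp]: "dir \<theta> \<bullet> e1 = cos \<theta>" "dir \<theta> \<bullet> e2 = sin \<theta>"
  by (simp_all add: dir_def algebra_simps)

lemma eq_e12_iff: "v = w \<longleftrightarrow> v \<bullet> e1 = w \<bullet> e1 \<and> v \<bullet> e2 = w \<bullet> e2"
  using e12_expand[of v] e12_expand[of w] by metis

lemma norm_dir [simp]: "norm (dir \<theta>) = 1"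
  unfolding norm_eq_1 by (subst inner_e12) (simp add: power2_eq_square[symmetric])

lemma rot_dir: "rot \<phi> (r *\<^sub>R dir \<theta>) = r *\<^sub>R dir (\<phi> + \<theta>)"
  by (simp add: eq_e12_iff rot_e12 cos_add sin_add algebra_simps)

lemma polar_form: obtains \<psi> where "b = norm b *\<^sub>R dir \<psi>"
proof (cases "b = 0")
  case True thus ?thesis using that[of 0] by simp
next
  case False
  have "(norm b)\<^sup>2 = (b \<bullet> e1)\<^sup>2 + (b \<bullet> e2)\<^sup>2"
    unfolding power2_norm_eq_inner by (subst inner_e12) (simp add: power2_eq_square)
  hence "((b \<bullet> e1) / norm b)\<^sup>2 + ((b \<bullet> e2) / norm b)\<^sup>2 = (norm b)\<^sup>2 / (norm b)\<^sup>2"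
    by (simp only: power_divide add_divide_distrib)
  hence "((b \<bullet> e1) / norm b)\<^sup>2 + ((b \<bullet> e2) / norm b)\<^sup>2 = 1" using False by simp
  then obtain \<psi> where "(b \<bullet> e1) / norm b = cos \<psi>" "(b \<bullet> e2) / norm b = sin \<psi>"
    using sincos_total_2pi by metis
  hence "b \<bullet> e1 = norm b * cos \<psi>" "b \<bullet> e2 = norm b * sin \<psi>"
    using False by (simp_all flip: \<open>_ = cos \<psi>\<close> \<open>_ = sin \<psi>\<close>)
  hence "b = norm b *\<^sub>R dir \<psi>" by (subst eq_e12_iff) simp
  thus ?thesis by (rule that)
qed

lemma linear_rot: "linear (rot \<phi>)"
  by (rule linearI) (simp_all add: eq_e12_iff rot_e12 inner_add_left algebra_simps)

lemma norm_rot [simp]: "norm (rot \<phi> v) = norm v"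
proof -
  obtain \<psi> where "v = norm v *\<^sub>R dir \<psi>" by (rule polar_form)
  hence "norm (rot \<phi> v) = norm (norm v *\<^sub>R dir (\<phi> + \<psi>))" by (metis rot_dir)
  thus ?thesis by simp
qed

lemma rot_rot [simp]: "rot \<phi> (rot \<psi> v) = rot (\<phi> + \<psi>) v"
  by (simp add: eq_e12_iff rot_e12 cos_add sin_add algebra_simps)

lemma rot_0 [simp]: "rot 0 v = v" by (simp add: rot_def)

lemma J_measurable [measurable]: "J \<in> borel_measurable borel"
  unfolding J_def[abs_def] by measurable

lemma rot_measurable [measurable]:
  assumes [measurable]: "f \<in> borel_measurable M" "g \<in> borel_measurable M"
  shows "(\<lambda>x. rot (f x) (g x)) \<in> borel_measurable M"
  unfolding rot_def[abs_def] by measurable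

lemma dir_measurable [measurable]: "dir \<in> borel_measurable borel"
  unfolding dir_def[abs_def] by measurable

text \<open>The measures are compared on boxes. The preimage of a box under
  \<open>rot \<phi>\<close> is its image under \<open>rot (- \<phi>)\<close>, an orthogonal map,
  which preserves Lebesgue measure.\<close>

lemma lborel_distr_rot: "distr lborel borel (rot \<phi>) = lborel"
proof (rule lborel_eqI[symmetric])
  fix l u :: "real^2" assume lu: "\<And>b. b \<in> Basis \<Longrightarrow> l \<bullet> b \<le> u \<bullet> b"
  have orth: "orthogonal_transformation (rot (- \<phi>))"
    by (simp add: orthogonal_transformation linear_rot)
  have im: "rot \<phi> -` box l u = rot (- \<phi>) ` box l u"
  proof (intro equalityI subsetI)
    fix v assume "v \<in> rot \<phi> -` box l u"
    thus "v \<in> rot (- \<phi>) ` box l u" by (intro image_eqI[of _ _ "rot \<phi> v"]) auto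
  qed auto
  have "box l u \<in> lmeasurable" by (intro lmeasurable_open bounded_box open_box)
  note lm = measurable_orthogonal_image[OF orth this] and eq = measure_orthogonal_image[OF orth this]
  have "rot \<phi> -` box l u \<in> sets borel"
    using measurable_sets[of "rot \<phi>" borel borel "box l u"] by simp
  hence "emeasure (distr lborel borel (rot \<phi>)) (box l u) = emeasure lebesgue (rot (- \<phi>) ` box l u)"
    by (simp add: emeasure_distr im)
  also have "\<dots> = ennreal (measure lebesgue (box l u))"
    by (simp only: emeasure_eq_measure2[OF lm] eq)
  also have "\<dots> = ennreal (\<Prod>b\<in>Basis. (u - l) \<bullet> b)"
    using lu by (simp only: measure_completion box_borel measure_lborel_box sets_lborel)
  finally show "emeasure (distr lborel borel (rot \<phi>)) (box l u) = ennreal (\<Prod>b\<in>Basis. (u - l) \<bullet> b)" .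
qed simp

lemma nn_integral_rot:
  assumes [measurable]: "f \<in> borel_measurable borel"
  shows "(\<integral>\<^sup>+v. f (rot \<phi> v) \<partial>lborel) = (\<integral>\<^sup>+v. f v \<partial>lborel)"
  using nn_integral_distr[of "rot \<phi>" lborel borel f] by (simp add: lborel_distr_rot)

text \<open>Arc length on the unit circle, expressed in the variable of \<open>dir\<close> and not
  normalised: many of the factors \<open>2 * pi\<close> below are its total mass.\<close>

definition angle :: "real measure" where
  "angle = density lborel (indicator {0..<2 * pi})"

lemma space_angle [simp]: "space angle = UNIV" and sets_angle [simp, measurable_cong]: "sets angle = sets borel"
  by (auto simp: angle_def)

lemma nn_integral_angle:
  "f \<in> borel_measurable borel \<Longrightarrow> (\<integral>\<^sup>+\<theta>. f \<theta> \<partial>angle) = (\<integral>\<^sup>+\<theta>. f \<theta> * indicator {0..<2*pi} \<theta> \<partial>lborel)"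
  unfolding angle_def by (subst nn_integral_density) (auto simp: mult.commute)

lemma emeasure_angle [simp]: "emeasure angle UNIV = ennreal (2 * pi)"
  by (simp add: angle_def emeasure_density)

interpretation angle: finite_measure angle
  by (rule finite_measureI) simp

lemma measure_angle [simp]: "measure angle UNIV = 2 * pi"
  by (simp add: measure_def)

text \<open>The shift is first reduced modulo \<open>2 * pi\<close> to some \<open>\<psi>'\<close>
  in one period. The shifted window is then cut at \<open>2 * pi\<close>, and the part beyond is
  moved back by one period.\<close>

lemma nn_integral_angle_shift:
  assumes [measurable]: "f \<in> borel_measurable borel" and per: "\<And>\<theta>. f (\<theta> + 2 * pi) = f \<theta>"
  shows "(\<integral>\<^sup>+\<theta>. f (\<theta> + \<psi>) \<partial>angle) = (\<integral>\<^sup>+\<theta>. f \<theta> \<partial>angle)"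
proof -
  have pern: "f (\<theta> + 2 * pi * real n) = f \<theta>" for \<theta> n
  proof (induction n)
    case (Suc n)
    have "f (\<theta> + 2 * pi * real (Suc n)) = f ((\<theta> + 2 * pi * real n) + 2 * pi)" by (simp add: algebra_simps)
    thus ?case by (simp only: per Suc)
  qed simp
  have per': "f (\<theta> + 2 * pi * of_int k) = f \<theta>" for \<theta> k
  proof (cases "k \<ge> 0")
    case True thus ?thesis using pern[of \<theta> "nat k"] by simp
  next
    case False thus ?thesis using pern[of "\<theta> + 2 * pi * of_int k" "nat (-k)"] by simp
  qed
  have per2: "f (2 * pi + \<theta>) = f \<theta>" for \<theta> using per[of \<theta>] by (simp add: add.commute)
  define k where "k = \<lfloor>\<psi> / (2 * pi)\<rfloor>"
  define \<psi>' where "\<psi>' = \<psi> - 2 * pi * of_int k"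
  have "of_int k \<le> \<psi> / (2 * pi)" "\<psi> / (2 * pi) < of_int k + 1"
    unfolding k_def by linarith+
  hence \<psi>': "0 \<le> \<psi>'" "\<psi>' < 2 * pi" by (auto simp: \<psi>'_def field_simps)
  have eq: "f (\<theta> + \<psi>) = f (\<psi>' + \<theta>)" for \<theta>
    using per'[of "\<psi>' + \<theta>" k] by (simp add: \<psi>'_def algebra_simps)
  have "(\<integral>\<^sup>+\<theta>. f (\<theta> + \<psi>) \<partial>angle) = (\<integral>\<^sup>+\<theta>. f (\<psi>' + \<theta>) * indicator {\<psi>'..<2*pi + \<psi>'} (\<psi>' + \<theta>) \<partial>lborel)"
    unfolding eq by (subst nn_integral_angle, measurable) (auto intro!: nn_integral_cong split: split_indicator)
  also have "\<dots> = (\<integral>\<^sup>+\<theta>. f \<theta> * indicator {\<psi>'..<2*pi + \<psi>'} \<theta> \<partial>lborel)"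
    using nn_integral_real_affine[of "\<lambda>\<theta>. f \<theta> * indicator {\<psi>'..<2*pi + \<psi>'} \<theta>" 1 \<psi>'] by simp
  also have "\<dots> = (\<integral>\<^sup>+\<theta>. f \<theta> * indicator {\<psi>'..<2*pi} \<theta> + f \<theta> * indicator {2*pi..<2*pi + \<psi>'} \<theta> \<partial>lborel)"
    using \<psi>' by (intro nn_integral_cong) (auto split: split_indicator)
  also have "\<dots> = (\<integral>\<^sup>+\<theta>. f \<theta> * indicator {\<psi>'..<2*pi} \<theta> \<partial>lborel) + (\<integral>\<^sup>+\<theta>. f \<theta> * indicator {2*pi..<2*pi + \<psi>'} \<theta> \<partial>lborel)"
    by (rule nn_integral_add) measurable
  also have "(\<integral>\<^sup>+\<theta>. f \<theta> * indicator {2*pi..<2*pi + \<psi>'} \<theta> \<partial>lborel) = (\<integral>\<^sup>+\<theta>. f \<theta> * indicator {0..<\<psi>'} \<theta> \<partial>lborel)"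
    by (subst nn_integral_real_affine[where c=1 and t="2*pi"])
       (auto intro!: nn_integral_cong simp: per2 split: split_indicator)
  also have "(\<integral>\<^sup>+\<theta>. f \<theta> * indicator {\<psi>'..<2*pi} \<theta> \<partial>lborel) + (\<integral>\<^sup>+\<theta>. f \<theta> * indicator {0..<\<psi>'} \<theta> \<partial>lborel)
      = (\<integral>\<^sup>+\<theta>. f \<theta> * indicator {\<psi>'..<2*pi} \<theta> + f \<theta> * indicator {0..<\<psi>'} \<theta> \<partial>lborel)"
    by (rule nn_integral_add[symmetric]) measurable
  also have "\<dots> = (\<integral>\<^sup>+\<theta>. f \<theta> \<partial>angle)"
    unfolding nn_integral_angle[OF assms(1)]
    using \<psi>' by (intro nn_integral_cong) (auto split: split_indicator)
  finally show ?thesis .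
qed

lemma dir_periodic [simp]: "dir (\<theta> + 2 * pi) = dir \<theta>"
  by (simp add: dir_def)

text \<open>Stated for image measures so that the invariance, available for nonnegative integrands,
  reaches Bochner integrals as well.\<close>

lemma distr_angle_dir_shift: "distr angle borel (\<lambda>\<theta>. dir (\<theta> + \<psi>)) = distr angle borel dir"
proof (rule measure_eqI)
  fix A assume "A \<in> sets (distr angle borel (\<lambda>\<theta>. dir (\<theta> + \<psi>)))"
  hence [measurable]: "A \<in> sets borel" by simp
  have "emeasure (distr angle borel (\<lambda>\<theta>. dir (\<theta> + \<psi>))) A = (\<integral>\<^sup>+\<theta>. indicator A (dir (\<theta> + \<psi>)) \<partial>angle)"
    by (subst nn_integral_indicator[symmetric], simp, subst nn_integral_distr) auto
  also have "\<dots> = (\<integral>\<^sup>+\<theta>. indicator A (dir \<theta>) \<partial>angle)"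
    by (rule nn_integral_angle_shift[of "\<lambda>\<theta>. indicator A (dir \<theta>)"]) auto
  also have "\<dots> = emeasure (distr angle borel dir) A"
    by (subst nn_integral_indicator[of A, symmetric], simp, subst nn_integral_distr) auto
  finally show "emeasure (distr angle borel (\<lambda>\<theta>. dir (\<theta> + \<psi>))) A = emeasure (distr angle borel dir) A" .
qed simp

text \<open>If \<psi> is the polar angle of \<open>v\<close>, rotating by \<theta> gives the angle
  \<theta> + \<psi>, and the shift by \<psi> is absorbed by periodicity.\<close>

lemma nn_integral_angle_rot:
  assumes [measurable]: "f \<in> borel_measurable borel"
  shows "(\<integral>\<^sup>+\<theta>. f (rot \<theta> v) \<partial>angle) = (\<integral>\<^sup>+\<theta>. f (norm v *\<^sub>R dir \<theta>) \<partial>angle)"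
proof -
  obtain \<psi> where "v = norm v *\<^sub>R dir \<psi>" by (rule polar_form)
  hence "rot \<theta> v = norm v *\<^sub>R dir (\<theta> + \<psi>)" for \<theta> by (metis rot_dir)
  thus ?thesis
    by (simp add: nn_integral_angle_shift[of "\<lambda>\<theta>. f (norm v *\<^sub>R dir \<theta>)"])
qed

lemma integral_angle_rot:
  fixes f :: "real^2 \<Rightarrow> 'b::{banach,second_countable_topology}"
  assumes [measurable]: "f \<in> borel_measurable borel"
  shows "(\<integral>\<theta>. f (rot \<theta> v) \<partial>angle) = (\<integral>\<theta>. f (norm v *\<^sub>R dir \<theta>) \<partial>angle)"
proof -
  obtain \<psi> where "v = norm v *\<^sub>R dir \<psi>" by (rule polar_form)
  hence "rot \<theta> v = norm v *\<^sub>R dir (\<theta> + \<psi>)" for \<theta> by (metis rot_dir)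
  hence "(\<integral>\<theta>. f (rot \<theta> v) \<partial>angle) = (\<integral>w. f (norm v *\<^sub>R w) \<partial>distr angle borel (\<lambda>\<theta>. dir (\<theta> + \<psi>)))"
    by (subst integral_distr) auto
  also have "\<dots> = (\<integral>\<theta>. f (norm v *\<^sub>R dir \<theta>) \<partial>angle)"
    unfolding distr_angle_dir_shift by (subst integral_distr) auto
  finally show ?thesis .
qed

text \<open>The disc of radius \<open>sqrt a\<close> has area \<open>pi * a\<close>, so the squared
  radius has constant density. This is why squared norms serve as coordinates from here on.\<close>

lemma distr_norm_squared:
  "distr lborel borel (\<lambda>b::real^2. (norm b)\<^sup>2) = density lborel (\<lambda>r. ennreal pi * indicator {0<..} r)"
proof (rule measure_eqI_generator_eq)
  show "Int_stable (range (\<lambda>a::real. {..a}))" by (auto simp: Int_stable_def)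
  show "range (\<lambda>a::real. {..a}) \<subseteq> Pow UNIV" by auto
  show "sets (distr lborel borel (\<lambda>b::real^2. (norm b)\<^sup>2)) = sigma_sets UNIV (range (\<lambda>a::real. {..a}))"
    by (simp add: borel_eq_atMost)
  show "sets (density lborel (\<lambda>r. ennreal pi * indicator {0<..} r)) = sigma_sets UNIV (range (\<lambda>a::real. {..a}))"
    by (simp add: borel_eq_atMost)
  have eq: "emeasure (distr lborel borel (\<lambda>b::real^2. (norm b)\<^sup>2)) {..a} = ennreal (pi * a)" if "a \<ge> 0" for a :: real
  proof -
    have "(\<lambda>b::real^2. (norm b)\<^sup>2) -` {..a} = cball 0 (sqrt a)"
      using that by (auto simp: real_le_rsqrt sqrt_ge_absD real_le_rsqrt dest: real_sqrt_le_mono)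
    thus ?thesis using that
      by (simp add: emeasure_distr emeasure_cball unit_ball_vol_even[of 1, simplified])
  qed
  have neg: "emeasure (distr lborel borel (\<lambda>b::real^2. (norm b)\<^sup>2)) {..a} = 0" if "a < 0" for a :: real
  proof -
    have "(\<lambda>b::real^2. (norm b)\<^sup>2) -` {..a} = {}"
    proof -
      have "\<not> (norm b)\<^sup>2 \<le> a" for b :: "real^2"
        using that zero_le_power2[of "norm b"] by linarith
      thus ?thesis by auto
    qed
    thus ?thesis by (simp add: emeasure_distr)
  qed
  show "range (\<lambda>n::nat. {..real n}) \<subseteq> range (\<lambda>a::real. {..a})" by auto
  show "(\<Union>n::nat. {..real n}) = UNIV" using real_arch_simple by auto
  show "emeasure (distr lborel borel (\<lambda>b::real^2. (norm b)\<^sup>2)) {..real n} \<noteq> \<infinity>" for n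
    by (simp add: eq)
  fix X assume "X \<in> range (\<lambda>a::real. {..a})"
  then obtain a where X: "X = {..a}" by auto
  have "emeasure (density lborel (\<lambda>r. ennreal pi * indicator {0<..} r)) {..a} = (\<integral>\<^sup>+r. ennreal pi * indicator {0<..a} r \<partial>lborel)"
    by (subst emeasure_density) (auto intro!: nn_integral_cong split: split_indicator)
  also have "\<dots> = ennreal pi * emeasure lborel {0<..a}" by (subst nn_integral_cmult_indicator) auto
  also have "\<dots> = (if a \<ge> 0 then ennreal (pi * a) else 0)" by (auto simp: ennreal_mult')
  finally show "emeasure (distr lborel borel (\<lambda>b::real^2. (norm b)\<^sup>2)) X = emeasure (density lborel (\<lambda>r. ennreal pi * indicator {0<..} r)) X"
    using eq neg by (auto simp: X)
qed

lemma nn_integral_norm_squared: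
  assumes [measurable]: "f \<in> borel_measurable borel"
  shows "(\<integral>\<^sup>+b. f ((norm (b::real^2))\<^sup>2) \<partial>lborel) = ennreal pi * (\<integral>\<^sup>+r. f r * indicator {0<..} r \<partial>lborel)"
proof -
  have "(\<integral>\<^sup>+b. f ((norm (b::real^2))\<^sup>2) \<partial>lborel) = (\<integral>\<^sup>+r. f r \<partial>distr lborel borel (\<lambda>b::real^2. (norm b)\<^sup>2))"
    by (subst nn_integral_distr) auto
  also have "\<dots> = (\<integral>\<^sup>+r. ennreal pi * (f r * indicator {0<..} r) \<partial>lborel)"
    unfolding distr_norm_squared by (subst nn_integral_density) (auto simp: mult_ac)
  also have "\<dots> = ennreal pi * (\<integral>\<^sup>+r. f r * indicator {0<..} r \<partial>lborel)" by (rule nn_integral_cmult) auto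
  finally show ?thesis .
qed

interpretation angle_lborel: pair_sigma_finite angle "lborel :: 'a::euclidean_space measure" ..

text \<open>Rotation invariance allows \<open>G\<close> to be averaged over all rotations; the
  average depends on the norm only, and the squared norm has density \<open>pi\<close>. The factor
  \<open>1/2\<close> is \<open>pi\<close> divided by the mass \<open>2 * pi\<close> of the
  circle.\<close>

lemma nn_integral_polar:
  assumes [measurable]: "G \<in> borel_measurable borel"
  shows "(\<integral>\<^sup>+b. G (b::real^2) \<partial>lborel)
    = (\<integral>\<^sup>+r. (\<integral>\<^sup>+\<theta>. ennreal (1/2) * G (sqrt r *\<^sub>R dir \<theta>) \<partial>angle) * indicator {0<..} r \<partial>lborel)"
proof -
  have "ennreal (2 * pi) * (\<integral>\<^sup>+b. G b \<partial>lborel) = (\<integral>\<^sup>+\<theta>. (\<integral>\<^sup>+b. G (rot \<theta> b) \<partial>lborel) \<partial>angle)"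
    by (simp add: nn_integral_rot mult.commute)
  also have "\<dots> = (\<integral>\<^sup>+b. (\<integral>\<^sup>+\<theta>. G (rot \<theta> b) \<partial>angle) \<partial>lborel)"
    by (rule angle_lborel.Fubini'[symmetric]) measurable
  also have "\<dots> = (\<integral>\<^sup>+b. (\<integral>\<^sup>+\<theta>. G (sqrt ((norm (b::real^2))\<^sup>2) *\<^sub>R dir \<theta>) \<partial>angle) \<partial>lborel)"
    by (simp add: nn_integral_angle_rot)
  also have "\<dots> = ennreal pi * (\<integral>\<^sup>+r. (\<integral>\<^sup>+\<theta>. G (sqrt r *\<^sub>R dir \<theta>) \<partial>angle) * indicator {0<..} r \<partial>lborel)"
    by (rule nn_integral_norm_squared) measurable
  also have "\<dots> = ennreal (2 * pi) * (ennreal (1/2) * (\<integral>\<^sup>+r. (\<integral>\<^sup>+\<theta>. G (sqrt r *\<^sub>R dir \<theta>) \<partial>angle) * indicator {0<..} r \<partial>lborel))"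
  proof -
    have "ennreal (2 * pi) * ennreal (1/2) = ennreal pi" by (subst ennreal_mult[symmetric]) auto
    thus ?thesis by (simp only: mult.assoc[symmetric])
  qed
  finally have "(\<integral>\<^sup>+b. G b \<partial>lborel) = ennreal (1/2) * (\<integral>\<^sup>+r. (\<integral>\<^sup>+\<theta>. G (sqrt r *\<^sub>R dir \<theta>) \<partial>angle) * indicator {0<..} r \<partial>lborel)"
    by (subst (asm) ennreal_mult_cancel_left) auto
  also have "\<dots> = (\<integral>\<^sup>+r. (\<integral>\<^sup>+\<theta>. ennreal (1/2) * G (sqrt r *\<^sub>R dir \<theta>) \<partial>angle) * indicator {0<..} r \<partial>lborel)"
    by (subst nn_integral_cmult[symmetric], measurable)
       (auto intro!: nn_integral_cong simp: nn_integral_cmult mult.assoc)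
  finally show ?thesis .
qed

section \<open>The diagonal restriction as a Fourier transform\<close>

text \<open>The squared difference is expanded and the cross term integrates to
  \<open>(cmod (\<integral>x. f x \<partial>M))\<^sup>2\<close>. This is Cauchy-Schwarz against the
  constant 1 with its exact defect; both the defect on circles and the plain inequality are used
  later.\<close>

lemma
  fixes f :: "'a \<Rightarrow> complex"
  assumes "finite_measure M" and [measurable]: "f \<in> borel_measurable M"
    and f2: "integrable M (\<lambda>x. (cmod (f x))\<^sup>2)"
  shows variance_identity: "(\<integral>x. (\<integral>y. (cmod (f x - f y))\<^sup>2 \<partial>M) \<partial>M)
      = 2 * (measure M (space M) * (\<integral>x. (cmod (f x))\<^sup>2 \<partial>M) - (cmod (\<integral>x. f x \<partial>M))\<^sup>2)"
    and variance_integrable: "integrable M (\<lambda>y. (cmod (f x - f y))\<^sup>2)"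
proof -
  interpret finite_measure M by fact
  have f: "integrable M f"
  proof (rule Bochner_Integration.integrable_bound)
    show "integrable M (\<lambda>x. 1 + (cmod (f x))\<^sup>2)" using f2 by auto
    have "cmod (f x) \<le> 1 + (cmod (f x))\<^sup>2" for x
    proof -
      have "2 * cmod (f x) \<le> 1 + (cmod (f x))\<^sup>2" using sum_squares_bound[of 1 "cmod (f x)"] by simp
      thus ?thesis using norm_ge_zero[of "f x"] by linarith
    qed
    thus "AE x in M. norm (f x) \<le> norm (1 + (cmod (f x))\<^sup>2)" by (intro AE_I2) simp
  qed simp
  define R where "R a b = Re (a * cnj b)" for a b
  have eq: "(cmod (a - b))\<^sup>2 = (cmod a)\<^sup>2 + (cmod b)\<^sup>2 - 2 * R a b" for a b
    unfolding cmod_power2 R_def by (simp add: power2_eq_square algebra_simps)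
  have int: "integrable M (\<lambda>y. R (f x) (f y))" for x
    unfolding R_def by (intro integrable_Re integrable_mult_right integrable_cnj f)
  show "integrable M (\<lambda>y. (cmod (f x - f y))\<^sup>2)" for x
    unfolding eq using f2 int by auto
  define I where "I = (\<integral>x. f x \<partial>M)"
  define N where "N = (\<integral>x. (cmod (f x))\<^sup>2 \<partial>M)"
  have inner: "(\<integral>y. (cmod (f x - f y))\<^sup>2 \<partial>M) = measure M (space M) * (cmod (f x))\<^sup>2 + N - 2 * R (f x) I" for x
  proof -
    have "(\<integral>y. R (f x) (f y) \<partial>M) = Re (\<integral>y. f x * cnj (f y) \<partial>M)"
      unfolding R_def using f by (intro integral_Re integrable_mult_right integrable_cnj)
    also have "\<dots> = R (f x) I"
      by (simp only: I_def R_def integral_mult_right_zero Bochner_Integration.integral_cnj)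
    finally show ?thesis unfolding eq using f2 int[of x]
      by (simp add: N_def mult.commute)
  qed
  have int': "integrable M (\<lambda>x. R (f x) I)"
    unfolding R_def by (intro integrable_Re integrable_mult_left f)
  have "(\<integral>x. R (f x) I \<partial>M) = Re (\<integral>x. f x * cnj I \<partial>M)"
    unfolding R_def using f by (intro integral_Re integrable_mult_left)
  also have "\<dots> = Re (I * cnj I)" by (simp only: I_def integral_mult_left_zero)
  also have "\<dots> = (cmod I)\<^sup>2" unfolding cmod_power2 by (simp add: power2_eq_square)
  finally have "(\<integral>x. measure M (space M) * (cmod (f x))\<^sup>2 + N - 2 * R (f x) I \<partial>M)
     = measure M (space M) * N + measure M (space M) * N - 2 * (cmod I)\<^sup>2"
    using f2 int' by (simp add: N_def mult.commute)
  thus "(\<integral>x. (\<integral>y. (cmod (f x - f y))\<^sup>2 \<partial>M) \<partial>M)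
      = 2 * (measure M (space M) * (\<integral>x. (cmod (f x))\<^sup>2 \<partial>M) - (cmod (\<integral>x. f x \<partial>M))\<^sup>2)"
    unfolding inner by (simp add: N_def I_def)
qed

section \<open>Frequency coordinates adapted to the diagonal\<close>

lemma fst_borel_pair [measurable]: "fst \<in> borel_measurable (borel :: ('a::euclidean_space \<times> 'b::euclidean_space) measure)"
  and snd_borel_pair [measurable]: "snd \<in> borel_measurable (borel :: ('a::euclidean_space \<times> 'b::euclidean_space) measure)"
  by (intro borel_measurable_continuous_onI continuous_intros)+

lemma borel_measurable_case_prod_compose:
  assumes K: "case_prod K \<in> borel_measurable (borel \<Otimes>\<^sub>M borel)"
    and [measurable]: "f \<in> borel_measurable N" "g \<in> borel_measurable N"
  shows "(\<lambda>x. K (f x) (g x)) \<in> borel_measurable N"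
  using measurable_compose[of "\<lambda>x. (f x, g x)" N "borel \<Otimes>\<^sub>M borel" "case_prod K" borel] K by simp

text \<open>
  Coordinates \<open>(a, q, \<theta>)\<close> on the frequency space: \<open>- a = \<xi> + \<eta>\<close> and \<open>q = |\<xi>|\<^sup>2 + |\<eta>|\<^sup>2\<close> are the
  frequencies of the restriction to the diagonal, and \<open>\<theta>\<close> is the direction of \<open>\<xi> - \<eta>\<close>.
\<close>

definition cpt :: "(real^2) \<times> real \<Rightarrow> real \<Rightarrow> (real^2) \<times> (real^2)" where
  "cpt p \<theta> = (let b = sqrt (2 * snd p - (norm (fst p))\<^sup>2) *\<^sub>R dir \<theta>
     in ((1/2) *\<^sub>R (b - fst p), (1/2) *\<^sub>R (- fst p - b)))"

text \<open>Density of Lebesgue measure in the coordinates \<open>(a, q, \<theta>)\<close>,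
  supported where the circle has positive radius. The value is the product of \<open>1/4\<close>
  (halving in the plane, \<xi> = (b - a) / 2), \<open>1/2\<close> (polar coordinates for
  \<open>b\<close>) and \<open>2\<close> (slope of the squared radius as a function of
  \<open>q\<close>).\<close>

definition wt :: "(real^2) \<times> real \<Rightarrow> real" where
  "wt p = (if (norm (fst p))\<^sup>2 < 2 * snd p then 1/4 else 0)"

lemma wt_nonneg [simp]: "wt p \<ge> 0" by (simp add: wt_def)

lemma cpt_measurable [measurable]:
  assumes [measurable]: "f \<in> borel_measurable M" "g \<in> borel_measurable M"
  shows "(\<lambda>x. cpt (f x) (g x)) \<in> borel_measurable M"
  unfolding cpt_def[abs_def] Let_def by measurable

lemma wt_measurable [measurable]: "wt \<in> borel_measurable borel"
  unfolding wt_def[abs_def] by measurable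

text \<open>For fixed \<xi> the variable \<eta> is traded for a = - \<xi> - \<eta>; for fixed
  \<open>a\<close> the remaining variable is b = \<xi> - \<eta>, which is put into polar
  coordinates.\<close>

lemma nn_integral_cpt_iterated:
  assumes [measurable]: "G \<in> borel_measurable borel"
  shows "(\<integral>\<^sup>+z. G z \<partial>lborel) = (\<integral>\<^sup>+a. \<integral>\<^sup>+q. (\<integral>\<^sup>+\<theta>. ennreal (wt (a, q)) * G (cpt (a, q) \<theta>) \<partial>angle) \<partial>lborel \<partial>lborel)"
proof -
  have [measurable]: "(\<lambda>p. G (f p, g p)) \<in> borel_measurable M"
    if [measurable]: "f \<in> borel_measurable M" "g \<in> borel_measurable M" for f g and M :: "'b measure"
    by measurable
  have "(\<integral>\<^sup>+z. G z \<partial>lborel) = (\<integral>\<^sup>+\<xi>. \<integral>\<^sup>+\<eta>. G (\<xi>, \<eta>) \<partial>lborel \<partial>lborel)"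
    unfolding lborel_prod[symmetric] by (subst lborel.nn_integral_fst[symmetric]) (simp_all add: lborel_prod)
  also have "\<dots> = (\<integral>\<^sup>+\<xi>. \<integral>\<^sup>+a. G (\<xi>, - \<xi> - a) \<partial>lborel \<partial>lborel)"
    by (intro nn_integral_cong nn_integral_reflect[symmetric]) measurable
  also have "\<dots> = (\<integral>\<^sup>+a. \<integral>\<^sup>+\<xi>. G (\<xi>, - \<xi> - a) \<partial>lborel \<partial>lborel)"
    by (rule lborel_pair.Fubini') measurable
  also have "\<dots> = (\<integral>\<^sup>+a. \<integral>\<^sup>+q. (\<integral>\<^sup>+\<theta>. ennreal (wt (a, q)) * G (cpt (a, q) \<theta>) \<partial>angle) \<partial>lborel \<partial>lborel)"
  proof (rule nn_integral_cong)
    fix a :: "real^2"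
    have l: "lborel = density (distr lborel borel (\<lambda>b. - (1/2) *\<^sub>R a + (1/2) *\<^sub>R b)) (\<lambda>_. ennreal (1/4))"
      using lborel_affine[of "1/2" "- (1/2) *\<^sub>R a"] by (simp add: power2_eq_square)
    define H where "H b = G ((1/2) *\<^sub>R (b - a), (1/2) *\<^sub>R (- a - b))" for b
    have [measurable]: "H \<in> borel_measurable borel" unfolding H_def[abs_def] by measurable
    have "(\<integral>\<^sup>+\<xi>. G (\<xi>, - \<xi> - a) \<partial>lborel) = (\<integral>\<^sup>+b. ennreal (1/4) * H b \<partial>lborel)"
    proof (subst l, subst nn_integral_density, measurable, subst nn_integral_distr, measurable, rule nn_integral_cong)
      fix b :: "real^2"
      have "(- (1/2) *\<^sub>R a + (1/2) *\<^sub>R b, - (- (1/2) *\<^sub>R a + (1/2) *\<^sub>R b) - a) = ((1/2) *\<^sub>R (b - a), (1/2) *\<^sub>R (- a - b))"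
        by (simp add: vec_eq_iff field_simps)
      thus "ennreal (1/4) * G (- (1/2) *\<^sub>R a + (1/2) *\<^sub>R b, - (- (1/2) *\<^sub>R a + (1/2) *\<^sub>R b) - a) = ennreal (1/4) * H b"
        by (simp only: H_def)
    qed
    also have "\<dots> = (\<integral>\<^sup>+r. (\<integral>\<^sup>+\<theta>. ennreal (1/2) * (ennreal (1/4) * H (sqrt r *\<^sub>R dir \<theta>)) \<partial>angle) * indicator {0<..} r \<partial>lborel)"
      by (rule nn_integral_polar) measurable
    \<comment> \<open>By the parallelogram law |a|^2 + |b|^2 = 2 q, so for fixed \<open>a\<close>
      the squared radius \<open>r\<close> is affine in \<open>q\<close>.\<close>
    also have "\<dots> = ennreal 2 * (\<integral>\<^sup>+q. (\<integral>\<^sup>+\<theta>. ennreal (1/2) * (ennreal (1/4) * H (sqrt (2 * q - (norm a)\<^sup>2) *\<^sub>R dir \<theta>)) \<partial>angle) * indicator {0<..} (2 * q - (norm a)\<^sup>2) \<partial>lborel)"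
      by (subst nn_integral_real_affine[where c=2 and t="- (norm a)\<^sup>2"]) simp_all
    also have "\<dots> = (\<integral>\<^sup>+q. ennreal 2 * ((\<integral>\<^sup>+\<theta>. ennreal (1/2) * (ennreal (1/4) * H (sqrt (2 * q - (norm a)\<^sup>2) *\<^sub>R dir \<theta>)) \<partial>angle) * indicator {0<..} (2 * q - (norm a)\<^sup>2)) \<partial>lborel)"
      by (rule nn_integral_cmult[symmetric]) measurable
    also have "\<dots> = (\<integral>\<^sup>+q. (\<integral>\<^sup>+\<theta>. ennreal (wt (a, q)) * G (cpt (a, q) \<theta>) \<partial>angle) \<partial>lborel)"
    proof (rule nn_integral_cong)
      fix q :: real
      have c: "ennreal 2 * (ennreal (1/2) * (ennreal (1/4) * x)) = ennreal (1/4) * x" for x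
      proof -
        have "ennreal 2 * ennreal (1/2) = 1" by (subst ennreal_mult[symmetric]) auto
        thus ?thesis by (simp only: mult.assoc[symmetric] mult_1)
      qed
      have "ennreal 2 * (\<integral>\<^sup>+\<theta>. ennreal (1/2) * (ennreal (1/4) * H (sqrt (2 * q - (norm a)\<^sup>2) *\<^sub>R dir \<theta>)) \<partial>angle)
        = (\<integral>\<^sup>+\<theta>. ennreal (1/4) * G (cpt (a, q) \<theta>) \<partial>angle)"
        by (subst nn_integral_cmult[symmetric], measurable) (simp only: c H_def cpt_def Let_def fst_conv snd_conv)
      thus "ennreal 2 * ((\<integral>\<^sup>+\<theta>. ennreal (1/2) * (ennreal (1/4) * H (sqrt (2 * q - (norm a)\<^sup>2) *\<^sub>R dir \<theta>)) \<partial>angle) * indicator {0<..} (2 * q - (norm a)\<^sup>2))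
        = (\<integral>\<^sup>+\<theta>. ennreal (wt (a, q)) * G (cpt (a, q) \<theta>) \<partial>angle)"
        by (auto simp: wt_def mult.assoc[symmetric] split: split_indicator)
    qed
    finally show "(\<integral>\<^sup>+\<xi>. G (\<xi>, - \<xi> - a) \<partial>lborel) = (\<integral>\<^sup>+q. (\<integral>\<^sup>+\<theta>. ennreal (wt (a, q)) * G (cpt (a, q) \<theta>) \<partial>angle) \<partial>lborel)" .
  qed
  finally show ?thesis .
qed

lemma nn_integral_cpt:
  assumes [measurable]: "G \<in> borel_measurable borel"
  shows "(\<integral>\<^sup>+z. G z \<partial>lborel) = (\<integral>\<^sup>+p. (\<integral>\<^sup>+\<theta>. ennreal (wt p) * G (cpt p \<theta>) \<partial>angle) \<partial>lborel)"
proof -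
  have "(\<lambda>p. (\<integral>\<^sup>+\<theta>. ennreal (wt p) * G (cpt p \<theta>) \<partial>angle)) \<in> borel_measurable (borel :: ((real^2) \<times> real) measure)"
    by measurable
  hence [measurable]: "(\<lambda>p. (\<integral>\<^sup>+\<theta>. ennreal (wt p) * G (cpt p \<theta>) \<partial>angle)) \<in> borel_measurable ((lborel :: (real^2) measure) \<Otimes>\<^sub>M (lborel :: real measure))"
    by (simp add: lborel_prod)
  show ?thesis unfolding nn_integral_cpt_iterated[OF assms]
    by (subst lborel.nn_integral_fst) (simp_all add: lborel_prod)
qed

text \<open>The change of variables as an identity of measures, which transfers Bochner integrals
  and integrability, not only nonnegative integrals.\<close>

lemma lborel_eq_distr_cpt:
  "lborel = distr (density (lborel \<Otimes>\<^sub>M angle) (\<lambda>(p, \<theta>). ennreal (wt p))) borel (\<lambda>(p, \<theta>). cpt p \<theta>)"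
proof (rule measure_eqI)
  fix A :: "((real^2) \<times> (real^2)) set" assume "A \<in> sets lborel"
  hence [measurable]: "A \<in> sets borel" by simp
  have "emeasure lborel A = (\<integral>\<^sup>+z. indicator A z \<partial>lborel)" by simp
  also have "\<dots> = (\<integral>\<^sup>+p. (\<integral>\<^sup>+\<theta>. ennreal (wt p) * indicator A (cpt p \<theta>) \<partial>angle) \<partial>lborel)"
    by (rule nn_integral_cpt) measurable
  also have "\<dots> = (\<integral>\<^sup>+x. (case x of (p, \<theta>) \<Rightarrow> ennreal (wt p) * indicator A (cpt p \<theta>)) \<partial>(lborel \<Otimes>\<^sub>M angle))"
    by (subst angle.nn_integral_fst[symmetric]) auto
  also have "\<dots> = (\<integral>\<^sup>+x. indicator A (case x of (p, \<theta>) \<Rightarrow> cpt p \<theta>) \<partial>density (lborel \<Otimes>\<^sub>M angle) (\<lambda>(p, \<theta>). ennreal (wt p)))"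
    by (subst nn_integral_density) (auto simp: case_prod_unfold)
  also have "\<dots> = emeasure (distr (density (lborel \<Otimes>\<^sub>M angle) (\<lambda>(p, \<theta>). ennreal (wt p))) borel (\<lambda>(p, \<theta>). cpt p \<theta>)) A"
    by (subst nn_integral_indicator[of A, symmetric], simp, subst nn_integral_distr) auto
  finally show "emeasure lborel A = emeasure (distr (density (lborel \<Otimes>\<^sub>M angle) (\<lambda>(p, \<theta>). ennreal (wt p))) borel (\<lambda>(p, \<theta>). cpt p \<theta>)) A" .
qed simp

lemma
  fixes H :: "(real^2) \<times> (real^2) \<Rightarrow> 'b::{banach,second_countable_topology}"
  assumes H: "integrable lborel H"
  shows integrable_cpt_fst: "integrable lborel (\<lambda>p. \<integral>\<theta>. wt p *\<^sub>R H (cpt p \<theta>) \<partial>angle)"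
    and AE_integrable_cpt: "AE p in lborel. integrable angle (\<lambda>\<theta>. wt p *\<^sub>R H (cpt p \<theta>))"
    and integral_cpt: "(\<integral>z. H z \<partial>lborel) = (\<integral>p. (\<integral>\<theta>. wt p *\<^sub>R H (cpt p \<theta>) \<partial>angle) \<partial>lborel)"
proof -
  interpret LA: pair_sigma_finite "lborel :: ((real^2) \<times> real) measure" angle ..
  have [measurable]: "H \<in> borel_measurable borel" using borel_measurable_integrable[OF H] by simp
  have "integrable (density (lborel \<Otimes>\<^sub>M angle) (\<lambda>(p, \<theta>). ennreal (wt p))) (\<lambda>x. H (case x of (p, \<theta>) \<Rightarrow> cpt p \<theta>))"
    using H by (subst (asm) lborel_eq_distr_cpt, subst (asm) integrable_distr_eq) auto
  hence "integrable (density (lborel \<Otimes>\<^sub>M angle) (\<lambda>x. ennreal (wt (fst x)))) (\<lambda>x. H (cpt (fst x) (snd x)))"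
    by (simp add: case_prod_unfold)
  hence int: "integrable (lborel \<Otimes>\<^sub>M angle) (\<lambda>x. wt (fst x) *\<^sub>R H (cpt (fst x) (snd x)))"
    by (subst (asm) integrable_density) auto
  hence int': "integrable (lborel \<Otimes>\<^sub>M angle) (\<lambda>(p, \<theta>). wt p *\<^sub>R H (cpt p \<theta>))"
    by (simp add: case_prod_unfold)
  show "integrable lborel (\<lambda>p. \<integral>\<theta>. wt p *\<^sub>R H (cpt p \<theta>) \<partial>angle)"
    using LA.integrable_fst'[OF int'] by simp
  show "AE p in lborel. integrable angle (\<lambda>\<theta>. wt p *\<^sub>R H (cpt p \<theta>))"
    using LA.AE_integrable_fst'[OF int'] by simp
  have "(\<integral>z. H z \<partial>lborel) = (\<integral>x. H (cpt (fst x) (snd x)) \<partial>density (lborel \<Otimes>\<^sub>M angle) (\<lambda>x. ennreal (wt (fst x))))"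
    by (subst lborel_eq_distr_cpt, subst integral_distr) (auto simp: case_prod_unfold)
  also have "\<dots> = (\<integral>x. wt (fst x) *\<^sub>R H (cpt (fst x) (snd x)) \<partial>(lborel \<Otimes>\<^sub>M angle))"
    by (subst integral_density) auto
  also have "\<dots> = (\<integral>p. (\<integral>\<theta>. wt p *\<^sub>R H (cpt p \<theta>) \<partial>angle) \<partial>lborel)"
    using LA.integral_fst'[OF int'] by (simp add: case_prod_unfold)
  finally show "(\<integral>z. H z \<partial>lborel) = (\<integral>p. (\<integral>\<theta>. wt p *\<^sub>R H (cpt p \<theta>) \<partial>angle) \<partial>lborel)" .
qed

text \<open>The density of the image of \<open>F\<close> times Lebesgue measure under the map from
  (\<xi>, \<eta>) to (- \<xi> - \<eta>, |\<xi>|^2 + |\<eta>|^2).\<close>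

definition fibre_integral :: "((real^2) \<times> (real^2) \<Rightarrow> complex) \<Rightarrow> (real^2) \<times> real \<Rightarrow> complex" where
  "fibre_integral F p = (\<integral>\<theta>. wt p *\<^sub>R F (cpt p \<theta>) \<partial>angle)"

text \<open>For \<open>F\<close> square integrable on the circle this is twice the defect in
  Cauchy-Schwarz there. The form with pairs of points, rather than deviations from a mean, is the
  one that can be compared with pairs of points on a whole sphere.\<close>

definition fibre_spread :: "((real^2) \<times> (real^2) \<Rightarrow> complex) \<Rightarrow> (real^2) \<times> real \<Rightarrow> real" where
  "fibre_spread F p = (\<integral>\<theta>. (\<integral>\<theta>'. (cmod (F (cpt p \<theta>) - F (cpt p \<theta>')))\<^sup>2 \<partial>angle) \<partial>angle)"

text \<open>These are the two quantities in the phase of the solution at \<open>(x, x, t)\<close>.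
  Since they do not depend on \<theta>, the phase comes out of the integral over the circle.\<close>

lemma cpt_inner:
  assumes "wt p \<noteq> 0"
  shows "(x, x) \<bullet> cpt p \<theta> = - (x \<bullet> fst p)" and "(norm (cpt p \<theta>))\<^sup>2 = snd p"
proof -
  have pos: "2 * snd p - (norm (fst p))\<^sup>2 \<ge> 0" using assms by (auto simp: wt_def split: if_splits)
  show "(x, x) \<bullet> cpt p \<theta> = - (x \<bullet> fst p)"
    by (simp add: cpt_def Let_def inner_diff_right algebra_simps)
  define b where "b = sqrt (2 * snd p - (norm (fst p))\<^sup>2) *\<^sub>R dir \<theta>"
  have b: "b \<bullet> b = 2 * snd p - (norm (fst p))\<^sup>2"
  proof -
    have "norm b = sqrt (2 * snd p - (norm (fst p))\<^sup>2)" using pos by (simp add: b_def)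
    thus ?thesis using pos by (simp only: power2_norm_eq_inner[symmetric] real_sqrt_pow2)
  qed
  have n: "(norm (b - fst p))\<^sup>2 + (norm (- fst p - b))\<^sup>2 = 2 * (b \<bullet> b) + 2 * (norm (fst p))\<^sup>2"
    by (simp add: power2_norm_eq_inner inner_diff_left inner_diff_right inner_commute)
  have "(norm (cpt p \<theta>))\<^sup>2 = (1/4) * ((norm (b - fst p))\<^sup>2 + (norm (- fst p - b))\<^sup>2)"
    unfolding cpt_def Let_def b_def[symmetric] norm_Pair norm_scaleR
    by (simp add: power_divide field_simps)
  thus "(norm (cpt p \<theta>))\<^sup>2 = snd p" unfolding n b by simp
qed

lemma schroedinger_diagonal_eq:
  assumes F: "integrable lborel (fourier f)"
  shows "diagonal f p = fourier (fibre_integral (fourier f)) p / (2 * pi) ^ 4"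
proof -
  obtain x t where p: "p = (x, t)" by force
  define H where "H \<zeta> = cis ((x, x) \<bullet> \<zeta>) * (cis (- (t * (norm \<zeta>)\<^sup>2)) * fourier f \<zeta>)" for \<zeta>
  have H: "integrable lborel H"
    unfolding H_def[abs_def] by (intro integrable_cis_mult F) measurable
  have "(\<integral>\<zeta>. H \<zeta> \<partial>lborel) = (\<integral>p. (\<integral>\<theta>. wt p *\<^sub>R H (cpt p \<theta>) \<partial>angle) \<partial>lborel)"
    by (rule integral_cpt[OF H])
  also have "\<dots> = fourier (fibre_integral (fourier f)) (x, t)"
    unfolding fourier_def[of "fibre_integral (fourier f)"]
  proof (rule Bochner_Integration.integral_cong)
    fix r :: "(real^2) \<times> real"
    \<comment> \<open>The minus sign in a = - \<xi> - \<eta> makes the spatial part of the phase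
      agree with the kernel of \<open>fourier\<close>, as its temporal part already does.\<close>
    have eq: "wt r *\<^sub>R H (cpt r \<theta>) = cis (- (r \<bullet> (x, t))) * (wt r *\<^sub>R fourier f (cpt r \<theta>))" for \<theta>
    proof (cases "wt r = 0")
      case False
      have "cis (- (r \<bullet> (x, t))) = cis (- (x \<bullet> fst r)) * cis (- (t * snd r))"
      proof -
        have "- (r \<bullet> (x, t)) = - (x \<bullet> fst r) + - (t * snd r)"
          by (cases r) (simp add: inner_commute)
        thus ?thesis by (simp only: cis_mult)
      qed
      thus ?thesis using cpt_inner[OF False] by (simp add: H_def)
    qed simp
    thus "(\<integral>\<theta>. wt r *\<^sub>R H (cpt r \<theta>) \<partial>angle) = cis (- (r \<bullet> (x, t))) * fibre_integral (fourier f) r"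
      by (simp only: fibre_integral_def eq integral_mult_right_zero)
  qed simp
  finally have "(\<integral>\<zeta>. H \<zeta> \<partial>lborel) = fourier (fibre_integral (fourier f)) (x, t)" .
  thus ?thesis by (simp add: p diagonal_def schroedinger_def H_def)
qed

text \<open>On a circle with weight \<open>1/4\<close> the variance identity reads |W|^2 = (1/16) (2
  pi \<integral>|F|^2 - spread / 2). One factor \<open>1/4\<close> is left in the integrals against
  \<open>wt\<close>, whence \<open>pi / 2\<close> and \<open>1 / 8\<close>. For almost every circle
  \<open>F\<close> is square integrable there, which is what the identity asks for.\<close>

lemma
  fixes F :: "(real^2) \<times> (real^2) \<Rightarrow> complex"
  assumes F: "integrable lborel F" and F2: "integrable lborel (\<lambda>x. (cmod (F x))\<^sup>2)"
  shows integrable_fibre_integral: "integrable lborel (fibre_integral F)"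
    and square_integrable_fibre_integral: "integrable lborel (\<lambda>p. (cmod (fibre_integral F p))\<^sup>2)"
    and integrable_fibre_spread: "integrable lborel (\<lambda>p. wt p * fibre_spread F p)"
    and square_integral_fibre_integral: "(\<integral>p. (cmod (fibre_integral F p))\<^sup>2 \<partial>lborel)
      = pi / 2 * (\<integral>x. (cmod (F x))\<^sup>2 \<partial>lborel) - 1 / 8 * (\<integral>p. wt p * fibre_spread F p \<partial>lborel)"
proof -
  have [measurable]: "F \<in> borel_measurable borel" using borel_measurable_integrable[OF F] by simp
  show W: "integrable lborel (fibre_integral F)"
    unfolding fibre_integral_def[abs_def] by (rule integrable_cpt_fst[OF F])
  hence [measurable]: "fibre_integral F \<in> borel_measurable borel" using borel_measurable_integrable[OF W] by simp
  define N where "N p = (\<integral>\<theta>. wt p *\<^sub>R (cmod (F (cpt p \<theta>)))\<^sup>2 \<partial>angle)" for p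
  have N: "integrable lborel N"
    unfolding N_def[abs_def] by (rule integrable_cpt_fst[OF F2])
  have key: "AE p in lborel. (cmod (fibre_integral F p))\<^sup>2 = pi / 2 * N p - 1 / 8 * (wt p * fibre_spread F p)"
    using AE_integrable_cpt[OF F2]
  proof eventually_elim
    case (elim p)
    show ?case
    proof (cases "wt p = 0")
      case True thus ?thesis by (simp add: fibre_integral_def N_def)
    next
      case False
      hence wt: "wt p = 1/4" by (simp add: wt_def split: if_splits)
      have i: "integrable angle (\<lambda>\<theta>. (cmod (F (cpt p \<theta>)))\<^sup>2)" using elim False by simp
      have "fibre_spread F p = 2 * (2 * pi * (\<integral>\<theta>. (cmod (F (cpt p \<theta>)))\<^sup>2 \<partial>angle) - (cmod (\<integral>\<theta>. F (cpt p \<theta>) \<partial>angle))\<^sup>2)"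
        unfolding fibre_spread_def
        using variance_identity[OF angle.finite_measure_axioms _ i] by simp
      thus ?thesis
        by (simp add: fibre_integral_def N_def wt norm_mult power_mult_distrib power_divide) (simp add: field_simps)
    qed
  qed
  have [measurable]: "fibre_spread F \<in> borel_measurable borel"
    unfolding fibre_spread_def[abs_def] by measurable
  have spread: "fibre_spread F p \<ge> 0" for p
    unfolding fibre_spread_def by (intro Bochner_Integration.integral_nonneg) auto
  show W2: "integrable lborel (\<lambda>p. (cmod (fibre_integral F p))\<^sup>2)"
  proof (rule Bochner_Integration.integrable_bound)
    show "integrable lborel (\<lambda>p. pi / 2 * N p)" using N by auto
    show "AE p in lborel. norm ((cmod (fibre_integral F p))\<^sup>2) \<le> norm (pi / 2 * N p)"
      using key
    proof eventually_elim
      case (elim p)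
      have "0 \<le> (cmod (fibre_integral F p))\<^sup>2" "0 \<le> 1 / 8 * (wt p * fibre_spread F p)"
        using spread[of p] by auto
      thus ?case unfolding elim real_norm_def by linarith
    qed
  qed measurable
  have eq: "AE p in lborel. wt p * fibre_spread F p = 4 * pi * N p - 8 * (cmod (fibre_integral F p))\<^sup>2"
    using key by eventually_elim simp
  have "integrable lborel (\<lambda>p. 4 * pi * N p - 8 * (cmod (fibre_integral F p))\<^sup>2)"
    using N W2 by auto
  thus S: "integrable lborel (\<lambda>p. wt p * fibre_spread F p)"
    by (subst integrable_cong_AE[OF _ _ eq]) (use borel_measurable_integrable[OF N] in auto)
  have "(\<integral>p. (cmod (fibre_integral F p))\<^sup>2 \<partial>lborel) = (\<integral>p. pi / 2 * N p - 1 / 8 * (wt p * fibre_spread F p) \<partial>lborel)"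
    by (rule integral_cong_AE) (use key borel_measurable_integrable[OF N] in auto)
  also have "\<dots> = pi / 2 * (\<integral>p. N p \<partial>lborel) - 1 / 8 * (\<integral>p. wt p * fibre_spread F p \<partial>lborel)"
    using N S by (subst Bochner_Integration.integral_diff) auto
  also have "(\<integral>p. N p \<partial>lborel) = (\<integral>x. (cmod (F x))\<^sup>2 \<partial>lborel)"
    unfolding N_def by (rule integral_cpt[OF F2, symmetric])
  finally show "(\<integral>p. (cmod (fibre_integral F p))\<^sup>2 \<partial>lborel)
      = pi / 2 * (\<integral>x. (cmod (F x))\<^sup>2 \<partial>lborel) - 1 / 8 * (\<integral>p. wt p * fibre_spread F p \<partial>lborel)" .
qed

text \<open>A setting common to Gaussians and Schwartz functions: with an integrable transform
  \<open>schroedinger\<close> is an absolutely convergent integral, and the other two conditions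
  feed the Plancherel inequality.\<close>

definition admissible :: "('a::euclidean_space \<Rightarrow> complex) \<Rightarrow> bool" where
  "admissible f \<longleftrightarrow> integrable lborel f \<and> integrable lborel (\<lambda>x. (cmod (f x))\<^sup>2) \<and> integrable lborel (fourier f)"

text \<open>The inverse transform on R^4 contributes \<open>(2 * pi) ^ 8\<close> to the denominator
  of the square, and Plancherel on R^2 \<times> R gives back \<open>(2 * pi) ^ 3\<close>. The rest
  is the exact formula for the square integral of the fibre integrals.\<close>

lemma
  assumes f: "admissible f"
  shows diagonal_measurable: "diagonal f \<in> borel_measurable borel"
    and diagonal_square_integrable: "integrable lborel (\<lambda>p. (cmod (diagonal f p))\<^sup>2)"
    and diagonal_square_integral_le: "(\<integral>p. (cmod (diagonal f p))\<^sup>2 \<partial>lborel)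
      \<le> (pi / 2 * (\<integral>x. (cmod (fourier f x))\<^sup>2 \<partial>lborel)
          - 1 / 8 * (\<integral>p. wt p * fibre_spread (fourier f) p \<partial>lborel)) / (2 * pi) ^ 5"
proof -
  note f' = f[unfolded admissible_def]
  have F2: "integrable lborel (\<lambda>x. (cmod (fourier f x))\<^sup>2)" using f' by (intro plancherel_integrable) auto
  have F: "integrable lborel (fourier f)" using f' by simp
  note W = integrable_fibre_integral[OF F F2] square_integrable_fibre_integral[OF F F2]
  have [measurable]: "fibre_integral (fourier f) \<in> borel_measurable borel" using borel_measurable_integrable[OF W(1)] by simp
  have eq: "diagonal f = (\<lambda>p. fourier (fibre_integral (fourier f)) p / (2 * pi) ^ 4)"
    using schroedinger_diagonal_eq[OF F] by auto
  show "diagonal f \<in> borel_measurable borel" unfolding eq by measurable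
  have eq2: "(cmod (diagonal f p))\<^sup>2 = (cmod (fourier (fibre_integral (fourier f)) p))\<^sup>2 / (2 * pi) ^ 8" for p
    by (simp add: eq norm_divide power_divide norm_power norm_mult power_mult_distrib flip: power_mult)
  show "integrable lborel (\<lambda>p. (cmod (diagonal f p))\<^sup>2)"
    unfolding eq2 by (intro integrable_divide plancherel_integrable W)
  have "(\<integral>p. (cmod (diagonal f p))\<^sup>2 \<partial>lborel) = (\<integral>p. (cmod (fourier (fibre_integral (fourier f)) p))\<^sup>2 \<partial>lborel) / (2 * pi) ^ 8"
    unfolding eq2 by simp
  also have "\<dots> \<le> ((2 * pi) ^ 3 * (\<integral>p. (cmod (fibre_integral (fourier f) p))\<^sup>2 \<partial>lborel)) / (2 * pi) ^ 8"
    using plancherel_le[OF W] by (intro divide_right_mono) (auto simp: eval_nat_numeral)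
  also have "\<dots> = (\<integral>p. (cmod (fibre_integral (fourier f) p))\<^sup>2 \<partial>lborel) / (2 * pi) ^ 5"
    by (simp add: field_simps eval_nat_numeral)
  finally show "(\<integral>p. (cmod (diagonal f p))\<^sup>2 \<partial>lborel)
      \<le> (pi / 2 * (\<integral>x. (cmod (fourier f x))\<^sup>2 \<partial>lborel)
          - 1 / 8 * (\<integral>p. wt p * fibre_spread (fourier f) p \<partial>lborel)) / (2 * pi) ^ 5"
    by (simp only: square_integral_fibre_integral[OF F F2])
qed

section \<open>A Doeblin minorization\<close>

lemma power2_less_iff_abs_less:
  fixes x q :: real
  assumes "q > 0"
  shows "x\<^sup>2 < q\<^sup>2 \<longleftrightarrow> \<bar>x\<bar> < q"
  using assms abs_le_square_iff[of q x] by (auto simp: not_le[symmetric])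

text \<open>The substitution v = - R cos \<theta>: a uniform angle on the half circle has the
  arcsine density in \<open>v\<close>. At \<open>v = R\<close> and \<open>v = - R\<close> the
  quotient is 0 by convention, and these are null sets.\<close>

lemma nn_integral_arcsine:
  fixes h :: "real \<Rightarrow> real"
  assumes [measurable]: "h \<in> borel_measurable borel" and R: "R > 0"
  shows "(\<integral>\<^sup>+v. ennreal (h v / sqrt (R\<^sup>2 - v\<^sup>2)) * indicator {-R..R} v \<partial>lborel)
    = (\<integral>\<^sup>+\<theta>. ennreal (h (- R * cos \<theta>)) * indicator {0<..<pi} \<theta> \<partial>lborel)"
proof -
  define f where "f v = h v / sqrt (R\<^sup>2 - v\<^sup>2)" for v
  define g where "g \<theta> = - R * cos \<theta>" for \<theta>
  have [measurable]: "f \<in> borel_measurable borel" unfolding f_def[abs_def] by measurable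
  have g: "g 0 = - R" "g pi = R" by (simp_all add: g_def)
  have "(\<integral>\<^sup>+v. ennreal (f v) * indicator {g 0..g pi} v \<partial>lborel)
      = (\<integral>\<^sup>+\<theta>. ennreal (f (g \<theta>) * (R * sin \<theta>)) * indicator {0..pi} \<theta> \<partial>lborel)"
  proof -
    have "(\<integral>\<^sup>+v. ennreal (f v * indicator {g 0..g pi} v) \<partial>lborel)
      = (\<integral>\<^sup>+\<theta>. ennreal (f (g \<theta>) * (R * sin \<theta>) * indicator {0..pi} \<theta>) \<partial>lborel)"
    proof (rule nn_integral_substitution)
      show "set_borel_measurable borel {g 0..g pi} f" unfolding set_borel_measurable_def by measurable
      show "(g has_real_derivative R * sin \<theta>) (at \<theta>)" for \<theta>
        unfolding g_def by (auto intro!: derivative_eq_intros)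
      show "continuous_on {0..pi} (\<lambda>\<theta>. R * sin \<theta>)" by (intro continuous_intros)
      show "R * sin \<theta> \<ge> 0" if "\<theta> \<in> {0..pi}" for \<theta>
        using that R by (auto intro!: mult_nonneg_nonneg sin_ge_zero)
    qed simp
    thus ?thesis by (simp add: ennreal_mult'' ennreal_indicator[symmetric])
  qed
  also have "\<dots> = (\<integral>\<^sup>+\<theta>. ennreal (h (- R * cos \<theta>)) * indicator {0<..<pi} \<theta> \<partial>lborel)"
  proof (rule nn_integral_cong)
    fix \<theta> :: real
    show "ennreal (f (g \<theta>) * (R * sin \<theta>)) * indicator {0..pi} \<theta> = ennreal (h (- R * cos \<theta>)) * indicator {0<..<pi} \<theta>"
    proof (cases "0 < \<theta> \<and> \<theta> < pi")
      case True
      hence s: "sin \<theta> > 0" by (intro sin_gt_zero) auto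
      have "R\<^sup>2 - (g \<theta>)\<^sup>2 = (R * sin \<theta>)\<^sup>2"
        by (simp add: g_def power_mult_distrib sin_squared_eq algebra_simps)
      hence "sqrt (R\<^sup>2 - (g \<theta>)\<^sup>2) = R * sin \<theta>" using s R by simp
      thus ?thesis using True s R by (simp add: f_def g_def)
    next
      case False
      show ?thesis
      proof (cases "\<theta> = 0 \<or> \<theta> = pi")
        case True thus ?thesis by auto
      next
        case F: False
        hence "\<theta> \<notin> {0..pi}" using False by auto
        thus ?thesis using False by simp
      qed
    qed
  qed
  finally show ?thesis by (simp add: f_def g)
qed

text \<open>The half circle beyond \<open>pi\<close> is discarded. By symmetry it contributes as
  much as the other half, so a factor 2 is given away for each of the two angles in the
  minorization.\<close>

lemma nn_integral_arcsine_le_angle: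
  fixes h :: "real \<Rightarrow> real"
  assumes [measurable]: "h \<in> borel_measurable borel" and R: "R > 0"
  shows "(\<integral>\<^sup>+v. ennreal (h v / sqrt (R\<^sup>2 - v\<^sup>2)) * indicator {-R..R} v \<partial>lborel)
    \<le> (\<integral>\<^sup>+\<theta>. ennreal (h (- R * cos \<theta>)) \<partial>angle)"
  unfolding nn_integral_arcsine[OF assms]
  by (subst nn_integral_angle) (auto intro!: nn_integral_mono split: split_indicator)

text \<open>
  The uniform lower bound on this density is the source of the spectral gap.  The factor with the
  larger radius is bounded below by \<open>1 / q\<close>; the other one is an arcsine density of total mass \<open>\<pi>\<close>.
\<close>

lemma overlap_density_ge:
  assumes q: "q > 0" and v: "\<bar>v\<bar> < q" "\<bar>v'\<bar> < q"
  shows "ennreal (pi / q) \<le> (\<integral>\<^sup>+y. ennreal (1 / sqrt (q\<^sup>2 - y\<^sup>2 - v\<^sup>2) / sqrt (q\<^sup>2 - y\<^sup>2 - v'\<^sup>2)) *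
     indicator {y. y\<^sup>2 + v\<^sup>2 < q\<^sup>2 \<and> y\<^sup>2 + v'\<^sup>2 < q\<^sup>2} y \<partial>lborel)"
proof -
  \<comment> \<open>Both factors are defined for \<open>|y| < \<rho>\<close> exactly, and this range
    is governed by the larger of \<open>|v|\<close> and \<open>|v'|\<close>.\<close>
  define m where "m = max \<bar>v\<bar> \<bar>v'\<bar>"
  define \<rho> where "\<rho> = sqrt (q\<^sup>2 - m\<^sup>2)"
  have m: "0 \<le> m" "m < q" using v by (auto simp: m_def)
  have m2: "m\<^sup>2 < q\<^sup>2" using m by (intro power_strict_mono) auto
  have \<rho>: "\<rho> > 0" "\<rho>\<^sup>2 = q\<^sup>2 - m\<^sup>2" using m2 by (auto simp: \<rho>_def)
  have vm: "v\<^sup>2 \<le> m\<^sup>2" "v'\<^sup>2 \<le> m\<^sup>2" "v\<^sup>2 = m\<^sup>2 \<or> v'\<^sup>2 = m\<^sup>2"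
    unfolding m_def by (auto simp: abs_le_square_iff[symmetric] max_def)
  have "ennreal (pi / q) = ennreal (1 / q) * emeasure lborel {0<..<pi}"
    using q by (simp add: ennreal_mult'[symmetric] divide_inverse mult.commute)
  also have "\<dots> = (\<integral>\<^sup>+\<theta>. ennreal (1 / q) * indicator {0<..<pi} \<theta> \<partial>lborel)"
    by (subst nn_integral_cmult_indicator) auto
  \<comment> \<open>The arcsine formula read from right to left, with the constant function
    \<open>1 / q\<close>.\<close>
  also have "\<dots> = (\<integral>\<^sup>+y. ennreal (1 / q / sqrt (\<rho>\<^sup>2 - y\<^sup>2)) * indicator {-\<rho>..\<rho>} y \<partial>lborel)"
    using nn_integral_arcsine[of "\<lambda>_. 1 / q" \<rho>] \<rho> by simp
  also have "\<dots> \<le> (\<integral>\<^sup>+y. ennreal (1 / sqrt (q\<^sup>2 - y\<^sup>2 - v\<^sup>2) / sqrt (q\<^sup>2 - y\<^sup>2 - v'\<^sup>2)) *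
     indicator {y. y\<^sup>2 + v\<^sup>2 < q\<^sup>2 \<and> y\<^sup>2 + v'\<^sup>2 < q\<^sup>2} y \<partial>lborel)"
  proof (rule nn_integral_mono)
    fix y
    show "ennreal (1 / q / sqrt (\<rho>\<^sup>2 - y\<^sup>2)) * indicator {-\<rho>..\<rho>} y \<le> ennreal (1 / sqrt (q\<^sup>2 - y\<^sup>2 - v\<^sup>2) / sqrt (q\<^sup>2 - y\<^sup>2 - v'\<^sup>2)) *
     indicator {y. y\<^sup>2 + v\<^sup>2 < q\<^sup>2 \<and> y\<^sup>2 + v'\<^sup>2 < q\<^sup>2} y"
    proof (cases "\<bar>y\<bar> < \<rho>")
      case False
      hence "y \<notin> {-\<rho>..\<rho>} \<or> y = \<rho> \<or> y = - \<rho>" by auto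
      thus ?thesis by auto
    next
      case True
      hence y: "y\<^sup>2 < \<rho>\<^sup>2" using \<rho>(1) by (simp add: power2_less_iff_abs_less)
      have in1: "y\<^sup>2 + v\<^sup>2 < q\<^sup>2" "y\<^sup>2 + v'\<^sup>2 < q\<^sup>2" using y \<rho> vm by linarith+
      have b: "sqrt (q\<^sup>2 - y\<^sup>2 - w\<^sup>2) \<le> q" for w
        using q by (intro real_le_lsqrt) auto
      have p: "sqrt (q\<^sup>2 - y\<^sup>2 - v\<^sup>2) > 0" "sqrt (q\<^sup>2 - y\<^sup>2 - v'\<^sup>2) > 0" "sqrt (\<rho>\<^sup>2 - y\<^sup>2) > 0"
        using in1 y by auto
      have eq: "\<rho>\<^sup>2 - y\<^sup>2 = q\<^sup>2 - y\<^sup>2 - m\<^sup>2" using \<rho> by simp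
      have "1 / q / sqrt (\<rho>\<^sup>2 - y\<^sup>2) \<le> 1 / sqrt (q\<^sup>2 - y\<^sup>2 - v\<^sup>2) / sqrt (q\<^sup>2 - y\<^sup>2 - v'\<^sup>2)"
        using vm(3)
      proof
        assume "v\<^sup>2 = m\<^sup>2"
        hence e: "sqrt (\<rho>\<^sup>2 - y\<^sup>2) = sqrt (q\<^sup>2 - y\<^sup>2 - v\<^sup>2)" using eq by simp
        have "1 / q \<le> 1 / sqrt (q\<^sup>2 - y\<^sup>2 - v'\<^sup>2)" using b p q by (intro divide_left_mono) auto
        hence "1 / q / sqrt (\<rho>\<^sup>2 - y\<^sup>2) \<le> 1 / sqrt (q\<^sup>2 - y\<^sup>2 - v'\<^sup>2) / sqrt (\<rho>\<^sup>2 - y\<^sup>2)"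
          using p by (intro divide_right_mono) auto
        thus ?thesis unfolding e by (simp add: mult.commute)
      next
        assume "v'\<^sup>2 = m\<^sup>2"
        hence e: "sqrt (\<rho>\<^sup>2 - y\<^sup>2) = sqrt (q\<^sup>2 - y\<^sup>2 - v'\<^sup>2)" using eq by simp
        have "1 / q \<le> 1 / sqrt (q\<^sup>2 - y\<^sup>2 - v\<^sup>2)" using b p q by (intro divide_left_mono) auto
        thus ?thesis unfolding e using p by (intro divide_right_mono) auto
      qed
      thus ?thesis using True in1 by (auto intro: ennreal_leI split: split_indicator)
    qed
  qed
  finally show ?thesis .
qed

text \<open>On the sphere of level \<open>q\<close> the circles are indexed by y = |a|^2 - q, and
  along one of them \<open>v\<close> oscillates with amplitude
  \<open>sqrt (q\<^sup>2 - y\<^sup>2)\<close>. Integrating over \<open>y\<close> first produces the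
  joint density of the pairs \<open>(v, v')\<close>, which \<open>overlap_density_ge\<close> bounds
  below on the whole square.\<close>

lemma doeblin_minorization:
  fixes \<psi> :: "real \<Rightarrow> real \<Rightarrow> real"
  assumes \<psi>: "case_prod \<psi> \<in> borel_measurable (borel \<Otimes>\<^sub>M borel)"
    and nn: "\<And>v v'. \<psi> v v' \<ge> 0" and q: "q > 0"
  shows "ennreal (pi / q) * (\<integral>\<^sup>+v. (\<integral>\<^sup>+v'. ennreal (\<psi> v v') * indicator {-q<..<q} v' \<partial>lborel) * indicator {-q<..<q} v \<partial>lborel)
    \<le> (\<integral>\<^sup>+y. (\<integral>\<^sup>+\<theta>. (\<integral>\<^sup>+\<theta>'. ennreal (\<psi> (- sqrt (q\<^sup>2 - y\<^sup>2) * cos \<theta>) (- sqrt (q\<^sup>2 - y\<^sup>2) * cos \<theta>')) \<partial>angle) \<partial>angle)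
          * indicator {-q<..<q} y \<partial>lborel)"
proof -
  note [measurable] = borel_measurable_case_prod_compose[OF \<psi>]
  \<comment> \<open>The product of the two arcsine densities belonging to the circle
    \<open>y\<close>, extended by 0 to the points where a square root would not be positive.\<close>
  define w where w: "w v v' y = (if y\<^sup>2 + v\<^sup>2 < q\<^sup>2 \<and> y\<^sup>2 + v'\<^sup>2 < q\<^sup>2
     then 1 / sqrt (q\<^sup>2 - y\<^sup>2 - v\<^sup>2) / sqrt (q\<^sup>2 - y\<^sup>2 - v'\<^sup>2) else 0)" for v v' y :: real
  have w0: "w v v' y \<ge> 0" for v v' y by (simp add: w)
  have [measurable]: "(\<lambda>x. w (f x) (g x) (h x)) \<in> borel_measurable N"
    if [measurable]: "f \<in> borel_measurable N" "g \<in> borel_measurable N" "h \<in> borel_measurable N" for f g h and N :: "'c measure"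
    unfolding w by measurable
  note sq = power2_less_iff_abs_less[OF q]
  have "ennreal (pi / q) * (\<integral>\<^sup>+v. (\<integral>\<^sup>+v'. ennreal (\<psi> v v') * indicator {-q<..<q} v' \<partial>lborel) * indicator {-q<..<q} v \<partial>lborel)
      = (\<integral>\<^sup>+v. \<integral>\<^sup>+v'. ennreal (\<psi> v v') * (ennreal (pi / q) * indicator {-q<..<q} v * indicator {-q<..<q} v') \<partial>lborel \<partial>lborel)"
  proof (subst nn_integral_cmult[symmetric])
    show "(\<lambda>v. (\<integral>\<^sup>+v'. ennreal (\<psi> v v') * indicator {-q<..<q} v' \<partial>lborel) * indicator {-q<..<q} v) \<in> borel_measurable lborel"
      by measurable
    show "(\<integral>\<^sup>+v. ennreal (pi / q) * ((\<integral>\<^sup>+v'. ennreal (\<psi> v v') * indicator {-q<..<q} v' \<partial>lborel) * indicator {-q<..<q} v) \<partial>lborel)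
      = (\<integral>\<^sup>+v. \<integral>\<^sup>+v'. ennreal (\<psi> v v') * (ennreal (pi / q) * indicator {-q<..<q} v * indicator {-q<..<q} v') \<partial>lborel \<partial>lborel)"
    proof (rule nn_integral_cong)
      fix v :: real
      have "(\<integral>\<^sup>+v'. ennreal (\<psi> v v') * (ennreal (pi / q) * indicator {-q<..<q} v * indicator {-q<..<q} v') \<partial>lborel)
        = (\<integral>\<^sup>+v'. (ennreal (pi / q) * indicator {-q<..<q} v) * (ennreal (\<psi> v v') * indicator {-q<..<q} v') \<partial>lborel)"
        by (simp only: mult_ac)
      also have "\<dots> = (ennreal (pi / q) * indicator {-q<..<q} v) * (\<integral>\<^sup>+v'. ennreal (\<psi> v v') * indicator {-q<..<q} v' \<partial>lborel)"
        by (rule nn_integral_cmult) measurable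
      finally show "ennreal (pi / q) * ((\<integral>\<^sup>+v'. ennreal (\<psi> v v') * indicator {-q<..<q} v' \<partial>lborel) * indicator {-q<..<q} v)
        = (\<integral>\<^sup>+v'. ennreal (\<psi> v v') * (ennreal (pi / q) * indicator {-q<..<q} v * indicator {-q<..<q} v') \<partial>lborel)"
        by (simp only: mult_ac)
    qed
  qed
  \<comment> \<open>The minorization itself, used pointwise in \<open>(v, v')\<close>; nonnegativity
    of \<psi> lets it pass through the integrals.\<close>
  also have "\<dots> \<le> (\<integral>\<^sup>+v. \<integral>\<^sup>+v'. ennreal (\<psi> v v') * (\<integral>\<^sup>+y. ennreal (w v v' y) \<partial>lborel) \<partial>lborel \<partial>lborel)"
  proof (intro nn_integral_mono mult_left_mono)
    fix v v' :: real
    show "ennreal (pi / q) * indicator {-q<..<q} v * indicator {-q<..<q} v' \<le> (\<integral>\<^sup>+y. ennreal (w v v' y) \<partial>lborel)"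
    proof (cases "v \<in> {-q<..<q} \<and> v' \<in> {-q<..<q}")
      case True
      have "(\<integral>\<^sup>+y. ennreal (w v v' y) \<partial>lborel) = (\<integral>\<^sup>+y. ennreal (1 / sqrt (q\<^sup>2 - y\<^sup>2 - v\<^sup>2) / sqrt (q\<^sup>2 - y\<^sup>2 - v'\<^sup>2)) *
         indicator {y. y\<^sup>2 + v\<^sup>2 < q\<^sup>2 \<and> y\<^sup>2 + v'\<^sup>2 < q\<^sup>2} y \<partial>lborel)"
        by (intro nn_integral_cong) (auto simp: w split: split_indicator)
      thus ?thesis using overlap_density_ge[OF q, of v v'] True by (auto simp: abs_less_iff)
    qed auto
  qed simp
  also have "\<dots> = (\<integral>\<^sup>+v. \<integral>\<^sup>+y. \<integral>\<^sup>+v'. ennreal (\<psi> v v' * w v v' y) \<partial>lborel \<partial>lborel \<partial>lborel)"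
  proof (rule nn_integral_cong)
    fix v :: real
    have "(\<integral>\<^sup>+v'. ennreal (\<psi> v v') * (\<integral>\<^sup>+y. ennreal (w v v' y) \<partial>lborel) \<partial>lborel) = (\<integral>\<^sup>+v'. \<integral>\<^sup>+y. ennreal (\<psi> v v' * w v v' y) \<partial>lborel \<partial>lborel)"
      by (intro nn_integral_cong) (simp add: nn_integral_cmult[symmetric] ennreal_mult nn w0)
    also have "\<dots> = (\<integral>\<^sup>+y. \<integral>\<^sup>+v'. ennreal (\<psi> v v' * w v v' y) \<partial>lborel \<partial>lborel)"
      by (rule lborel_pair.Fubini') measurable
    finally show "(\<integral>\<^sup>+v'. ennreal (\<psi> v v') * (\<integral>\<^sup>+y. ennreal (w v v' y) \<partial>lborel) \<partial>lborel) = (\<integral>\<^sup>+y. \<integral>\<^sup>+v'. ennreal (\<psi> v v' * w v v' y) \<partial>lborel \<partial>lborel)" .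
  qed
  also have "\<dots> = (\<integral>\<^sup>+y. \<integral>\<^sup>+v. \<integral>\<^sup>+v'. ennreal (\<psi> v v' * w v v' y) \<partial>lborel \<partial>lborel \<partial>lborel)"
    by (rule lborel_pair.Fubini') measurable
  also have "\<dots> \<le> (\<integral>\<^sup>+y. (\<integral>\<^sup>+\<theta>. (\<integral>\<^sup>+\<theta>'. ennreal (\<psi> (- sqrt (q\<^sup>2 - y\<^sup>2) * cos \<theta>) (- sqrt (q\<^sup>2 - y\<^sup>2) * cos \<theta>')) \<partial>angle) \<partial>angle)
          * indicator {-q<..<q} y \<partial>lborel)"
  proof (rule nn_integral_mono)
    fix y :: real
    define R where "R = sqrt (q\<^sup>2 - y\<^sup>2)"
    show "(\<integral>\<^sup>+v. \<integral>\<^sup>+v'. ennreal (\<psi> v v' * w v v' y) \<partial>lborel \<partial>lborel) \<le>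
       (\<integral>\<^sup>+\<theta>. (\<integral>\<^sup>+\<theta>'. ennreal (\<psi> (- sqrt (q\<^sup>2 - y\<^sup>2) * cos \<theta>) (- sqrt (q\<^sup>2 - y\<^sup>2) * cos \<theta>')) \<partial>angle) \<partial>angle) * indicator {-q<..<q} y"
    proof (cases "\<bar>y\<bar> < q")
      case False
      hence "\<not> y\<^sup>2 + v\<^sup>2 < q\<^sup>2" for v using sq[of y] zero_le_power2[of v] by linarith
      hence "w v v' y = 0" for v v' by (simp add: w)
      thus ?thesis by simp
    next
      case True
      hence y2: "y\<^sup>2 < q\<^sup>2" by (simp add: sq)
      hence R: "R > 0" "R\<^sup>2 = q\<^sup>2 - y\<^sup>2" by (auto simp: R_def)
      have wR: "w v v' y = 1 / sqrt (R\<^sup>2 - v\<^sup>2) / sqrt (R\<^sup>2 - v'\<^sup>2)" if "\<bar>v\<bar> < R" "\<bar>v'\<bar> < R" for v v'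
      proof -
        have "v\<^sup>2 < R\<^sup>2" "v'\<^sup>2 < R\<^sup>2" using that R(1) by (simp_all add: power2_less_iff_abs_less)
        thus ?thesis by (simp add: w R)
      qed
      have wR0: "w v v' y = 0" if "\<bar>v\<bar> \<ge> R \<or> \<bar>v'\<bar> \<ge> R" for v v'
      proof -
        have "v\<^sup>2 \<ge> R\<^sup>2 \<or> v'\<^sup>2 \<ge> R\<^sup>2" using that R(1) by (metis abs_le_square_iff abs_of_pos)
        thus ?thesis using R by (auto simp: w)
      qed
      have ind: "\<bar>v\<bar> < R \<or> v \<notin> {-R..R} \<or> v = R \<or> v = - R" for v by auto
      have "(\<integral>\<^sup>+v. \<integral>\<^sup>+v'. ennreal (\<psi> v v' * w v v' y) \<partial>lborel \<partial>lborel)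
         \<le> (\<integral>\<^sup>+v. ennreal (1 / sqrt (R\<^sup>2 - v\<^sup>2)) * indicator {-R..R} v * (\<integral>\<^sup>+v'. ennreal (\<psi> v v' / sqrt (R\<^sup>2 - v'\<^sup>2)) * indicator {-R..R} v' \<partial>lborel) \<partial>lborel)"
      proof (subst nn_integral_cmult[symmetric], measurable, intro nn_integral_mono)
        fix v v' :: real
        show "ennreal (\<psi> v v' * w v v' y) \<le> ennreal (1 / sqrt (R\<^sup>2 - v\<^sup>2)) * indicator {-R..R} v * (ennreal (\<psi> v v' / sqrt (R\<^sup>2 - v'\<^sup>2)) * indicator {-R..R} v')"
        proof (cases "\<bar>v\<bar> < R \<and> \<bar>v'\<bar> < R")
          case True
          hence "v\<^sup>2 < R\<^sup>2" "v'\<^sup>2 < R\<^sup>2" using R(1) by (simp_all add: power2_less_iff_abs_less)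
          thus ?thesis using True nn[of v v'] by (auto simp: wR ennreal_mult[symmetric] mult_ac abs_less_iff)
        next
          case False thus ?thesis using wR0[of v v'] by auto
        qed
      qed
      also have "\<dots> \<le> (\<integral>\<^sup>+v. ennreal (1 / sqrt (R\<^sup>2 - v\<^sup>2)) * indicator {-R..R} v * (\<integral>\<^sup>+\<theta>'. ennreal (\<psi> v (- R * cos \<theta>')) \<partial>angle) \<partial>lborel)"
        by (intro nn_integral_mono mult_left_mono nn_integral_arcsine_le_angle[OF _ R(1)]) auto
      also have "\<dots> = (\<integral>\<^sup>+v. \<integral>\<^sup>+\<theta>'. ennreal (1 / sqrt (R\<^sup>2 - v\<^sup>2)) * indicator {-R..R} v * ennreal (\<psi> v (- R * cos \<theta>')) \<partial>angle \<partial>lborel)"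
        by (intro nn_integral_cong nn_integral_cmult[symmetric]) measurable
      also have "\<dots> = (\<integral>\<^sup>+\<theta>'. \<integral>\<^sup>+v. ennreal (1 / sqrt (R\<^sup>2 - v\<^sup>2)) * indicator {-R..R} v * ennreal (\<psi> v (- R * cos \<theta>')) \<partial>lborel \<partial>angle)"
        by (rule angle_lborel.Fubini') measurable
      also have "\<dots> \<le> (\<integral>\<^sup>+\<theta>'. (\<integral>\<^sup>+\<theta>. ennreal (\<psi> (- R * cos \<theta>) (- R * cos \<theta>')) \<partial>angle) \<partial>angle)"
      proof (intro nn_integral_mono)
        fix \<theta>' :: real
        have "(\<integral>\<^sup>+v. ennreal (1 / sqrt (R\<^sup>2 - v\<^sup>2)) * indicator {-R..R} v * ennreal (\<psi> v (- R * cos \<theta>')) \<partial>lborel)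
          \<le> (\<integral>\<^sup>+v. ennreal (\<psi> v (- R * cos \<theta>') / sqrt (R\<^sup>2 - v\<^sup>2)) * indicator {-R..R} v \<partial>lborel)"
        proof (intro nn_integral_mono)
          fix v
          show "ennreal (1 / sqrt (R\<^sup>2 - v\<^sup>2)) * indicator {-R..R} v * ennreal (\<psi> v (- R * cos \<theta>'))
             \<le> ennreal (\<psi> v (- R * cos \<theta>') / sqrt (R\<^sup>2 - v\<^sup>2)) * indicator {-R..R} v"
            using ind[of v] R nn[of v "- R * cos \<theta>'"]
            by (auto simp: ennreal_mult''[symmetric] split: split_indicator)
        qed
        also have "\<dots> \<le> (\<integral>\<^sup>+\<theta>. ennreal (\<psi> (- R * cos \<theta>) (- R * cos \<theta>')) \<partial>angle)"
          by (rule nn_integral_arcsine_le_angle[OF _ R(1)]) measurable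
        finally show "(\<integral>\<^sup>+v. ennreal (1 / sqrt (R\<^sup>2 - v\<^sup>2)) * indicator {-R..R} v * ennreal (\<psi> v (- R * cos \<theta>')) \<partial>lborel)
          \<le> (\<integral>\<^sup>+\<theta>. ennreal (\<psi> (- R * cos \<theta>) (- R * cos \<theta>')) \<partial>angle)" .
      qed
      also have "\<dots> = (\<integral>\<^sup>+\<theta>. (\<integral>\<^sup>+\<theta>'. ennreal (\<psi> (- R * cos \<theta>) (- R * cos \<theta>')) \<partial>angle) \<partial>angle)"
      proof -
        interpret AA: pair_sigma_finite angle angle ..
        show ?thesis by (rule AA.Fubini') measurable
      qed
      finally show ?thesis using True by (auto simp: R_def abs_less_iff)
    qed
  qed
  finally show ?thesis .
qed

section \<open>The gap for biradial functions\<close>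

lemma pred_symmetric_interval [measurable]:
  fixes f g :: "'a \<Rightarrow> real"
  assumes [measurable]: "f \<in> borel_measurable M" "g \<in> borel_measurable M"
  shows "Measurable.pred M (\<lambda>x. g x \<in> {- f x<..<f x})"
  unfolding greaterThanLessThan_iff by measurable

lemma nn_integral_lborel_pair:
  fixes G :: "'a::euclidean_space \<times> 'b::euclidean_space \<Rightarrow> ennreal"
  assumes [measurable]: "G \<in> borel_measurable borel"
  shows "(\<integral>\<^sup>+z. G z \<partial>lborel) = (\<integral>\<^sup>+x. \<integral>\<^sup>+y. G (x, y) \<partial>lborel \<partial>lborel)"
  unfolding lborel_prod[symmetric] by (subst lborel.nn_integral_fst[symmetric]) (simp_all add: lborel_prod)

text \<open>Each squared norm has density \<open>pi\<close>. The change to p = (q + v) / 2, r = (q -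
  v) / 2 has Jacobian \<open>1/2\<close>, and positivity of \<open>p\<close> and \<open>r\<close>
  becomes \<open>|v| < q\<close>. In particular \<open>v\<close> is uniform on the sphere of level
  \<open>q\<close>.\<close>

lemma nn_integral_biradial:
  fixes K :: "real \<Rightarrow> real \<Rightarrow> ennreal"
  assumes K: "case_prod K \<in> borel_measurable (borel \<Otimes>\<^sub>M borel)"
  shows "(\<integral>\<^sup>+z. K ((norm (fst z))\<^sup>2) ((norm (snd z))\<^sup>2) \<partial>(lborel :: ((real^2) \<times> (real^2)) measure))
    = ennreal (pi\<^sup>2 / 2) * (\<integral>\<^sup>+q. \<integral>\<^sup>+v. K ((q + v) / 2) ((q - v) / 2) * indicator {-q<..<q} v \<partial>lborel \<partial>lborel)"
proof -
  note [measurable] = borel_measurable_case_prod_compose[OF K]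
  define I where "I = (\<integral>\<^sup>+q. \<integral>\<^sup>+v. K ((q + v) / 2) ((q - v) / 2) * indicator {-q<..<q} v \<partial>lborel \<partial>lborel)"
  have "(\<integral>\<^sup>+z. K ((norm (fst z))\<^sup>2) ((norm (snd z))\<^sup>2) \<partial>(lborel :: ((real^2) \<times> (real^2)) measure))
     = (\<integral>\<^sup>+x. \<integral>\<^sup>+y. K ((norm (x::real^2))\<^sup>2) ((norm (y::real^2))\<^sup>2) \<partial>lborel \<partial>lborel)"
    by (subst nn_integral_lborel_pair) simp_all
  also have "\<dots> = (\<integral>\<^sup>+x. ennreal pi * (\<integral>\<^sup>+r. K ((norm (x::real^2))\<^sup>2) r * indicator {0<..} r \<partial>lborel) \<partial>lborel)"
    by (intro nn_integral_cong nn_integral_norm_squared) measurable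
  also have "\<dots> = ennreal pi * (\<integral>\<^sup>+p. (ennreal pi * (\<integral>\<^sup>+r. K p r * indicator {0<..} r \<partial>lborel)) * indicator {0<..} p \<partial>lborel)"
    by (rule nn_integral_norm_squared) measurable
  also have "\<dots> = ennreal pi * (ennreal pi * (\<integral>\<^sup>+p. (\<integral>\<^sup>+r. K p r * indicator {0<..} r \<partial>lborel) * indicator {0<..} p \<partial>lborel))"
    by (subst nn_integral_cmult[symmetric]) (simp_all add: mult.assoc)
  also have "(\<integral>\<^sup>+p. (\<integral>\<^sup>+r. K p r * indicator {0<..} r \<partial>lborel) * indicator {0<..} p \<partial>lborel)
      = (\<integral>\<^sup>+p. \<integral>\<^sup>+q. K p (q - p) * indicator {0<..} (q - p) * indicator {0<..} p \<partial>lborel \<partial>lborel)"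
  proof (rule nn_integral_cong)
    fix p :: real
    have "(\<integral>\<^sup>+r. K p r * indicator {0<..} r \<partial>lborel) = (\<integral>\<^sup>+q. K p (q - p) * indicator {0<..} (q - p) \<partial>lborel)"
      by (rule nn_integral_translate[of "\<lambda>r. K p r * indicator {0<..} r", symmetric]) measurable
    thus "(\<integral>\<^sup>+r. K p r * indicator {0<..} r \<partial>lborel) * indicator {0<..} p
       = (\<integral>\<^sup>+q. K p (q - p) * indicator {0<..} (q - p) * indicator {0<..} p \<partial>lborel)"
      by (subst nn_integral_multc) (simp_all, measurable)
  qed
  also have "\<dots> = (\<integral>\<^sup>+q. \<integral>\<^sup>+p. K p (q - p) * indicator {0<..} (q - p) * indicator {0<..} p \<partial>lborel \<partial>lborel)"
    by (rule lborel_pair.Fubini') measurable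
  also have "\<dots> = (\<integral>\<^sup>+q. ennreal (1/2) * (\<integral>\<^sup>+v. K ((q + v) / 2) ((q - v) / 2) * indicator {-q<..<q} v \<partial>lborel) \<partial>lborel)"
  proof (rule nn_integral_cong)
    fix q :: real
    have "(\<integral>\<^sup>+p. K p (q - p) * indicator {0<..} (q - p) * indicator {0<..} p \<partial>lborel)
      = ennreal (1/2) * (\<integral>\<^sup>+v. K (q/2 + 1/2 * v) (q - (q/2 + 1/2 * v)) * indicator {0<..} (q - (q/2 + 1/2 * v)) * indicator {0<..} (q/2 + 1/2 * v) \<partial>lborel)"
      by (subst nn_integral_real_affine[where c="1/2" and t="q/2"]) simp_all
    also have "(\<integral>\<^sup>+v. K (q/2 + 1/2 * v) (q - (q/2 + 1/2 * v)) * indicator {0<..} (q - (q/2 + 1/2 * v)) * indicator {0<..} (q/2 + 1/2 * v) \<partial>lborel)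
      = (\<integral>\<^sup>+v. K ((q + v) / 2) ((q - v) / 2) * indicator {-q<..<q} v \<partial>lborel)"
    proof (rule nn_integral_cong)
      fix v
      have e: "q/2 + 1/2 * v = (q + v) / 2" "q - (q + v) / 2 = (q - v) / 2" by (simp_all add: field_simps)
      show "K (q/2 + 1/2 * v) (q - (q/2 + 1/2 * v)) * indicator {0<..} (q - (q/2 + 1/2 * v)) * indicator {0<..} (q/2 + 1/2 * v)
         = K ((q + v) / 2) ((q - v) / 2) * indicator {-q<..<q} v"
        unfolding e by (auto split: split_indicator)
    qed
    finally show "(\<integral>\<^sup>+p. K p (q - p) * indicator {0<..} (q - p) * indicator {0<..} p \<partial>lborel)
      = ennreal (1/2) * (\<integral>\<^sup>+v. K ((q + v) / 2) ((q - v) / 2) * indicator {-q<..<q} v \<partial>lborel)" .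
  qed
  also have "\<dots> = ennreal (1/2) * I"
    unfolding I_def by (rule nn_integral_cmult) measurable
  also have "ennreal pi * (ennreal pi * (ennreal (1/2) * I)) = ennreal (pi\<^sup>2 / 2) * I"
  proof -
    have "ennreal pi * (ennreal pi * ennreal (1/2)) = ennreal (pi\<^sup>2 / 2)"
      by (simp add: ennreal_mult[symmetric] power2_eq_square del: ennreal_half)
    thus ?thesis by (simp only: mult.assoc[symmetric])
  qed
  finally show ?thesis by (simp only: I_def)
qed

text \<open>On the fibre over \<open>(a, q)\<close> a function of \<open>|\<xi>|\<^sup>2\<close> and \<open>|\<eta>|\<^sup>2\<close> depends on \<open>|\<xi>|\<^sup>2 - |\<eta>|\<^sup>2 = - R cos \<theta>\<close> only.\<close>

lemma norm_cpt_dir: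
  assumes "(norm a)\<^sup>2 < 2 * q" and a: "a = norm a *\<^sub>R dir \<psi>"
  defines "R \<equiv> sqrt (q\<^sup>2 - ((norm a)\<^sup>2 - q)\<^sup>2)"
  shows "(norm (fst (cpt (a, q) \<theta>)))\<^sup>2 = (q + - R * cos (\<theta> + - \<psi>)) / 2"
    and "(norm (snd (cpt (a, q) \<theta>)))\<^sup>2 = (q - - R * cos (\<theta> + - \<psi>)) / 2"
proof -
  define s where "s = sqrt (2 * q - (norm a)\<^sup>2)"
  define b where "b = s *\<^sub>R dir \<theta>"
  have b2: "(norm b)\<^sup>2 = 2 * q - (norm a)\<^sup>2"
    using assms(1) by (simp add: b_def s_def power_mult_distrib)
  have "q\<^sup>2 - ((norm a)\<^sup>2 - q)\<^sup>2 = (norm a)\<^sup>2 * (2 * q - (norm a)\<^sup>2)"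
    by (simp add: power2_eq_square algebra_simps)
  \<comment> \<open>\<open>R\<close> is the product of |a| and |b|, hence the largest value of
    \<open>b \<bullet> a\<close> on the circle.\<close>
  hence R: "R = norm a * s" by (simp add: R_def s_def real_sqrt_mult)
  have "b \<bullet> a = s * norm a * (dir \<theta> \<bullet> dir \<psi>)"
    by (subst a) (simp add: b_def)
  also have "dir \<theta> \<bullet> dir \<psi> = cos (\<theta> + - \<psi>)"
    by (subst inner_e12) (simp add: cos_diff)
  finally have ab: "b \<bullet> a = R * cos (\<theta> + - \<psi>)" by (simp add: R mult.commute)
  have "(norm (fst (cpt (a, q) \<theta>)))\<^sup>2 = (norm (b - a))\<^sup>2 / 4"
    by (simp add: cpt_def Let_def b_def s_def power_divide)
  also have "(norm (b - a))\<^sup>2 = 2 * q - 2 * (b \<bullet> a)"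
    using b2 by (simp add: power2_norm_eq_inner inner_diff_left inner_diff_right inner_commute)
  finally show "(norm (fst (cpt (a, q) \<theta>)))\<^sup>2 = (q + - R * cos (\<theta> + - \<psi>)) / 2" by (simp add: ab)
  have "(norm (snd (cpt (a, q) \<theta>)))\<^sup>2 = (norm (- a - b))\<^sup>2 / 4"
    by (simp add: cpt_def Let_def b_def s_def power_divide)
  also have "(norm (- a - b))\<^sup>2 = 2 * q + 2 * (b \<bullet> a)"
    using b2 by (simp add: power2_norm_eq_inner inner_diff_left inner_diff_right inner_commute)
  finally show "(norm (snd (cpt (a, q) \<theta>)))\<^sup>2 = (q - - R * cos (\<theta> + - \<psi>)) / 2" by (simp add: ab)
qed

text \<open>The direction of \<open>a\<close> only shifts \<theta> and \<theta>', so the spread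
  depends on \<open>a\<close> through |a|^2, whose density \<open>pi\<close> combines with the
  weight \<open>1/4\<close>. Boundedness of \<Phi> makes the Bochner integrals in
  \<open>fibre_spread\<close> finite, so that they agree with the nonnegative ones.\<close>

lemma nn_integral_fibre_spread_biradial:
  fixes \<Phi> :: "real \<Rightarrow> real \<Rightarrow> complex"
  assumes \<Phi>: "case_prod \<Phi> \<in> borel_measurable (borel \<Otimes>\<^sub>M borel)" and bnd: "\<And>p r. cmod (\<Phi> p r) \<le> B"
  defines "F \<equiv> \<lambda>z::(real^2) \<times> (real^2). \<Phi> ((norm (fst z))\<^sup>2) ((norm (snd z))\<^sup>2)"
  defines "\<psi> \<equiv> \<lambda>q v v'. (cmod (\<Phi> ((q + v) / 2) ((q - v) / 2) - \<Phi> ((q + v') / 2) ((q - v') / 2)))\<^sup>2"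
  shows "(\<integral>\<^sup>+p. ennreal (wt p * fibre_spread F p) \<partial>lborel) = ennreal (pi / 4) * (\<integral>\<^sup>+q.
     (\<integral>\<^sup>+y. (\<integral>\<^sup>+\<theta>. (\<integral>\<^sup>+\<theta>'. ennreal (\<psi> q (- sqrt (q\<^sup>2 - y\<^sup>2) * cos \<theta>) (- sqrt (q\<^sup>2 - y\<^sup>2) * cos \<theta>')) \<partial>angle) \<partial>angle)
          * indicator {-q<..<q} y \<partial>lborel) \<partial>lborel)"
proof -
  have \<Phi>m [measurable]: "(\<lambda>x. \<Phi> (f x) (g x)) \<in> borel_measurable N"
    if [measurable]: "f \<in> borel_measurable N" "g \<in> borel_measurable N" for f g and N :: "'c measure"
    using measurable_compose[of "\<lambda>x. (f x, g x)" N "borel \<Otimes>\<^sub>M borel" "case_prod \<Phi>" borel] \<Phi> by simp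
  have [measurable]: "F \<in> borel_measurable borel" unfolding F_def by measurable
  define D where "D q y = (\<integral>\<^sup>+\<theta>. (\<integral>\<^sup>+\<theta>'. ennreal (\<psi> q (- sqrt (q\<^sup>2 - y\<^sup>2) * cos \<theta>) (- sqrt (q\<^sup>2 - y\<^sup>2) * cos \<theta>')) \<partial>angle) \<partial>angle)" for q y
  have [measurable]: "(\<lambda>x. D (f x) (g x)) \<in> borel_measurable N"
    if [measurable]: "f \<in> borel_measurable N" "g \<in> borel_measurable N" for f g and N :: "'c measure"
    unfolding D_def \<psi>_def by measurable
  have spread: "ennreal (fibre_spread F p) = (\<integral>\<^sup>+\<theta>. (\<integral>\<^sup>+\<theta>'. ennreal ((cmod (F (cpt p \<theta>) - F (cpt p \<theta>')))\<^sup>2) \<partial>angle) \<partial>angle)" for p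
  proof -
    have b: "(cmod (F z - F z'))\<^sup>2 \<le> (2 * B)\<^sup>2" for z z'
    proof (rule power_mono)
      show "cmod (F z - F z') \<le> 2 * B"
        using norm_triangle_ineq4[of "F z" "F z'"] bnd by (smt (verit) F_def)
    qed simp
    have i1: "integrable angle (\<lambda>\<theta>'. (cmod (F (cpt p \<theta>) - F (cpt p \<theta>')))\<^sup>2)" for \<theta>
      by (rule angle.integrable_const_bound[where B="(2 * B)\<^sup>2"]) (use b in auto)
    have i2: "integrable angle (\<lambda>\<theta>. \<integral>\<theta>'. (cmod (F (cpt p \<theta>) - F (cpt p \<theta>')))\<^sup>2 \<partial>angle)"
    proof (rule angle.integrable_const_bound[where B="(2 * B)\<^sup>2 * (2 * pi)"])
      have "(\<integral>\<theta>'. (cmod (F (cpt p \<theta>) - F (cpt p \<theta>')))\<^sup>2 \<partial>angle) \<le> (\<integral>\<theta>'. (2 * B)\<^sup>2 \<partial>angle)" for \<theta>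
        by (intro integral_mono i1 b) auto
      moreover have "(\<integral>\<theta>'. (2 * B)\<^sup>2 \<partial>angle) = (2 * B)\<^sup>2 * (2 * pi)" by simp
      moreover have "(\<integral>\<theta>'. (cmod (F (cpt p \<theta>) - F (cpt p \<theta>')))\<^sup>2 \<partial>angle) \<ge> 0" for \<theta>
        by (intro Bochner_Integration.integral_nonneg) simp
      ultimately show "AE \<theta> in angle. norm (\<integral>\<theta>'. (cmod (F (cpt p \<theta>) - F (cpt p \<theta>')))\<^sup>2 \<partial>angle) \<le> (2 * B)\<^sup>2 * (2 * pi)"
        by (intro AE_I2) (simp only: real_norm_def abs_of_nonneg)
    qed measurable
    show ?thesis unfolding fibre_spread_def
      by (subst nn_integral_eq_integral[OF i1]) (auto intro!: nn_integral_eq_integral[OF i2, symmetric])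
  qed
  have fibre: "ennreal (fibre_spread F (a, q)) = D q ((norm a)\<^sup>2 - q)" if aq: "(norm a)\<^sup>2 < 2 * q" for a q
  proof -
    obtain \<alpha> where a: "a = norm a *\<^sub>R dir \<alpha>" by (rule polar_form)
    define R where "R = sqrt (q\<^sup>2 - ((norm a)\<^sup>2 - q)\<^sup>2)"
    have "(cmod (F (cpt (a, q) \<theta>) - F (cpt (a, q) \<theta>')))\<^sup>2 = \<psi> q (- R * cos (\<theta> + - \<alpha>)) (- R * cos (\<theta>' + - \<alpha>))" for \<theta> \<theta>'
      unfolding F_def \<psi>_def R_def by (simp only: norm_cpt_dir[OF aq a])
    hence "ennreal (fibre_spread F (a, q)) = (\<integral>\<^sup>+\<theta>. (\<integral>\<^sup>+\<theta>'. ennreal (\<psi> q (- R * cos (\<theta> + - \<alpha>)) (- R * cos (\<theta>' + - \<alpha>))) \<partial>angle) \<partial>angle)"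
      by (simp only: spread)
    also have "\<dots> = (\<integral>\<^sup>+\<theta>. (\<integral>\<^sup>+\<theta>'. ennreal (\<psi> q (- R * cos (\<theta> + - \<alpha>)) (- R * cos \<theta>')) \<partial>angle) \<partial>angle)"
    proof (rule nn_integral_cong)
      fix \<theta> :: real
      show "(\<integral>\<^sup>+\<theta>'. ennreal (\<psi> q (- R * cos (\<theta> + - \<alpha>)) (- R * cos (\<theta>' + - \<alpha>))) \<partial>angle)
         = (\<integral>\<^sup>+\<theta>'. ennreal (\<psi> q (- R * cos (\<theta> + - \<alpha>)) (- R * cos \<theta>')) \<partial>angle)"
        by (rule nn_integral_angle_shift[of "\<lambda>\<theta>'. ennreal (\<psi> q (- R * cos (\<theta> + - \<alpha>)) (- R * cos \<theta>'))"])
           (simp_all add: \<psi>_def)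
    qed
    also have "\<dots> = (\<integral>\<^sup>+\<theta>. (\<integral>\<^sup>+\<theta>'. ennreal (\<psi> q (- R * cos \<theta>) (- R * cos \<theta>')) \<partial>angle) \<partial>angle)"
      by (rule nn_integral_angle_shift[of "\<lambda>\<theta>. (\<integral>\<^sup>+\<theta>'. ennreal (\<psi> q (- R * cos \<theta>) (- R * cos \<theta>')) \<partial>angle)"])
         (simp_all add: \<psi>_def)
    finally show ?thesis by (simp add: D_def R_def)
  qed
  \<comment> \<open>\<open>A\<close> stands for |a|^2. After the shift \<open>A = q + y\<close> the
    two conditions \<open>0 < A\<close> and \<open>A < 2 * q\<close> become
    \<open>|y| < q\<close>.\<close>
  define E where "E q A = ennreal (if A < 2 * q then 1/4 else 0) * D q (A - q)" for q A
  have [measurable]: "(\<lambda>x. E (f x) (g x)) \<in> borel_measurable N"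
    if [measurable]: "f \<in> borel_measurable N" "g \<in> borel_measurable N" for f g and N :: "'c measure"
    unfolding E_def by measurable
  have [measurable]: "fibre_spread F \<in> borel_measurable borel"
    unfolding fibre_spread_def[abs_def] by measurable
  have "(\<integral>\<^sup>+p. ennreal (wt p * fibre_spread F p) \<partial>lborel) = (\<integral>\<^sup>+a. \<integral>\<^sup>+q. ennreal (wt (a, q) * fibre_spread F (a, q)) \<partial>lborel \<partial>lborel)"
    by (rule nn_integral_lborel_pair) measurable
  also have "\<dots> = (\<integral>\<^sup>+a. \<integral>\<^sup>+q. E q ((norm (a::real^2))\<^sup>2) \<partial>lborel \<partial>lborel)"
  proof (intro nn_integral_cong)
    fix a :: "real^2" and q :: real
    show "ennreal (wt (a, q) * fibre_spread F (a, q)) = E q ((norm (a::real^2))\<^sup>2)"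
    proof (cases "(norm a)\<^sup>2 < 2 * q")
      case True
      have "ennreal (wt (a, q) * fibre_spread F (a, q)) = ennreal (wt (a, q)) * ennreal (fibre_spread F (a, q))"
        by (rule ennreal_mult') simp
      thus ?thesis using True unfolding fibre[OF True] by (simp add: E_def wt_def)
    qed (simp add: E_def wt_def)
  qed
  also have "\<dots> = (\<integral>\<^sup>+q. \<integral>\<^sup>+a. E q ((norm (a::real^2))\<^sup>2) \<partial>lborel \<partial>lborel)"
    by (rule lborel_pair.Fubini') measurable
  also have "\<dots> = (\<integral>\<^sup>+q. ennreal pi * (\<integral>\<^sup>+A. E q A * indicator {0<..} A \<partial>lborel) \<partial>lborel)"
    by (rule nn_integral_cong, rule nn_integral_norm_squared) measurable
  also have "\<dots> = (\<integral>\<^sup>+q. ennreal (pi / 4) * (\<integral>\<^sup>+y. D q y * indicator {-q<..<q} y \<partial>lborel) \<partial>lborel)"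
  proof (rule nn_integral_cong)
    fix q :: real
    have "(\<integral>\<^sup>+A. E q A * indicator {0<..} A \<partial>lborel) = (\<integral>\<^sup>+y. E q (q + 1 * y) * indicator {0<..} (q + 1 * y) \<partial>lborel)"
      by (subst nn_integral_real_affine[where c=1 and t=q]) simp_all
    also have "\<dots> = (\<integral>\<^sup>+y. ennreal (1/4) * (D q y * indicator {-q<..<q} y) \<partial>lborel)"
      by (intro nn_integral_cong) (auto simp: E_def split: split_indicator)
    also have "\<dots> = ennreal (1/4) * (\<integral>\<^sup>+y. D q y * indicator {-q<..<q} y \<partial>lborel)"
      by (rule nn_integral_cmult) measurable
    finally have "ennreal pi * (\<integral>\<^sup>+A. E q A * indicator {0<..} A \<partial>lborel) = ennreal pi * ennreal (1/4) * (\<integral>\<^sup>+y. D q y * indicator {-q<..<q} y \<partial>lborel)"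
      by (simp only: mult.assoc)
    moreover have "ennreal pi * ennreal (1/4) = ennreal (pi / 4)" by (subst ennreal_mult[symmetric]) auto
    ultimately show "ennreal pi * (\<integral>\<^sup>+A. E q A * indicator {0<..} A \<partial>lborel) = ennreal (pi / 4) * (\<integral>\<^sup>+y. D q y * indicator {-q<..<q} y \<partial>lborel)"
      by (simp only:)
  qed
  also have "\<dots> = ennreal (pi / 4) * (\<integral>\<^sup>+q. \<integral>\<^sup>+y. D q y * indicator {-q<..<q} y \<partial>lborel \<partial>lborel)"
    by (rule nn_integral_cmult) measurable
  finally show ?thesis by (simp only: D_def)
qed

text \<open>The mean of the biradial function over the sphere |z|^2 = q, since \<open>v\<close> is
  uniform on an interval of length \<open>2 * q\<close>. For \<open>q \<le> 0\<close> the interval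
  is empty and the value is 0.\<close>

definition shell_mean :: "(real \<Rightarrow> real \<Rightarrow> complex) \<Rightarrow> real \<Rightarrow> complex" where
  "shell_mean \<Phi> q = (\<integral>v. indicator {-q<..<q} v *\<^sub>R \<Phi> ((q + v) / 2) ((q - v) / 2) \<partial>lborel) / of_real (2 * q)"

text \<open>The variance identity for Lebesgue measure on the interval, of mass
  \<open>2 * q\<close>. Subtracting the mean leaves differences unchanged and makes the square of
  the integral vanish, so that the factor is 2 times \<open>2 * q\<close>.\<close>

lemma nn_integral_spread_interval:
  fixes \<phi> :: "real \<Rightarrow> complex"
  assumes [measurable]: "\<phi> \<in> borel_measurable borel" and bnd: "\<And>v. cmod (\<phi> v) \<le> B" and q: "q > 0"
  defines "m \<equiv> (\<integral>v. indicator {-q<..<q} v *\<^sub>R \<phi> v \<partial>lborel) / of_real (2 * q)"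
  shows "(\<integral>\<^sup>+v. (\<integral>\<^sup>+v'. ennreal ((cmod (\<phi> v - \<phi> v'))\<^sup>2) * indicator {-q<..<q} v' \<partial>lborel) * indicator {-q<..<q} v \<partial>lborel)
    = ennreal (4 * q) * (\<integral>\<^sup>+v. ennreal ((cmod (\<phi> v - m))\<^sup>2) * indicator {-q<..<q} v \<partial>lborel)"
proof -
  define M where "M = density lborel (\<lambda>v. indicator {-q<..<q} v :: ennreal)"
  have sM [measurable_cong]: "sets M = sets borel" and spM: "space M = UNIV" by (auto simp: M_def)
  have mass: "emeasure M UNIV = ennreal (2 * q)" using q by (simp add: M_def emeasure_density)
  interpret finite_measure M by (rule finite_measureI) (simp add: mass spM)
  have mm: "measure M (space M) = 2 * q" using q by (simp add: measure_def mass spM)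
  have nnM: "(\<integral>\<^sup>+v. f v \<partial>M) = (\<integral>\<^sup>+v. f v * indicator {-q<..<q} v \<partial>lborel)" if [measurable]: "f \<in> borel_measurable borel" for f
    unfolding M_def by (subst nn_integral_density) (auto simp: mult.commute)
  have intM: "(\<integral>v. f v \<partial>M) = (\<integral>v. indicator {-q<..<q} v *\<^sub>R f v \<partial>lborel)" if [measurable]: "f \<in> borel_measurable borel" for f :: "real \<Rightarrow> complex"
    unfolding M_def using integral_density[of f lborel "indicator {-q<..<q}"] by (simp add: ennreal_indicator)
  define f where "f v = \<phi> v - m" for v
  have [measurable]: "f \<in> borel_measurable borel" unfolding f_def[abs_def] by measurable
  have fb: "cmod (f v) \<le> B + cmod m" for v
    using norm_triangle_ineq4[of "\<phi> v" m] bnd[of v] by (simp add: f_def)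
  have f2: "integrable M (\<lambda>v. (cmod (f v))\<^sup>2)"
    by (rule integrable_const_bound[where B="(B + cmod m)\<^sup>2"]) (auto intro!: power_mono fb)
  have \<phi>i: "integrable M \<phi>" by (rule integrable_const_bound[where B=B]) (auto intro: bnd)
  have "(\<integral>v. f v \<partial>M) = (\<integral>v. \<phi> v \<partial>M) - of_real (2 * q) * m"
    unfolding f_def using \<phi>i mm by (simp add: scaleR_conv_of_real spM)
  also have "\<dots> = 0" using q by (subst intM) (simp_all add: m_def)
  finally have f0: "(\<integral>v. f v \<partial>M) = 0" .
  note v = variance_identity[OF finite_measure_axioms _ f2] variance_integrable[OF finite_measure_axioms _ f2]
  have i1: "integrable M (\<lambda>y. (cmod (f x - f y))\<^sup>2)" for x by (rule v(2)) measurable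
  have i2: "integrable M (\<lambda>x. \<integral>y. (cmod (f x - f y))\<^sup>2 \<partial>M)"
  proof (rule integrable_const_bound[where B="(2 * (B + cmod m))\<^sup>2 * (2 * q)"])
    have "(cmod (f x - f y))\<^sup>2 \<le> (2 * (B + cmod m))\<^sup>2" for x y
      using norm_triangle_ineq4[of "f x" "f y"] fb[of x] fb[of y] by (intro power_mono) auto
    hence "(\<integral>y. (cmod (f x - f y))\<^sup>2 \<partial>M) \<le> (\<integral>y. (2 * (B + cmod m))\<^sup>2 \<partial>M)" for x
      by (intro integral_mono i1) auto
    thus "AE x in M. norm (\<integral>y. (cmod (f x - f y))\<^sup>2 \<partial>M) \<le> (2 * (B + cmod m))\<^sup>2 * (2 * q)"
      by (intro AE_I2) (simp add: mm mult.commute)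
  qed measurable
  have "(\<integral>\<^sup>+v. (\<integral>\<^sup>+v'. ennreal ((cmod (\<phi> v - \<phi> v'))\<^sup>2) * indicator {-q<..<q} v' \<partial>lborel) * indicator {-q<..<q} v \<partial>lborel)
     = (\<integral>\<^sup>+x. (\<integral>\<^sup>+y. ennreal ((cmod (f x - f y))\<^sup>2) \<partial>M) \<partial>M)"
  proof -
    have a: "(\<integral>\<^sup>+y. ennreal ((cmod (f x - f y))\<^sup>2) \<partial>M) = (\<integral>\<^sup>+v'. ennreal ((cmod (\<phi> x - \<phi> v'))\<^sup>2) * indicator {-q<..<q} v' \<partial>lborel)" for x
      by (subst nnM) (simp_all add: f_def)
    show ?thesis unfolding a by (subst nnM) simp_all
  qed
  also have "\<dots> = ennreal (\<integral>x. (\<integral>y. (cmod (f x - f y))\<^sup>2 \<partial>M) \<partial>M)"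
    by (subst nn_integral_eq_integral[OF i1]) (auto intro!: nn_integral_eq_integral[OF i2])
  also have "(\<integral>x. (\<integral>y. (cmod (f x - f y))\<^sup>2 \<partial>M) \<partial>M) = 4 * q * (\<integral>x. (cmod (f x))\<^sup>2 \<partial>M)"
    by (subst v(1)) (simp_all add: f0 mm)
  also have "ennreal \<dots> = ennreal (4 * q) * (\<integral>\<^sup>+x. ennreal ((cmod (f x))\<^sup>2) \<partial>M)"
    using q by (subst nn_integral_eq_integral[OF f2]) (auto simp: ennreal_mult)
  also have "\<dots> = ennreal (4 * q) * (\<integral>\<^sup>+v. ennreal ((cmod (\<phi> v - m))\<^sup>2) * indicator {-q<..<q} v \<partial>lborel)"
    by (subst nnM) (simp_all add: f_def)
  finally show ?thesis .
qed

lemma shell_mean_measurable: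
  assumes \<Phi>: "case_prod \<Phi> \<in> borel_measurable (borel \<Otimes>\<^sub>M borel)"
  shows "shell_mean \<Phi> \<in> borel_measurable borel"
proof -
  note [measurable] = borel_measurable_case_prod_compose[OF \<Phi>]
  show ?thesis unfolding shell_mean_def[abs_def] by measurable
qed

text \<open>For each \<open>q\<close> the minorization constant \<open>pi / q\<close> meets the
  factor \<open>4 * q\<close> of the variance, and the product \<open>4 * pi\<close> is free of
  \<open>q\<close>. Comparing \<open>pi / 4\<close> times \<open>4 * pi\<close> with the biradial
  density \<open>pi^2 / 2\<close> gives the factor 2.\<close>

lemma nn_integral_shell_mean_le:
  fixes \<Phi> :: "real \<Rightarrow> real \<Rightarrow> complex"
  assumes \<Phi>: "case_prod \<Phi> \<in> borel_measurable (borel \<Otimes>\<^sub>M borel)" and bnd: "\<And>p r. cmod (\<Phi> p r) \<le> B"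
  defines "F \<equiv> \<lambda>z::(real^2) \<times> (real^2). \<Phi> ((norm (fst z))\<^sup>2) ((norm (snd z))\<^sup>2)"
  shows "2 * (\<integral>\<^sup>+z. ennreal ((cmod (F z - shell_mean \<Phi> ((norm z)\<^sup>2)))\<^sup>2) \<partial>lborel)
     \<le> (\<integral>\<^sup>+p. ennreal (wt p * fibre_spread F p) \<partial>lborel)"
proof -
  note [measurable] = borel_measurable_case_prod_compose[OF \<Phi>]
  note shell_mean_measurable[OF \<Phi>, measurable]
  define \<psi> where "\<psi> q v v' = (cmod (\<Phi> ((q + v) / 2) ((q - v) / 2) - \<Phi> ((q + v') / 2) ((q - v') / 2)))\<^sup>2" for q v v'
  define X where "X q = (\<integral>\<^sup>+v. ennreal ((cmod (\<Phi> ((q + v) / 2) ((q - v) / 2) - shell_mean \<Phi> q))\<^sup>2) * indicator {-q<..<q} v \<partial>lborel)" for q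
  have [measurable]: "X \<in> borel_measurable borel" unfolding X_def[abs_def] by measurable
  define Y where "Y q = (\<integral>\<^sup>+y. (\<integral>\<^sup>+\<theta>. (\<integral>\<^sup>+\<theta>'. ennreal (\<psi> q (- sqrt (q\<^sup>2 - y\<^sup>2) * cos \<theta>) (- sqrt (q\<^sup>2 - y\<^sup>2) * cos \<theta>')) \<partial>angle) \<partial>angle)
          * indicator {-q<..<q} y \<partial>lborel)" for q
  have Y: "(\<integral>\<^sup>+p. ennreal (wt p * fibre_spread F p) \<partial>lborel) = ennreal (pi / 4) * (\<integral>\<^sup>+q. Y q \<partial>lborel)"
    unfolding F_def Y_def \<psi>_def by (rule nn_integral_fibre_spread_biradial[OF \<Phi> bnd])
  have XY: "ennreal (4 * pi) * X q \<le> Y q" for q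
  proof (cases "q > 0")
    case False
    hence "{-q<..<q} = {}" by auto
    thus ?thesis by (simp add: X_def)
  next
    case True
    have "ennreal (pi / q) * (\<integral>\<^sup>+v. (\<integral>\<^sup>+v'. ennreal (\<psi> q v v') * indicator {-q<..<q} v' \<partial>lborel) * indicator {-q<..<q} v \<partial>lborel) \<le> Y q"
      unfolding Y_def by (rule doeblin_minorization) (simp_all add: \<psi>_def True)
    also have "(\<integral>\<^sup>+v. (\<integral>\<^sup>+v'. ennreal (\<psi> q v v') * indicator {-q<..<q} v' \<partial>lborel) * indicator {-q<..<q} v \<partial>lborel) = ennreal (4 * q) * X q"
      unfolding \<psi>_def X_def shell_mean_def
      by (rule nn_integral_spread_interval[where \<phi>="\<lambda>v. \<Phi> ((q + v) / 2) ((q - v) / 2)"]) (use bnd True in auto)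
    also have "ennreal (pi / q) * (ennreal (4 * q) * X q) = ennreal (4 * pi) * X q"
    proof -
      have "ennreal (pi / q) * ennreal (4 * q) = ennreal (4 * pi)" using True by (subst ennreal_mult[symmetric]) auto
      thus ?thesis by (simp only: mult.assoc[symmetric])
    qed
    finally show ?thesis .
  qed
  have n: "(norm z)\<^sup>2 = (norm (fst z))\<^sup>2 + (norm (snd z))\<^sup>2" for z :: "(real^2) \<times> (real^2)"
    by (cases z) (simp add: norm_Pair)
  have "(\<integral>\<^sup>+z. ennreal ((cmod (F z - shell_mean \<Phi> ((norm z)\<^sup>2)))\<^sup>2) \<partial>lborel)
     = (\<integral>\<^sup>+z. ennreal ((cmod (\<Phi> ((norm (fst z))\<^sup>2) ((norm (snd z))\<^sup>2) - shell_mean \<Phi> ((norm (fst z))\<^sup>2 + (norm (snd z))\<^sup>2)))\<^sup>2) \<partial>(lborel :: ((real^2) \<times> (real^2)) measure))"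
    by (simp only: F_def n)
  also have "\<dots> = ennreal (pi\<^sup>2 / 2) * (\<integral>\<^sup>+q. \<integral>\<^sup>+v. ennreal ((cmod (\<Phi> ((q + v) / 2) ((q - v) / 2) - shell_mean \<Phi> ((q + v) / 2 + (q - v) / 2)))\<^sup>2) * indicator {-q<..<q} v \<partial>lborel \<partial>lborel)"
    by (rule nn_integral_biradial[where K="\<lambda>p r. ennreal ((cmod (\<Phi> p r - shell_mean \<Phi> (p + r)))\<^sup>2)"]) measurable
  also have "\<dots> = ennreal (pi\<^sup>2 / 2) * (\<integral>\<^sup>+q. X q \<partial>lborel)"
    by (simp add: X_def field_simps)
  finally have "2 * (\<integral>\<^sup>+z. ennreal ((cmod (F z - shell_mean \<Phi> ((norm z)\<^sup>2)))\<^sup>2) \<partial>lborel) = 2 * ennreal (pi\<^sup>2 / 2) * (\<integral>\<^sup>+q. X q \<partial>lborel)"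
    by (simp only: mult.assoc)
  also have "2 * ennreal (pi\<^sup>2 / 2) = ennreal (pi / 4) * ennreal (4 * pi)"
  proof -
    have "2 * ennreal (pi\<^sup>2 / 2) = ennreal 2 * ennreal (pi\<^sup>2 / 2)" by simp
    also have "\<dots> = ennreal (2 * (pi\<^sup>2 / 2))" by (rule ennreal_mult[symmetric]) auto
    also have "2 * (pi\<^sup>2 / 2) = (pi / 4) * (4 * pi)" by (simp add: power2_eq_square)
    also have "ennreal \<dots> = ennreal (pi / 4) * ennreal (4 * pi)" by (rule ennreal_mult) auto
    finally show ?thesis .
  qed
  also have "ennreal (pi / 4) * ennreal (4 * pi) * (\<integral>\<^sup>+q. X q \<partial>lborel) = ennreal (pi / 4) * (\<integral>\<^sup>+q. ennreal (4 * pi) * X q \<partial>lborel)"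
    by (subst nn_integral_cmult) (simp_all add: mult.assoc)
  also have "\<dots> \<le> ennreal (pi / 4) * (\<integral>\<^sup>+q. Y q \<partial>lborel)"
    by (intro mult_left_mono nn_integral_mono XY) auto
  finally show ?thesis by (simp only: Y)
qed

section \<open>Schwartz functions\<close>

text \<open>A product of weights in single coordinates: its integrability is a question in one
  variable, and a unit shift along a basis vector changes it by a bounded factor.\<close>

definition bracket_weight :: "'a::euclidean_space \<Rightarrow> real" where
  "bracket_weight x = (\<Prod>b\<in>Basis. inverse (1 + (x \<bullet> b)\<^sup>2))"

lemma bracket_weight_pos: "bracket_weight x > 0"
  unfolding bracket_weight_def by (intro prod_pos ballI) (simp add: add_pos_nonneg)

lemma integrable_bracket_weight: "integrable lborel (bracket_weight :: 'a::euclidean_space \<Rightarrow> real)"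
proof -
  have "integrable lborel (\<lambda>x::real. inverse (1 + x\<^sup>2))"
    using integrable_inverse_1_plus_square by (simp add: set_integrable_def)
  thus ?thesis unfolding bracket_weight_def[abs_def] by (intro integrable_lborel_prod)
qed

text \<open>The inverse weight grows like a polynomial of degree \<open>2 * DIM('a)\<close>, so two
  decay bounds, of order 0 and of that order, dominate a function by a multiple of the
  weight.\<close>

lemma bracket_weight_ge:
  fixes x :: "'a::euclidean_space"
  shows "inverse (bracket_weight x) \<le> 2 ^ DIM('a) * (1 + norm x ^ (2 * DIM('a)))"
proof -
  have "inverse (bracket_weight x) = (\<Prod>b\<in>Basis. 1 + (x \<bullet> b)\<^sup>2)"
    unfolding bracket_weight_def prod_inversef[unfolded o_def] by simp
  also have "\<dots> \<le> (\<Prod>b\<in>(Basis::'a set). 1 + (norm x)\<^sup>2)"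
  proof (rule prod_mono)
    fix b :: 'a assume "b \<in> Basis"
    hence "\<bar>x \<bullet> b\<bar> \<le> \<bar>norm x\<bar>" by (simp add: Basis_le_norm)
    hence "(x \<bullet> b)\<^sup>2 \<le> (norm x)\<^sup>2" by (simp only: abs_le_square_iff)
    thus "0 \<le> 1 + (x \<bullet> b)\<^sup>2 \<and> 1 + (x \<bullet> b)\<^sup>2 \<le> 1 + (norm x)\<^sup>2" by (simp add: add_nonneg_nonneg)
  qed
  also have "\<dots> = (1 + (norm x)\<^sup>2) ^ DIM('a)" by simp
  also have "\<dots> \<le> 2 ^ DIM('a) * (1 + norm x ^ (2 * DIM('a)))"
  proof (cases "norm x \<le> 1")
    case True
    have "(1 + (norm x)\<^sup>2) ^ DIM('a) \<le> 2 ^ DIM('a)"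
      using True by (intro power_mono) (auto simp: power_le_one)
    also have "\<dots> \<le> 2 ^ DIM('a) * (1 + norm x ^ (2 * DIM('a)))" by simp
    finally show ?thesis .
  next
    case False
    hence "1 + (norm x)\<^sup>2 \<le> 2 * (norm x)\<^sup>2" by (simp add: one_le_power)
    hence "(1 + (norm x)\<^sup>2) ^ DIM('a) \<le> (2 * (norm x)\<^sup>2) ^ DIM('a)" by (intro power_mono) auto
    also have "\<dots> = 2 ^ DIM('a) * norm x ^ (2 * DIM('a))" by (simp add: power_mult_distrib power_mult)
    also have "\<dots> \<le> 2 ^ DIM('a) * (1 + norm x ^ (2 * DIM('a)))" by simp
    finally show ?thesis .
  qed
  finally show ?thesis .
qed

text \<open>The decay in \<open>schwartz\<close> isolated from the derivatives; this much is also
  established for Fourier transforms of Schwartz functions.\<close>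

definition rapidly_decreasing :: "('a::euclidean_space \<Rightarrow> complex) \<Rightarrow> bool" where
  "rapidly_decreasing f \<longleftrightarrow> (\<forall>k::nat. bounded (range (\<lambda>x. norm x ^ k *\<^sub>R f x)))"

lemma rapidly_decreasingD:
  assumes "rapidly_decreasing f"
  shows "\<exists>B\<ge>0. \<forall>x. norm x ^ k * cmod (f x) \<le> B"
proof -
  have "bounded (range (\<lambda>x. norm x ^ k *\<^sub>R f x))"
    using assms by (simp add: rapidly_decreasing_def)
  then obtain B where B: "\<And>x. norm (norm x ^ k *\<^sub>R f x) \<le> B"
    by (auto simp: bounded_iff)
  have "B \<ge> 0" by (rule order_trans[OF norm_ge_zero B])
  thus ?thesis using B by auto
qed

lemma rapidly_decreasing_weight:
  fixes f :: "'a::euclidean_space \<Rightarrow> complex"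
  assumes "rapidly_decreasing f"
  shows "\<exists>C\<ge>0. \<forall>x. cmod (f x) \<le> C * bracket_weight x"
proof -
  obtain A where "A \<ge> 0" and A: "\<And>x. norm x ^ 0 * cmod (f x) \<le> A"
    using rapidly_decreasingD[OF assms, of 0] by blast
  obtain B where "B \<ge> 0" and B: "\<And>x. norm x ^ (2 * DIM('a)) * cmod (f x) \<le> B"
    using rapidly_decreasingD[OF assms, of "2 * DIM('a)"] by blast
  show ?thesis
  proof (intro exI conjI allI)
    show "2 ^ DIM('a) * (A + B) \<ge> 0" using \<open>0 \<le> A\<close> \<open>0 \<le> B\<close> by simp
    fix x
    have "cmod (f x) * inverse (bracket_weight x) \<le> cmod (f x) * (2 ^ DIM('a) * (1 + norm x ^ (2 * DIM('a))))"
      by (intro mult_left_mono bracket_weight_ge) simp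
    also have "\<dots> = 2 ^ DIM('a) * (cmod (f x) + norm x ^ (2 * DIM('a)) * cmod (f x))" by (simp add: algebra_simps)
    also have "\<dots> \<le> 2 ^ DIM('a) * (A + B)" using A[of x] B[of x] by (intro mult_left_mono add_mono) auto
    finally show "cmod (f x) \<le> 2 ^ DIM('a) * (A + B) * bracket_weight x"
      using bracket_weight_pos[of x] by (simp add: field_simps)
  qed
qed

lemma
  fixes f :: "'a::euclidean_space \<Rightarrow> complex"
  assumes f: "rapidly_decreasing f" and [measurable]: "f \<in> borel_measurable borel"
  shows rapidly_decreasing_integrable: "integrable lborel f"
    and rapidly_decreasing_square_integrable: "integrable lborel (\<lambda>x. (cmod (f x))\<^sup>2)"
proof -
  obtain C where C: "C \<ge> 0" "\<And>x. cmod (f x) \<le> C * bracket_weight x"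
    using rapidly_decreasing_weight[OF f] by blast
  have i: "integrable lborel (\<lambda>x::'a. C * bracket_weight x)" using integrable_bracket_weight by auto
  have n: "norm (C * bracket_weight x) = C * bracket_weight x" for x :: 'a
    using C(1) bracket_weight_pos[of x] by simp
  show f1: "integrable lborel f"
    by (rule Bochner_Integration.integrable_bound[OF i]) (use C n in auto)
  obtain A where A: "\<And>x. norm x ^ 0 * cmod (f x) \<le> A"
    using rapidly_decreasingD[OF f, of 0] by blast
  show "integrable lborel (\<lambda>x. (cmod (f x))\<^sup>2)"
  proof (rule Bochner_Integration.integrable_bound)
    show "integrable lborel (\<lambda>x. A * cmod (f x))" using f1 by auto
    have "(cmod (f x))\<^sup>2 \<le> \<bar>A * cmod (f x)\<bar>" for x
    proof -
      have "(cmod (f x))\<^sup>2 \<le> A * cmod (f x)" using A[of x] by (simp add: power2_eq_square mult_right_mono)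
      thus ?thesis by linarith
    qed
    thus "AE x in lborel. norm ((cmod (f x))\<^sup>2) \<le> norm (A * cmod (f x))" by simp
  qed measurable
qed

section \<open>Schwartz functions, their derivatives and their transforms\<close>

lemma schwartz_rapidly_decreasing: "schwartz f \<Longrightarrow> rapidly_decreasing f"
  unfolding schwartz_def rapidly_decreasing_def by (drule spec[of _ "[]"]) simp

lemma schwartz_differentiable: "schwartz f \<Longrightarrow> f differentiable (at x)"
  unfolding schwartz_def by (drule spec[of _ "[]"]) simp

lemma schwartz_measurable: "schwartz f \<Longrightarrow> f \<in> borel_measurable borel"
  by (intro borel_measurable_continuous_onI differentiable_imp_continuous_on)
     (simp add: differentiable_on_def schwartz_differentiable)

abbreviation partial_derivative :: "'a::euclidean_space \<Rightarrow> ('a \<Rightarrow> complex) \<Rightarrow> 'a \<Rightarrow> complex" where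
  "partial_derivative b f \<equiv> iterated_derivative [b] f"

text \<open>The last entry of the list is differentiated first, so appending \<open>b\<close> at the
  end amounts to starting from a derivative of \<open>f\<close>. This yields closure of
  \<open>schwartz\<close> under partial derivatives.\<close>

lemma iterated_derivative_snoc: "iterated_derivative (vs @ [b]) f = iterated_derivative vs (partial_derivative b f)"
  by (induction vs) auto

lemma schwartz_partial_derivative:
  assumes f: "schwartz f" and b: "b \<in> Basis"
  shows "schwartz (partial_derivative b f)"
  unfolding schwartz_def
proof (intro allI impI)
  fix vs :: "'a list" assume "set vs \<subseteq> Basis"
  hence "set (vs @ [b]) \<subseteq> Basis" using b by simp
  with f show "(\<forall>x. iterated_derivative vs (partial_derivative b f) differentiable (at x)) \<and>
      (\<forall>k. bounded (range (\<lambda>x. norm x ^ k *\<^sub>R iterated_derivative vs (partial_derivative b f) x)))"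
    unfolding schwartz_def iterated_derivative_snoc[symmetric] by blast
qed

lemma schwartz_vector_derivative:
  assumes "schwartz f"
  shows "((\<lambda>s. f (x + s *\<^sub>R b)) has_vector_derivative partial_derivative b f (x + s *\<^sub>R b)) (at s)"
proof -
  have "(f has_derivative frechet_derivative f (at (x + s *\<^sub>R b))) (at (x + s *\<^sub>R b))"
    using schwartz_differentiable[OF assms] by (simp add: frechet_derivative_works)
  moreover have "((\<lambda>s. x + s *\<^sub>R b) has_derivative (\<lambda>t. t *\<^sub>R b)) (at s)"
    by (auto intro!: derivative_eq_intros)
  ultimately have "((\<lambda>s. f (x + s *\<^sub>R b)) has_derivative (\<lambda>t. frechet_derivative f (at (x + s *\<^sub>R b)) (t *\<^sub>R b))) (at s)"
    by (rule has_derivative_compose[rotated])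
  moreover have "linear (frechet_derivative f (at (x + s *\<^sub>R b)))"
    using schwartz_differentiable[OF assms] by (rule linear_frechet_derivative)
  ultimately show ?thesis by (simp add: has_vector_derivative_def linear_cmul)
qed

text \<open>In each coordinate x^2 \<le> 2 (x + t)^2 + 2 t^2, and t^2 \<le> 1 turns this into a
  factor 3. The uniformity in \<open>s\<close> provides a single integrable majorant for all
  difference quotients.\<close>

lemma bracket_weight_shift:
  fixes x :: "'a::euclidean_space"
  assumes b: "b \<in> Basis" and s: "\<bar>s\<bar> \<le> 1"
  shows "bracket_weight (x + s *\<^sub>R b) \<le> 3 ^ DIM('a) * bracket_weight x"
proof -
  have "bracket_weight (x + s *\<^sub>R b) \<le> (\<Prod>c\<in>Basis. 3 * inverse (1 + (x \<bullet> c)\<^sup>2))"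
    unfolding bracket_weight_def
  proof (rule prod_mono)
    fix c :: 'a assume c: "c \<in> Basis"
    define t where "t = s * (b \<bullet> c)"
    have "\<bar>t\<bar> \<le> 1" using s b c by (simp add: t_def inner_Basis)
    hence t: "t\<^sup>2 \<le> 1" by (simp add: abs_square_le_1)
    define A where "A = (x \<bullet> c + t)\<^sup>2"
    have "(x \<bullet> c)\<^sup>2 \<le> 2 * A + 2 * t\<^sup>2"
      using zero_le_power2[of "x \<bullet> c + 2 * t"] by (simp add: A_def power2_eq_square algebra_simps)
    moreover have "A \<ge> 0" by (simp add: A_def)
    ultimately have "1 + (x \<bullet> c)\<^sup>2 \<le> 3 * (1 + A)" using t by argo
    hence "1 + (x \<bullet> c)\<^sup>2 \<le> 3 * (1 + (x \<bullet> c + t)\<^sup>2)" by (simp only: A_def)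
    moreover have "1 + (x \<bullet> c)\<^sup>2 > 0" "1 + (x \<bullet> c + t)\<^sup>2 > 0" by (simp_all add: add_pos_nonneg)
    ultimately have "inverse (1 + (x \<bullet> c + t)\<^sup>2) \<le> 3 * inverse (1 + (x \<bullet> c)\<^sup>2)"
      by (simp add: field_simps)
    thus "0 \<le> inverse (1 + ((x + s *\<^sub>R b) \<bullet> c)\<^sup>2) \<and> inverse (1 + ((x + s *\<^sub>R b) \<bullet> c)\<^sup>2) \<le> 3 * inverse (1 + (x \<bullet> c)\<^sup>2)"
      by (simp add: t_def inner_add_left)
  qed
  also have "\<dots> = 3 ^ DIM('a) * bracket_weight x" by (simp add: prod.distrib bracket_weight_def)
  finally show ?thesis .
qed

text \<open>
  Differentiation under the Fourier integral, by translating \<open>f\<close> and letting the step of the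
  difference quotient tend to zero; this avoids integration by parts in one coordinate.
\<close>

lemma fourier_partial_derivative:
  fixes f :: "'a::euclidean_space \<Rightarrow> complex"
  assumes f: "schwartz f" and b: "b \<in> Basis"
  shows "fourier (partial_derivative b f) \<xi> = \<i> * of_real (\<xi> \<bullet> b) * fourier f \<xi>"
proof -
  define g where "g = partial_derivative b f"
  have g: "schwartz g" unfolding g_def by (rule schwartz_partial_derivative[OF f b])
  have [measurable]: "f \<in> borel_measurable borel" "g \<in> borel_measurable borel"
    using f g by (auto intro: schwartz_measurable)
  have fi: "integrable lborel f" using f by (intro rapidly_decreasing_integrable schwartz_rapidly_decreasing) auto
  obtain C where C: "C \<ge> 0" "\<And>x. cmod (g x) \<le> C * bracket_weight x"
    using rapidly_decreasing_weight[OF schwartz_rapidly_decreasing[OF g]] by blast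
  \<comment> \<open>Steps that are positive, at most 1 as the shift of the weight demands, and tend
    to 0.\<close>
  define h where "h n = 1 / real (Suc n)" for n
  have h: "h n > 0" "h n \<le> 1" for n by (auto simp: h_def)
  have hlim: "h \<longlonglongrightarrow> 0" unfolding h_def by (rule LIMSEQ_Suc[OF lim_1_over_n])
  define q where "q n x = (f (x + h n *\<^sub>R b) - f x) / of_real (h n)" for n x
  have vd: "((\<lambda>s. f (x + s *\<^sub>R b)) has_derivative (\<lambda>t. t *\<^sub>R g (x + s *\<^sub>R b))) (at s)" for x s
    using schwartz_vector_derivative[OF f, of x b s] by (simp add: has_vector_derivative_def g_def)
  have qlim: "(\<lambda>n. q n x) \<longlonglongrightarrow> g x" for x
  proof -
    have "((\<lambda>s. norm (f (x + s *\<^sub>R b) - f x - s *\<^sub>R g x) / norm s) \<longlongrightarrow> 0) (at 0)"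
      using vd[of x 0] unfolding has_derivative_at by simp
    moreover have "filterlim h (at 0) sequentially"
      using hlim h(1) by (auto simp: filterlim_at intro!: always_eventually less_imp_neq[THEN not_sym])
    ultimately have "(\<lambda>n. norm (f (x + h n *\<^sub>R b) - f x - h n *\<^sub>R g x) / norm (h n)) \<longlonglongrightarrow> 0"
      by (rule filterlim_compose)
    moreover have "norm (f (x + h n *\<^sub>R b) - f x - h n *\<^sub>R g x) / norm (h n) = norm (q n x - g x)" for n
    proof -
      have "q n x - g x = (f (x + h n *\<^sub>R b) - f x - h n *\<^sub>R g x) / of_real (h n)"
        using h(1)[of n] by (simp add: q_def diff_divide_distrib scaleR_conv_of_real)
      thus ?thesis by (simp add: norm_divide)
    qed
    ultimately have "(\<lambda>n. norm (q n x - g x)) \<longlonglongrightarrow> 0" by simp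
    thus ?thesis by (rule LIM_zero_cancel[OF tendsto_norm_zero_cancel])
  qed
  \<comment> \<open>The mean value inequality on a segment of length at most 1, with the derivative
    controlled by the shifted weight: the majorant for dominated convergence.\<close>
  have qb: "cmod (q n x) \<le> C * 3 ^ DIM('a) * bracket_weight x" for n x
  proof -
    define B where "B = C * (3 ^ DIM('a) * bracket_weight x)"
    have "norm ((\<lambda>s. f (x + s *\<^sub>R b)) (h n) - (\<lambda>s. f (x + s *\<^sub>R b)) 0) \<le> B * norm (h n - 0)"
    proof (rule differentiable_bound[where S="{0..h n}" and f'="\<lambda>s t. t *\<^sub>R g (x + s *\<^sub>R b)"])
      show "((\<lambda>s. f (x + s *\<^sub>R b)) has_derivative (\<lambda>t. t *\<^sub>R g (x + s *\<^sub>R b))) (at s within {0..h n})" for s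
        using vd by (rule has_derivative_at_withinI)
      fix s assume s: "s \<in> {0..h n}"
      hence "cmod (g (x + s *\<^sub>R b)) \<le> C * bracket_weight (x + s *\<^sub>R b)" using C by auto
      also have "\<dots> \<le> B" unfolding B_def
        using s h(2)[of n] by (intro mult_left_mono bracket_weight_shift b C(1)) auto
      finally show "onorm (\<lambda>t. t *\<^sub>R g (x + s *\<^sub>R b)) \<le> B"
        by (subst onorm_scaleR_left) (auto simp: onorm_id)
    qed (use h[of n] in auto)
    thus ?thesis using h(1)[of n] by (simp add: q_def norm_divide B_def field_simps)
  qed
  have lim1: "(\<lambda>n. \<integral>x. cis (- (x \<bullet> \<xi>)) * q n x \<partial>lborel) \<longlonglongrightarrow> fourier g \<xi>"
    unfolding fourier_def
  proof (rule integral_dominated_convergence)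
    show "integrable lborel (\<lambda>x::'a. C * 3 ^ DIM('a) * bracket_weight x)"
      using integrable_bracket_weight by auto
    show "AE x in lborel. (\<lambda>n. cis (- (x \<bullet> \<xi>)) * q n x) \<longlonglongrightarrow> cis (- (x \<bullet> \<xi>)) * g x"
      using qlim by (intro AE_I2 tendsto_intros)
    show "AE x in lborel. norm (cis (- (x \<bullet> \<xi>)) * q n x) \<le> C * 3 ^ DIM('a) * bracket_weight x" for n
      using qb by (intro AE_I2) (simp add: norm_mult)
  qed (simp_all add: q_def)
  \<comment> \<open>Translating \<open>f\<close> by \<open>h n\<close> along \<open>b\<close>
    multiplies its transform by \<open>cis (h n * (\<xi> \<bullet> b))\<close>; the limit below is
    then the derivative of an exponential at 0.\<close>
  have "(\<integral>x. cis (- (x \<bullet> \<xi>)) * q n x \<partial>lborel) = (cis (h n * (\<xi> \<bullet> b)) - 1) / of_real (h n) * fourier f \<xi>" for n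
  proof -
    have fi': "integrable lborel (\<lambda>x. f (x + h n *\<^sub>R b))"
      using integrable_reflect[OF integrable_reflect[OF fi, of "h n *\<^sub>R b"], of 0] by (simp add: add.commute)
    have "(\<integral>x. cis (- (x \<bullet> \<xi>)) * f (x + h n *\<^sub>R b) \<partial>lborel) = cis (h n * (\<xi> \<bullet> b)) * fourier f \<xi>"
    proof -
      define k where "k y = cis (- (y \<bullet> \<xi>)) * f y" for y
      have [measurable]: "k \<in> borel_measurable borel" unfolding k_def[abs_def] by measurable
      have shift: "(\<integral>x. k (x + h n *\<^sub>R b) \<partial>lborel) = (\<integral>x. k x \<partial>lborel)"
        using integral_reflect[of "\<lambda>z. k (h n *\<^sub>R b - z)" 0] integral_reflect[of k "h n *\<^sub>R b"] by (simp add: add.commute)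
      have modulate: "cis (- (x \<bullet> \<xi>)) * f (x + h n *\<^sub>R b) = cis (h n * (\<xi> \<bullet> b)) * k (x + h n *\<^sub>R b)" for x
      proof -
        have "h n * (\<xi> \<bullet> b) + - ((x + h n *\<^sub>R b) \<bullet> \<xi>) = - (x \<bullet> \<xi>)"
          by (simp add: inner_add_left inner_commute[of b \<xi>])
        thus ?thesis by (simp only: k_def mult.assoc[symmetric] cis_mult)
      qed
      show ?thesis unfolding modulate integral_mult_right_zero shift
        by (simp add: fourier_def k_def[abs_def])
    qed
    moreover have eq: "cis (- (x \<bullet> \<xi>)) * q n x = (cis (- (x \<bullet> \<xi>)) * f (x + h n *\<^sub>R b) - cis (- (x \<bullet> \<xi>)) * f x) / of_real (h n)" for x
      by (simp add: q_def right_diff_distrib diff_divide_distrib)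
    moreover have "integrable lborel (\<lambda>x. cis (- (x \<bullet> \<xi>)) * f (x + h n *\<^sub>R b))" "integrable lborel (\<lambda>x. cis (- (x \<bullet> \<xi>)) * f x)"
      by (intro integrable_cis_mult fi fi', measurable)+
    ultimately have "(\<integral>x. cis (- (x \<bullet> \<xi>)) * q n x \<partial>lborel) = (cis (h n * (\<xi> \<bullet> b)) * fourier f \<xi> - fourier f \<xi>) / of_real (h n)"
      unfolding eq integral_divide_zero by (subst Bochner_Integration.integral_diff) (simp_all only: fourier_def)
    thus ?thesis by (simp add: left_diff_distrib)
  qed
  moreover have "(\<lambda>n. (cis (h n * (\<xi> \<bullet> b)) - 1) / of_real (h n) * fourier f \<xi>) \<longlonglongrightarrow> \<i> * of_real (\<xi> \<bullet> b) * fourier f \<xi>"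
  proof (intro tendsto_mult tendsto_const)
    define c where "c = \<xi> \<bullet> b"
    have "((\<lambda>z. exp (z * (\<i> * of_real c))) has_field_derivative \<i> * of_real c) (at 0)"
      by (auto intro!: derivative_eq_intros)
    hence "((\<lambda>z. (exp (z * (\<i> * of_real c)) - 1) / z) \<longlongrightarrow> \<i> * of_real c) (at 0)"
      by (simp add: has_field_derivative_iff)
    moreover have "filterlim (\<lambda>n. complex_of_real (h n)) (at 0) sequentially"
      using tendsto_of_real[OF hlim, where 'a=complex] h(1)
      by (auto simp: filterlim_at intro!: always_eventually less_imp_neq[THEN not_sym])
    ultimately have "(\<lambda>n. (exp (of_real (h n) * (\<i> * of_real c)) - 1) / of_real (h n)) \<longlonglongrightarrow> \<i> * of_real c"
      by (rule filterlim_compose)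
    thus "(\<lambda>n. (cis (h n * (\<xi> \<bullet> b)) - 1) / complex_of_real (h n)) \<longlonglongrightarrow> \<i> * of_real (\<xi> \<bullet> b)"
      by (simp add: cis_conv_exp c_def mult_ac)
  qed
  ultimately show ?thesis using lim1 LIMSEQ_unique unfolding g_def by (simp only:) blast
qed

text \<open>Each partial derivative of \<open>f\<close> gains one factor \<xi> \<bullet> b on the
  transform, so induction on \<open>k\<close>, with \<open>f\<close> arbitrary, bounds the
  \<open>k\<close>-th power of every coordinate. The norm is at most the dimension times the largest
  coordinate.\<close>

lemma schwartz_fourier_rapidly_decreasing:
  fixes f :: "'a::euclidean_space \<Rightarrow> complex"
  assumes f: "schwartz f"
  shows "rapidly_decreasing (fourier f)"
  unfolding rapidly_decreasing_def
proof
  fix k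
  have "\<exists>B. \<forall>\<xi>. \<bar>\<xi> \<bullet> b\<bar> ^ k * cmod (fourier f \<xi>) \<le> B" if b: "b \<in> Basis" for b
    using f
  proof (induction k arbitrary: f)
    case 0
    have "integrable lborel f"
      using 0 by (intro rapidly_decreasing_integrable schwartz_rapidly_decreasing schwartz_measurable)
    thus ?case using norm_fourier_le by auto
  next
    case (Suc k)
    from Suc.IH[OF schwartz_partial_derivative[OF Suc.prems b]]
    obtain B where "\<And>\<xi>. \<bar>\<xi> \<bullet> b\<bar> ^ k * cmod (fourier (partial_derivative b f) \<xi>) \<le> B" by blast
    thus ?case unfolding fourier_partial_derivative[OF Suc.prems b] by (auto simp: norm_mult mult_ac)
  qed
  then obtain B where B: "\<And>b \<xi>. b \<in> Basis \<Longrightarrow> \<bar>\<xi> \<bullet> b\<bar> ^ k * cmod (fourier f \<xi>) \<le> B b" by metis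
  have "norm (norm \<xi> ^ k *\<^sub>R fourier f \<xi>) \<le> real DIM('a) ^ k * (\<Sum>b\<in>Basis. B b)" for \<xi>
  proof -
    define m where "m = Max ((\<lambda>b. \<bar>\<xi> \<bullet> b\<bar>) ` Basis)"
    have "m \<in> (\<lambda>b. \<bar>\<xi> \<bullet> b\<bar>) ` Basis" unfolding m_def by (intro Max_in) auto
    then obtain c where c: "c \<in> Basis" "m = \<bar>\<xi> \<bullet> c\<bar>" by auto
    have "norm \<xi> \<le> (\<Sum>b\<in>Basis. \<bar>\<xi> \<bullet> b\<bar>)" by (rule norm_le_l1)
    also have "\<dots> \<le> (\<Sum>b\<in>(Basis::'a set). m)" unfolding m_def by (intro sum_mono Max_ge) auto
    finally have "norm \<xi> \<le> real DIM('a) * \<bar>\<xi> \<bullet> c\<bar>" by (simp add: c)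
    hence "norm \<xi> ^ k \<le> (real DIM('a) * \<bar>\<xi> \<bullet> c\<bar>) ^ k" by (intro power_mono) auto
    hence "norm \<xi> ^ k * cmod (fourier f \<xi>) \<le> (real DIM('a) * \<bar>\<xi> \<bullet> c\<bar>) ^ k * cmod (fourier f \<xi>)" by (intro mult_right_mono) auto
    also have "\<dots> = real DIM('a) ^ k * (\<bar>\<xi> \<bullet> c\<bar> ^ k * cmod (fourier f \<xi>))" by (simp add: power_mult_distrib)
    also have "\<dots> \<le> real DIM('a) ^ k * (\<Sum>b\<in>Basis. B b)"
    proof (rule mult_left_mono)
      have "B b \<ge> 0" if "b \<in> Basis" for b
        using B[OF that, of 0] by (rule order_trans[rotated]) simp
      hence "B c \<le> (\<Sum>b\<in>Basis. B b)" using c by (intro member_le_sum) auto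
      thus "\<bar>\<xi> \<bullet> c\<bar> ^ k * cmod (fourier f \<xi>) \<le> (\<Sum>b\<in>Basis. B b)" using B[OF c(1), of \<xi>] by linarith
    qed simp
    finally show ?thesis by simp
  qed
  thus "bounded (range (\<lambda>x. norm x ^ k *\<^sub>R fourier f x))" unfolding bounded_iff by blast
qed

text \<open>The link to \<open>diagonal_trace\<close>: the bound for the restriction becomes
  available for every Schwartz function over which that definition quantifies.\<close>

lemma schwartz_admissible: "schwartz f \<Longrightarrow> admissible f"
  unfolding admissible_def
  by (intro conjI rapidly_decreasing_integrable rapidly_decreasing_square_integrable
      schwartz_rapidly_decreasing schwartz_fourier_rapidly_decreasing schwartz_measurable fourier_borel)

text \<open>Polynomials times Gaussians, generated so as to be stable under partial derivatives. The
  class serves to show that Gaussians are Schwartz functions.\<close>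

inductive polynomial_gaussian :: "('a::euclidean_space \<Rightarrow> complex) \<Rightarrow> bool" where
  gaussian: "(\<And>b. b \<in> Basis \<Longrightarrow> a b > 0) \<Longrightarrow> polynomial_gaussian (\<lambda>x. of_real (gaussian a x))"
| coord: "polynomial_gaussian f \<Longrightarrow> b \<in> Basis \<Longrightarrow> polynomial_gaussian (\<lambda>x. of_real (x \<bullet> b) * f x)"
| add: "polynomial_gaussian f \<Longrightarrow> polynomial_gaussian g \<Longrightarrow> polynomial_gaussian (\<lambda>x. f x + g x)"
| scale: "polynomial_gaussian f \<Longrightarrow> polynomial_gaussian (\<lambda>x. c * f x)"

text \<open>The total derivative is exhibited as a linear map at each point, because uniqueness of
  the derivative then identifies the \<open>frechet_derivative\<close> inside
  \<open>iterated_derivative\<close>.\<close>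

lemma polynomial_gaussian_derivative:
  assumes "polynomial_gaussian f"
  shows "\<exists>f'. (\<forall>x. (f has_derivative f' x) (at x)) \<and> (\<forall>b\<in>Basis. polynomial_gaussian (\<lambda>x. f' x b))"
  using assms
proof induction
  case (gaussian a)
  define f' where "f' x h = complex_of_real (gaussian a x * - (\<Sum>c\<in>Basis. a c * (2 * (x \<bullet> c) * (h \<bullet> c))))" for x h
  have "((\<lambda>x. of_real (gaussian a x)) has_derivative f' x) (at x)" for x
    unfolding gaussian_def[abs_def] f'_def
    by (auto intro!: derivative_eq_intros simp: fun_eq_iff sum_distrib_left sum_distrib_right mult_ac power2_eq_square sum_negf)
  moreover have "polynomial_gaussian (\<lambda>x. f' x b)" if b: "b \<in> Basis" for b
  proof -
    have "(\<Sum>c\<in>Basis. a c * (2 * (x \<bullet> c) * (b \<bullet> c))) = a b * (2 * (x \<bullet> b))" for x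
    proof -
      have "(\<Sum>c\<in>Basis. a c * (2 * (x \<bullet> c) * (b \<bullet> c))) = (\<Sum>c\<in>Basis. if c = b then a b * (2 * (x \<bullet> b)) else 0)"
        using b by (intro sum.cong) (auto simp: inner_Basis)
      thus ?thesis using b by simp
    qed
    hence "(\<lambda>x. f' x b) = (\<lambda>x. of_real (- 2 * a b) * (of_real (x \<bullet> b) * of_real (gaussian a x)))"
      by (simp add: f'_def fun_eq_iff)
    thus ?thesis using gaussian b by (simp only:) (intro polynomial_gaussian.intros)
  qed
  ultimately show ?case by blast
next
  case (coord f b)
  then obtain f' where f': "\<And>x. (f has_derivative f' x) (at x)" "\<And>b. b \<in> Basis \<Longrightarrow> polynomial_gaussian (\<lambda>x. f' x b)" by blast
  have "((\<lambda>x. of_real (x \<bullet> b) * f x) has_derivative (\<lambda>h. of_real (x \<bullet> b) * f' x h + of_real (h \<bullet> b) * f x)) (at x)" for x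
    by (auto intro!: derivative_eq_intros f'(1))
  moreover have "polynomial_gaussian (\<lambda>x. of_real (x \<bullet> b) * f' x c + of_real (c \<bullet> b) * f x)" if "c \<in> Basis" for c
    using coord f'(2)[OF that] by (intro polynomial_gaussian.intros)
  ultimately show ?case
    by (intro exI[of _ "\<lambda>x h. of_real (x \<bullet> b) * f' x h + of_real (h \<bullet> b) * f x"]) blast
next
  case (add f g)
  then obtain f' g' where "\<And>x. (f has_derivative f' x) (at x)" "\<And>b. b \<in> Basis \<Longrightarrow> polynomial_gaussian (\<lambda>x. f' x b)"
    "\<And>x. (g has_derivative g' x) (at x)" "\<And>b. b \<in> Basis \<Longrightarrow> polynomial_gaussian (\<lambda>x. g' x b)" by blast
  thus ?case by (intro exI[of _ "\<lambda>x h. f' x h + g' x h"]) (auto intro: polynomial_gaussian.add has_derivative_add)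
next
  case (scale f c)
  then obtain f' where "\<And>x. (f has_derivative f' x) (at x)" "\<And>b. b \<in> Basis \<Longrightarrow> polynomial_gaussian (\<lambda>x. f' x b)" by blast
  thus ?case by (intro exI[of _ "\<lambda>x h. c * f' x h"]) (auto intro: polynomial_gaussian.scale has_derivative_mult_right)
qed

text \<open>For \<open>r > 1\<close>, one term of the exponential series at t = c r^2 bounds t^k exp
  (- t) by \<open>fact k\<close>, and r^k \<le> r^(2 k). The summand 1 covers
  \<open>r \<le> 1\<close>.\<close>

lemma power_exp_bounded:
  fixes c :: real
  assumes c: "c > 0" and r: "r \<ge> 0"
  shows "r ^ k * exp (- c * r\<^sup>2) \<le> 1 + fact k / c ^ k"
proof (cases "r \<le> 1")
  case True
  have "r ^ k * exp (- c * r\<^sup>2) \<le> 1 * 1"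
    using True r c by (intro mult_mono power_le_one) auto
  also have "\<dots> \<le> 1 + fact k / c ^ k" using c by simp
  finally show ?thesis by simp
next
  case False
  define t where "t = c * r\<^sup>2"
  have t: "t > 0" using c False by (simp add: t_def)
  have "t ^ k / fact k \<le> exp t"
  proof -
    have "(\<Sum>n\<in>{k}. t ^ n /\<^sub>R fact n) \<le> (\<Sum>n. t ^ n /\<^sub>R fact n)"
      using t by (intro sum_le_suminf summable_exp_generic) auto
    thus ?thesis by (simp add: exp_def divide_inverse mult.commute)
  qed
  hence "t ^ k * exp (- t) \<le> fact k" by (simp add: exp_minus field_simps)
  hence "(r\<^sup>2) ^ k * exp (- t) \<le> fact k / c ^ k" using c by (simp add: t_def power_mult_distrib field_simps)
  moreover have "r ^ k \<le> (r\<^sup>2) ^ k" using False r by (intro power_mono) (auto simp: power2_eq_square)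
  ultimately have "r ^ k * exp (- t) \<le> fact k / c ^ k"
    by (meson exp_ge_zero mult_right_mono order_trans)
  thus ?thesis by (simp add: t_def)
qed

text \<open>The exponent \<open>k\<close> is left arbitrary in the induction, since a coordinate
  factor is paid for by one more power of the norm.\<close>

lemma polynomial_gaussian_rapidly_decreasing:
  assumes "polynomial_gaussian (f :: 'a::euclidean_space \<Rightarrow> complex)"
  shows "rapidly_decreasing f"
  unfolding rapidly_decreasing_def bounded_iff
proof
  fix k
  have "\<exists>B. \<forall>x. norm x ^ k * cmod (f x) \<le> B"
    using assms
  proof (induction arbitrary: k)
    case (gaussian a)
    define c where "c = Min (a ` Basis)"
    have "c \<in> a ` Basis" unfolding c_def by (intro Min_in) auto
    hence c: "c > 0" using gaussian by auto
    have "gaussian a x \<le> exp (- c * (norm x)\<^sup>2)" for x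
    proof -
      have "(\<Sum>b\<in>Basis. c * (x \<bullet> b)\<^sup>2) \<le> (\<Sum>b\<in>Basis. a b * (x \<bullet> b)\<^sup>2)"
        unfolding c_def by (intro sum_mono mult_right_mono Min_le) auto
      hence "gaussian a x \<le> gaussian (\<lambda>_. c) x" by (simp add: gaussian_def)
      thus ?thesis by (simp add: gaussian_const)
    qed
    hence "norm x ^ k * gaussian a x \<le> norm x ^ k * exp (- c * (norm x)\<^sup>2)" for x :: 'a by (intro mult_left_mono) auto
    hence "norm x ^ k * gaussian a x \<le> 1 + fact k / c ^ k" for x :: 'a
      using power_exp_bounded[OF c, of "norm x" k] by (meson norm_ge_zero order_trans)
    thus ?case by (auto simp: gaussian_pos less_imp_le)
  next
    case (coord f b)
    obtain B where B: "\<And>x. norm x ^ Suc k * cmod (f x) \<le> B" using coord.IH by blast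
    have "norm x ^ k * cmod (of_real (x \<bullet> b) * f x) \<le> norm x ^ k * (norm x * cmod (f x))" for x
      using Basis_le_norm[OF coord.hyps(2), of x] by (intro mult_left_mono) (auto simp: norm_mult intro: mult_right_mono)
    hence "norm x ^ k * cmod (of_real (x \<bullet> b) * f x) \<le> B" for x
      using B[of x] by (simp add: mult_ac) (meson order_trans)
    thus ?case by blast
  next
    case (add f g)
    obtain A B where "\<And>x. norm x ^ k * cmod (f x) \<le> A" "\<And>x. norm x ^ k * cmod (g x) \<le> B" using add.IH by metis
    hence "norm x ^ k * cmod (f x + g x) \<le> A + B" for x
      using mult_left_mono[OF norm_triangle_ineq[of "f x" "g x"], of "norm x ^ k"]
      by (simp add: distrib_left) (smt (verit))
    thus ?case by blast
  next
    case (scale f c)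
    obtain B where "\<And>x. norm x ^ k * cmod (f x) \<le> B" using scale.IH by blast
    hence "norm x ^ k * cmod (c * f x) \<le> cmod c * B" for x
      using mult_left_mono[of "norm x ^ k * cmod (f x)" B "cmod c"] by (simp add: norm_mult mult_ac)
    thus ?case by blast
  qed
  thus "\<exists>B. \<forall>y\<in>range (\<lambda>x. norm x ^ k *\<^sub>R f x). norm y \<le> B" by auto
qed

lemma polynomial_gaussian_schwartz:
  assumes "polynomial_gaussian (f :: 'a::euclidean_space \<Rightarrow> complex)"
  shows "schwartz f"
proof -
  have pg: "polynomial_gaussian (iterated_derivative vs f)" if "set vs \<subseteq> Basis" for vs
    using that
  proof (induction vs)
    case (Cons v vs)
    then obtain f' where f': "\<And>x. (iterated_derivative vs f has_derivative f' x) (at x)" "polynomial_gaussian (\<lambda>x. f' x v)"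
      using polynomial_gaussian_derivative by (metis list.set_intros(1) set_subset_Cons subset_trans subsetD)
    have "frechet_derivative (iterated_derivative vs f) (at x) = f' x" for x
      using frechet_derivative_at[OF f'(1)] by simp
    thus ?case using f'(2) by simp
  qed (use assms in simp)
  show ?thesis unfolding schwartz_def
  proof (intro allI impI conjI)
    fix vs :: "'a list" assume vs: "set vs \<subseteq> Basis"
    show "iterated_derivative vs f differentiable (at x)" for x
      using polynomial_gaussian_derivative[OF pg[OF vs]] unfolding differentiable_def by blast
    show "bounded (range (\<lambda>x. norm x ^ k *\<^sub>R iterated_derivative vs f x))" for k
      using polynomial_gaussian_rapidly_decreasing[OF pg[OF vs]] unfolding rapidly_decreasing_def by blast
  qed
qed

section \<open>The space of square integrable functions\<close>

lemma L2D: "f \<in> L2 \<Longrightarrow> f \<in> borel_measurable lebesgue" "f \<in> L2 \<Longrightarrow> integrable lebesgue (\<lambda>x. (cmod (f x))\<^sup>2)"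
  by (auto simp: L2_def)

lemma L2_borelI:
  assumes "f \<in> borel_measurable borel" "integrable lborel (\<lambda>x. (cmod (f x))\<^sup>2)"
  shows "f \<in> L2"
  using assms by (auto simp: L2_def integrable_completion intro: measurable_completion)

lemma L2_norm_borel:
  assumes "f \<in> borel_measurable borel"
  shows "L2_norm f = sqrt (\<integral>x. (cmod (f x))\<^sup>2 \<partial>lborel)"
  using assms by (simp add: L2_norm_def integral_completion)

lemma L2_norm_nonneg [simp]: "L2_norm f \<ge> 0"
  by (simp add: L2_norm_def)

lemma L2_norm_power2: "(L2_norm f)\<^sup>2 = (\<integral>x. (cmod (f x))\<^sup>2 \<partial>lebesgue)"
  by (simp add: L2_norm_def)

text \<open>The cross term is split by the arithmetic-geometric mean inequality with a free weight
  \<open>t\<close>, to be optimised in the triangle inequality.\<close>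

lemma norm_add_power2_le:
  fixes a b :: complex
  assumes "t > 0"
  shows "(cmod (a + b))\<^sup>2 \<le> (1 + t) * (cmod a)\<^sup>2 + (1 + 1 / t) * (cmod b)\<^sup>2"
proof -
  have "2 * (sqrt t * cmod a) * (cmod b / sqrt t) \<le> (sqrt t * cmod a)\<^sup>2 + (cmod b / sqrt t)\<^sup>2"
    by (rule sum_squares_bound)
  hence *: "2 * (cmod a * cmod b) \<le> t * (cmod a)\<^sup>2 + 1 / t * (cmod b)\<^sup>2"
    using assms by (simp add: power_mult_distrib power_divide)
  have "(cmod (a + b))\<^sup>2 \<le> (cmod a + cmod b)\<^sup>2" by (intro power_mono norm_triangle_ineq) auto
  also have "\<dots> = (cmod a)\<^sup>2 + 2 * (cmod a * cmod b) + (cmod b)\<^sup>2" by (simp add: power2_eq_square algebra_simps)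
  finally show ?thesis using * by (simp add: algebra_simps)
qed

lemma L2_add:
  assumes "f \<in> L2" "g \<in> L2"
  shows "(\<lambda>x. f x + g x) \<in> L2"
proof -
  note [measurable] = L2D(1)[OF assms(1)] L2D(1)[OF assms(2)]
  have "integrable lebesgue (\<lambda>x. (cmod (f x + g x))\<^sup>2)"
  proof (rule Bochner_Integration.integrable_bound)
    show "integrable lebesgue (\<lambda>x. 2 * (cmod (f x))\<^sup>2 + 2 * (cmod (g x))\<^sup>2)"
      using L2D(2)[OF assms(1)] L2D(2)[OF assms(2)] by simp
    show "AE x in lebesgue. norm ((cmod (f x + g x))\<^sup>2) \<le> norm (2 * (cmod (f x))\<^sup>2 + 2 * (cmod (g x))\<^sup>2)"
    proof (rule AE_I2)
      fix x show "norm ((cmod (f x + g x))\<^sup>2) \<le> norm (2 * (cmod (f x))\<^sup>2 + 2 * (cmod (g x))\<^sup>2)"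
        using norm_add_power2_le[of 1 "f x" "g x"] by simp
    qed
  qed measurable
  thus ?thesis by (simp add: L2_def)
qed

lemma L2_scale: "f \<in> L2 \<Longrightarrow> (\<lambda>x. c * f x) \<in> L2"
  by (auto simp: L2_def norm_mult power_mult_distrib)

lemma L2_diff:
  assumes "f \<in> L2" "g \<in> L2"
  shows "(\<lambda>x. f x - g x) \<in> L2"
  using L2_add[OF assms(1) L2_scale[OF assms(2), of "-1"]] by simp

text \<open>The optimal weight is the ratio of the two norms. Both are enlarged by
  \<open>e / 2\<close> so that the ratio makes sense when a norm vanishes.\<close>

lemma L2_norm_add:
  assumes f: "f \<in> L2" and g: "g \<in> L2"
  shows "L2_norm (\<lambda>x. f x + g x) \<le> L2_norm f + L2_norm g"
proof (rule field_le_epsilon)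
  fix e :: real assume e: "e > 0"
  define A where "A = L2_norm f + e / 2"
  define B where "B = L2_norm g + e / 2"
  have AB: "A > 0" "B > 0" using e by (auto simp: A_def B_def add_nonneg_pos)
  have "(L2_norm (\<lambda>x. f x + g x))\<^sup>2 \<le> (\<integral>x. (1 + B / A) * (cmod (f x))\<^sup>2 + (1 + A / B) * (cmod (g x))\<^sup>2 \<partial>lebesgue)"
    unfolding L2_norm_power2
  proof (rule integral_mono)
    show "integrable lebesgue (\<lambda>x. (cmod (f x + g x))\<^sup>2)" using L2_add[OF f g] by (auto simp: L2_def)
    show "integrable lebesgue (\<lambda>x. (1 + B / A) * (cmod (f x))\<^sup>2 + (1 + A / B) * (cmod (g x))\<^sup>2)"
      using L2D(2)[OF f] L2D(2)[OF g] by simp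
    fix x show "(cmod (f x + g x))\<^sup>2 \<le> (1 + B / A) * (cmod (f x))\<^sup>2 + (1 + A / B) * (cmod (g x))\<^sup>2"
      using norm_add_power2_le[of "B / A" "f x" "g x"] AB by simp
  qed
  also have "\<dots> = (1 + B / A) * (L2_norm f)\<^sup>2 + (1 + A / B) * (L2_norm g)\<^sup>2"
    unfolding L2_norm_power2 using L2D(2)[OF f] L2D(2)[OF g] by simp
  also have "\<dots> \<le> (1 + B / A) * A\<^sup>2 + (1 + A / B) * B\<^sup>2"
    using e AB by (intro add_mono mult_left_mono power_mono) (auto simp: A_def B_def)
  also have "\<dots> = (A + B)\<^sup>2" using AB by (simp add: power2_eq_square field_simps)
  finally have sq: "(L2_norm (\<lambda>x. f x + g x))\<^sup>2 \<le> (A + B)\<^sup>2" .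
  have "L2_norm (\<lambda>x. f x + g x) \<le> A + B" by (rule power2_le_imp_le[OF sq]) (use AB in simp)
  thus "L2_norm (\<lambda>x. f x + g x) \<le> L2_norm f + L2_norm g + e" by (simp add: A_def B_def)
qed

lemma L2_norm_minus_commute: "L2_norm (\<lambda>x. f x - g x) = L2_norm (\<lambda>x. g x - f x)"
  by (simp add: L2_norm_def norm_minus_commute)

lemma L2_norm_triangle:
  assumes "f \<in> L2" "g \<in> L2" "h \<in> L2"
  shows "L2_norm (\<lambda>x. f x - h x) \<le> L2_norm (\<lambda>x. f x - g x) + L2_norm (\<lambda>x. g x - h x)"
  using L2_norm_add[OF L2_diff[OF assms(1,2)] L2_diff[OF assms(2,3)]] by simp

lemma L2_norm_le_add_diff:
  assumes "f \<in> L2" "g \<in> L2"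
  shows "L2_norm f \<le> L2_norm g + L2_norm (\<lambda>x. f x - g x)"
  using L2_norm_add[OF assms(2) L2_diff[OF assms]] by simp

lemma L2_norm_scale: "L2_norm (\<lambda>x. c * f x) = cmod c * L2_norm f"
  by (simp add: L2_norm_def norm_mult power_mult_distrib real_sqrt_mult)

lemma nn_integral_L2:
  assumes "f \<in> L2"
  shows "(\<integral>\<^sup>+x. ennreal ((cmod (f x))\<^sup>2) \<partial>lebesgue) = ennreal ((L2_norm f)\<^sup>2)"
  unfolding L2_norm_power2 using assms by (intro nn_integral_eq_integral L2D) auto

lemma L2_nn_integralI:
  assumes [measurable]: "f \<in> borel_measurable lebesgue"
    and le: "(\<integral>\<^sup>+x. ennreal ((cmod (f x))\<^sup>2) \<partial>lebesgue) \<le> ennreal (e\<^sup>2)" and e: "e \<ge> 0"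
  shows "f \<in> L2" "L2_norm f \<le> e"
proof -
  have "integrable lebesgue (\<lambda>x. (cmod (f x))\<^sup>2)"
    by (rule integrableI_bounded) (auto intro: le_less_trans[OF le])
  thus f: "f \<in> L2" by (simp add: L2_def)
  have "(L2_norm f)\<^sup>2 \<le> e\<^sup>2" using le unfolding nn_integral_L2[OF f] by simp
  thus "L2_norm f \<le> e" using e by (rule power2_le_imp_le)
qed

section \<open>Completeness\<close>

lemma fast_Cauchy_L2_AE_convergent:
  assumes f: "\<And>n. f n \<in> L2" and fast: "\<And>n. L2_norm (\<lambda>x. f (Suc n) x - f n x) \<le> (1/2) ^ n"
  shows "AE x in lebesgue. convergent (\<lambda>n. f n x)"
proof -
  note [measurable] = L2D(1)[OF f]
  \<comment> \<open>Sums of the absolute increments. Their norms stay below the geometric series, so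
    by monotone convergence the supremum is finite almost everywhere, and there the telescoping
    series converges absolutely.\<close>
  define S where "S n x = (\<Sum>j<n. cmod (f (Suc j) x - f j x))" for n x
  have [measurable]: "S n \<in> borel_measurable lebesgue" for n unfolding S_def[abs_def] by measurable
  have S0: "S n x \<ge> 0" for n x by (simp add: S_def sum_nonneg)
  have Smono: "S m x \<le> S n x" if "m \<le> n" for m n x
    unfolding S_def using that by (intro sum_mono2) auto
  have SL: "(\<lambda>x. complex_of_real (S n x)) \<in> L2 \<and> L2_norm (\<lambda>x. complex_of_real (S n x)) \<le> (\<Sum>j<n. (1/2) ^ j)" for n
  proof (induction n)
    case 0 show ?case by (simp add: S_def L2_def L2_norm_def)
  next
    case (Suc n)
    define d where "d x = complex_of_real (cmod (f (Suc n) x - f n x))" for x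
    have [measurable]: "d \<in> borel_measurable lebesgue" unfolding d_def[abs_def] by measurable
    have d: "d \<in> L2" "L2_norm d \<le> (1/2) ^ n"
      using L2_diff[OF f[of "Suc n"] f[of n]] fast[of n] by (auto simp: d_def L2_def L2_norm_def)
    have "(\<lambda>x. complex_of_real (S (Suc n) x)) = (\<lambda>x. complex_of_real (S n x) + d x)"
      by (simp add: S_def d_def)
    thus ?case using Suc L2_add[of "\<lambda>x. complex_of_real (S n x)" d] L2_norm_add[of "\<lambda>x. complex_of_real (S n x)" d] d
      by simp
  qed
  have geo: "(\<Sum>j<n. (1/2) ^ j) \<le> (2::real)" for n
    using sum_gp_strict[of "1/2::real" n] by simp
  have nS: "(\<integral>\<^sup>+x. ennreal ((S n x)\<^sup>2) \<partial>lebesgue) \<le> ennreal 4" for n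
  proof -
    have "(\<integral>\<^sup>+x. ennreal ((S n x)\<^sup>2) \<partial>lebesgue) = ennreal ((L2_norm (\<lambda>x. complex_of_real (S n x)))\<^sup>2)"
      using nn_integral_L2[of "\<lambda>x. complex_of_real (S n x)"] SL by simp
    also have "\<dots> \<le> ennreal (2\<^sup>2)"
      using SL[of n] geo[of n] by (intro ennreal_leI power_mono) auto
    finally show ?thesis by simp
  qed
  have "(\<integral>\<^sup>+x. (SUP n. ennreal ((S n x)\<^sup>2)) \<partial>lebesgue) = (SUP n. \<integral>\<^sup>+x. ennreal ((S n x)\<^sup>2) \<partial>lebesgue)"
    using Smono S0 by (intro nn_integral_monotone_convergence_SUP) (auto simp: incseq_def le_fun_def intro!: ennreal_leI power_mono)
  also have "\<dots> \<le> ennreal 4" using nS by (intro SUP_least) auto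
  finally have "(\<integral>\<^sup>+x. (SUP n. ennreal ((S n x)\<^sup>2)) \<partial>lebesgue) \<noteq> \<infinity>"
    by (auto simp: top_unique)
  hence "AE x in lebesgue. (SUP n. ennreal ((S n x)\<^sup>2)) \<noteq> \<infinity>"
    by (intro nn_integral_PInf_AE) auto
  thus ?thesis
  proof eventually_elim
    case (elim x)
    then obtain c where c: "c \<ge> 0" "(SUP n. ennreal ((S n x)\<^sup>2)) = ennreal c" by (cases "SUP n. ennreal ((S n x)\<^sup>2)") auto
    have "(S n x)\<^sup>2 \<le> c" for n
      using SUP_upper[of n UNIV "\<lambda>n. ennreal ((S n x)\<^sup>2)"] c by simp
    hence "S n x \<le> sqrt c" for n by (rule real_le_rsqrt)
    hence "summable (\<lambda>j. norm (f (Suc j) x - f j x))"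
      by (intro summableI_nonneg_bounded[where x="sqrt c"]) (auto simp: S_def)
    hence "summable (\<lambda>j. f (Suc j) x - f j x)" by (rule summable_norm_cancel)
    hence "convergent (\<lambda>n. \<Sum>j<n. f (Suc j) x - f j x)" by (simp add: summable_iff_convergent)
    hence "convergent (\<lambda>n. f n x - f 0 x)" by (simp add: sum_lessThan_telescope[of "\<lambda>j. f j x"])
    from convergent_add[OF this convergent_const[of "f 0 x"]] show ?case by simp
  qed
qed

text \<open>A subsequence with geometric increments converges almost everywhere. Fatou's lemma,
  applied to the distance of a fixed \<open>f n\<close> from that subsequence, shows that the whole
  sequence converges to the same limit in norm.\<close>

lemma Riesz_Fischer:
  assumes f: "\<And>n. f n \<in> L2"
    and Cauchy: "\<And>e. e > 0 \<Longrightarrow> \<exists>N. \<forall>m\<ge>N. \<forall>n\<ge>N. L2_norm (\<lambda>x. f m x - f n x) < e"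
  obtains h where "h \<in> L2" "(\<lambda>n. L2_norm (\<lambda>x. f n x - h x)) \<longlonglongrightarrow> 0"
proof -
  have "\<forall>j. \<exists>N. \<forall>m\<ge>N. \<forall>n\<ge>N. L2_norm (\<lambda>x. f m x - f n x) < (1/2) ^ j"
    using Cauchy by simp
  from choice[OF this] obtain K
    where K: "\<And>j m n. m \<ge> K j \<Longrightarrow> n \<ge> K j \<Longrightarrow> L2_norm (\<lambda>x. f m x - f n x) < (1/2) ^ j"
    by blast
  \<comment> \<open>Summing the thresholds gives \<open>k j \<ge> K j\<close> and
    \<open>k (Suc j) \<ge> K j\<close> at once, so consecutive terms differ by at most
    \<open>(1/2) ^ j\<close>; adding \<open>j\<close> makes the indices tend to infinity.\<close>
  define k where "k j = (\<Sum>i\<le>j. K i) + j" for j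
  have kK: "k j \<ge> K j" for j unfolding k_def using member_le_sum[of j "{..j}" K] by simp
  have kj: "k j \<ge> j" for j by (simp add: k_def)
  have kS: "k (Suc j) \<ge> K j" for j
    unfolding k_def using member_le_sum[of j "{..Suc j}" K] by simp
  note [measurable] = L2D(1)[OF f]
  define g where "g j = f (k j)" for j
  have conv: "AE x in lebesgue. convergent (\<lambda>j. g j x)"
    by (rule fast_Cauchy_L2_AE_convergent) (auto simp: g_def f intro!: less_imp_le K kK kS)
  define h where "h x = lim (\<lambda>j. g j x)" for x
  have [measurable]: "g j \<in> borel_measurable lebesgue" for j unfolding g_def by measurable
  have [measurable]: "h \<in> borel_measurable lebesgue" unfolding h_def[abs_def] by measurable
  have lim: "AE x in lebesgue. (\<lambda>j. g j x) \<longlonglongrightarrow> h x"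
    using conv by eventually_elim (simp add: h_def convergent_LIMSEQ_iff)
  have close: "(\<lambda>x. f n x - h x) \<in> L2 \<and> L2_norm (\<lambda>x. f n x - h x) \<le> e"
    if e: "e > 0" and N: "\<forall>m\<ge>N. \<forall>n\<ge>N. L2_norm (\<lambda>x. f m x - f n x) < e" and n: "n \<ge> N" for e N n
  proof -
    have "(\<integral>\<^sup>+x. ennreal ((cmod (f n x - h x))\<^sup>2) \<partial>lebesgue) = (\<integral>\<^sup>+x. liminf (\<lambda>j. ennreal ((cmod (f n x - g j x))\<^sup>2)) \<partial>lebesgue)"
    proof (rule nn_integral_cong_AE)
      show "AE x in lebesgue. ennreal ((cmod (f n x - h x))\<^sup>2) = liminf (\<lambda>j. ennreal ((cmod (f n x - g j x))\<^sup>2))"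
        using lim
      proof eventually_elim
        case (elim x)
        have "(\<lambda>j. ennreal ((cmod (f n x - g j x))\<^sup>2)) \<longlonglongrightarrow> ennreal ((cmod (f n x - h x))\<^sup>2)"
          by (intro tendsto_ennrealI tendsto_intros elim)
        thus ?case by (metis lim_imp_Liminf trivial_limit_sequentially)
      qed
    qed
    also have "\<dots> \<le> liminf (\<lambda>j. \<integral>\<^sup>+x. ennreal ((cmod (f n x - g j x))\<^sup>2) \<partial>lebesgue)"
      by (rule nn_integral_liminf) measurable
    also have "\<dots> \<le> liminf (\<lambda>j::nat. ennreal (e\<^sup>2))"
    proof (rule Liminf_mono, unfold eventually_sequentially, intro exI allI impI)
      fix j assume j: "N \<le> j"
      have "(\<integral>\<^sup>+x. ennreal ((cmod (f n x - g j x))\<^sup>2) \<partial>lebesgue) = ennreal ((L2_norm (\<lambda>x. f n x - g j x))\<^sup>2)"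
        by (rule nn_integral_L2) (simp add: g_def L2_diff f)
      also have "\<dots> \<le> ennreal (e\<^sup>2)"
        using N n j kj[of j] by (intro ennreal_leI power_mono) (auto simp: g_def intro!: less_imp_le)
      finally show "(\<integral>\<^sup>+x. ennreal ((cmod (f n x - g j x))\<^sup>2) \<partial>lebesgue) \<le> ennreal (e\<^sup>2)" .
    qed
    also have "\<dots> = ennreal (e\<^sup>2)" by (simp add: Liminf_const)
    finally have "(\<integral>\<^sup>+x. ennreal ((cmod (f n x - h x))\<^sup>2) \<partial>lebesgue) \<le> ennreal (e\<^sup>2)" .
    from L2_nn_integralI[OF _ this] e show ?thesis by auto
  qed
  show thesis
  proof (rule that)
    obtain N where "\<forall>m\<ge>N. \<forall>n\<ge>N. L2_norm (\<lambda>x. f m x - f n x) < 1" using Cauchy[of 1] by auto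
    from close[OF _ this, of N] have "(\<lambda>x. f N x - h x) \<in> L2" by simp
    from L2_diff[OF f[of N] this] show "h \<in> L2" by simp
    show "(\<lambda>n. L2_norm (\<lambda>x. f n x - h x)) \<longlonglongrightarrow> 0"
    proof (rule LIMSEQ_I)
      fix r :: real assume r: "r > 0"
      then obtain N where N: "\<forall>m\<ge>N. \<forall>n\<ge>N. L2_norm (\<lambda>x. f m x - f n x) < r / 2" using Cauchy[of "r/2"] by auto
      show "\<exists>no. \<forall>n\<ge>no. norm (L2_norm (\<lambda>x. f n x - h x) - 0) < r"
      proof (intro exI allI impI)
        fix n assume "n \<ge> N"
        from close[OF _ N this] r have "L2_norm (\<lambda>x. f n x - h x) \<le> r / 2" by simp
        thus "norm (L2_norm (\<lambda>x. f n x - h x) - 0) < r" using r by simp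
      qed
    qed
  qed
qed

lemma L2_dominated_convergence:
  assumes g: "g \<in> L2" and s [measurable]: "\<And>i::nat. s i \<in> borel_measurable lebesgue"
    and lim: "AE x in lebesgue. (\<lambda>i. s i x) \<longlonglongrightarrow> g x"
    and dom: "\<And>i. AE x in lebesgue. (cmod (g x - s i x))\<^sup>2 \<le> w x" and w: "integrable lebesgue w"
  shows "s i \<in> L2" "(\<lambda>i. L2_norm (\<lambda>x. g x - s i x)) \<longlonglongrightarrow> 0"
proof -
  note [measurable] = L2D(1)[OF g] borel_measurable_integrable[OF w]
  have lim': "AE x in lebesgue. (\<lambda>i. (cmod (g x - s i x))\<^sup>2) \<longlonglongrightarrow> 0"
    using lim
  proof eventually_elim
    case (elim x)
    have "(\<lambda>i. (cmod (g x - s i x))\<^sup>2) \<longlonglongrightarrow> (cmod (g x - g x))\<^sup>2" by (intro tendsto_intros elim)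
    thus ?case by simp
  qed
  have dom': "AE x in lebesgue. norm ((cmod (g x - s i x))\<^sup>2) \<le> w x" for i using dom by simp
  have m: "(\<lambda>x. (cmod (g x - s i x))\<^sup>2) \<in> borel_measurable lebesgue" for i by measurable
  have "integrable lebesgue (\<lambda>x. (cmod (g x - s i x))\<^sup>2)"
    by (rule integrable_dominated_convergence2[OF _ m w lim' dom']) measurable
  hence "(\<lambda>x. g x - s i x) \<in> L2" by (simp add: L2_def)
  from L2_diff[OF g this] show "s i \<in> L2" by simp
  have "(\<lambda>i. \<integral>x. (cmod (g x - s i x))\<^sup>2 \<partial>lebesgue) \<longlonglongrightarrow> (\<integral>x. 0 \<partial>(lebesgue :: 'a measure))"
    by (rule integral_dominated_convergence[OF _ m w lim' dom']) measurable
  from tendsto_real_sqrt[OF this] show "(\<lambda>i. L2_norm (\<lambda>x. g x - s i x)) \<longlonglongrightarrow> 0"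
    by (simp add: L2_norm_def)
qed

section \<open>Density of continuous functions of bounded support\<close>

definition test_function :: "('a::euclidean_space \<Rightarrow> complex) \<Rightarrow> bool" where
  "test_function k \<longleftrightarrow> continuous_on UNIV k \<and> (\<exists>r. \<forall>x. norm x > r \<longrightarrow> k x = 0)"

lemma test_function_bounded:
  assumes "test_function k"
  obtains B where "\<And>x. cmod (k x) \<le> B"
proof -
  from assms obtain r where r: "\<And>x. norm x > r \<Longrightarrow> k x = 0" and c: "continuous_on UNIV k"
    by (auto simp: test_function_def)
  have "compact (k ` cball 0 r)" using c by (intro compact_continuous_image) (auto intro: continuous_on_subset)
  then obtain B where B: "\<And>y. y \<in> k ` cball 0 r \<Longrightarrow> norm y \<le> B" using compact_imp_bounded bounded_iff by metis
  have "cmod (k x) \<le> \<bar>B\<bar>" for x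
  proof (cases "norm x > r")
    case False
    hence "cmod (k x) \<le> B" by (intro B imageI) auto
    thus ?thesis by linarith
  qed (simp add: r)
  thus thesis by (rule that)
qed

lemma test_function_L2:
  fixes k :: "'a::euclidean_space \<Rightarrow> complex"
  assumes "test_function k"
  shows "k \<in> L2"
proof (rule L2_borelI)
  from assms obtain r where r: "\<And>x. norm x > r \<Longrightarrow> k x = 0" and c: "continuous_on UNIV k"
    by (auto simp: test_function_def)
  show "k \<in> borel_measurable borel" using c by (rule borel_measurable_continuous_onI)
  have "integrable lborel (\<lambda>x. indicator (cball 0 r) x *\<^sub>R (cmod (k x))\<^sup>2)"
    using c by (intro borel_integrable_compact continuous_intros) (auto intro: continuous_on_subset)
  moreover have "(\<lambda>x. indicator (cball 0 r) x *\<^sub>R (cmod (k x))\<^sup>2) = (\<lambda>x. (cmod (k x))\<^sup>2)"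
    using r by (auto simp: fun_eq_iff not_le split: split_indicator)
  ultimately show "integrable lborel (\<lambda>x. (cmod (k x))\<^sup>2)" by simp
qed

text \<open>The property climbs from indicators of compact sets to sets of finite measure, then to
  simple functions and to all of \<open>L2\<close>; each passage is a linear combination or a limit
  in norm.\<close>

definition approximable :: "('a::euclidean_space \<Rightarrow> complex) \<Rightarrow> bool" where
  "approximable g \<longleftrightarrow> g \<in> L2 \<and> (\<forall>e>0. \<exists>k. test_function k \<and> L2_norm (\<lambda>x. g x - k x) < e)"

lemma approximable_limit:
  assumes g: "g \<in> L2" and lim: "(\<lambda>i::nat. L2_norm (\<lambda>x. g x - s i x)) \<longlonglongrightarrow> 0" and s: "\<And>i. approximable (s i)"
  shows "approximable g"
  unfolding approximable_def
proof (intro conjI allI impI g)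
  fix e :: real assume e: "e > 0"
  from lim[THEN order_tendstoD(2), of "e/2"] e obtain i where i: "L2_norm (\<lambda>x. g x - s i x) < e / 2"
    by (auto simp: eventually_sequentially)
  from s[of i] e obtain k where k: "test_function k" "L2_norm (\<lambda>x. s i x - k x) < e / 2"
    unfolding approximable_def by (metis half_gt_zero)
  have "L2_norm (\<lambda>x. g x - k x) \<le> L2_norm (\<lambda>x. g x - s i x) + L2_norm (\<lambda>x. s i x - k x)"
    using s[of i] g test_function_L2[OF k(1)] by (intro L2_norm_triangle) (auto simp: approximable_def)
  thus "\<exists>k. test_function k \<and> L2_norm (\<lambda>x. g x - k x) < e" using k i by (intro exI[of _ k]) auto
qed

lemma approximable_add:
  assumes "approximable f" "approximable g"
  shows "approximable (\<lambda>x. f x + g x)"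
  unfolding approximable_def
proof (intro conjI allI impI)
  show "(\<lambda>x. f x + g x) \<in> L2" using assms by (intro L2_add) (auto simp: approximable_def)
  fix e :: real assume e: "e > 0"
  from assms e obtain k l where k: "test_function k" "L2_norm (\<lambda>x. f x - k x) < e / 2"
    and l: "test_function l" "L2_norm (\<lambda>x. g x - l x) < e / 2"
    unfolding approximable_def by (metis half_gt_zero)
  have "L2_norm (\<lambda>x. (f x - k x) + (g x - l x)) \<le> L2_norm (\<lambda>x. f x - k x) + L2_norm (\<lambda>x. g x - l x)"
    using assms by (intro L2_norm_add L2_diff[OF _ test_function_L2[OF k(1)]] L2_diff[OF _ test_function_L2[OF l(1)]])
      (auto simp: approximable_def)
  hence "L2_norm (\<lambda>x. (f x + g x) - (k x + l x)) < e" using k l by (simp add: algebra_simps)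
  moreover have "test_function (\<lambda>x. k x + l x)"
  proof -
    from k(1) l(1) obtain r r' where "\<And>x. norm x > r \<Longrightarrow> k x = 0" "\<And>x. norm x > r' \<Longrightarrow> l x = 0"
      by (auto simp: test_function_def)
    thus ?thesis using k(1) l(1) unfolding test_function_def
      by (intro conjI exI[of _ "max r r'"] continuous_on_add) auto
  qed
  ultimately show "\<exists>k. test_function k \<and> L2_norm (\<lambda>x. f x + g x - k x) < e" by blast
qed

lemma approximable_zero: "approximable (\<lambda>x. 0)"
  unfolding approximable_def
  by (auto simp: L2_def L2_norm_def test_function_def intro!: exI[of _ "\<lambda>x. 0"])

lemma approximable_scale:
  assumes "approximable f"
  shows "approximable (\<lambda>x. c * f x)"
proof (cases "c = 0")
  case True thus ?thesis by (simp add: approximable_zero)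
next
  case False
  show ?thesis unfolding approximable_def
  proof (intro conjI allI impI)
    show "(\<lambda>x. c * f x) \<in> L2" using assms by (intro L2_scale) (auto simp: approximable_def)
    fix e :: real assume e: "e > 0"
    hence "e / cmod c > 0" using False by simp
    with assms obtain k where k: "test_function k" "L2_norm (\<lambda>x. f x - k x) < e / cmod c"
      unfolding approximable_def by metis
    have "L2_norm (\<lambda>x. c * (f x - k x)) < e" unfolding L2_norm_scale using k False by (simp add: field_simps)
    hence "L2_norm (\<lambda>x. c * f x - c * k x) < e" by (simp add: algebra_simps)
    moreover have "test_function (\<lambda>x. c * k x)"
      using k(1) unfolding test_function_def by (auto intro!: continuous_on_mult_left)
    ultimately show "\<exists>k. test_function k \<and> L2_norm (\<lambda>x. c * f x - k x) < e" by blast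
  qed
qed

lemma indicator_L2: "S \<in> lmeasurable \<Longrightarrow> (\<lambda>x. complex_of_real (indicator S x)) \<in> L2"
proof -
  assume S: "S \<in> lmeasurable"
  have "(\<lambda>x. (cmod (complex_of_real (indicator S x)))\<^sup>2) = indicat_real S"
    by (auto simp: fun_eq_iff split: split_indicator)
  thus ?thesis using S by (auto simp: L2_def lmeasurable_iff_integrable fmeasurable_def)
qed

text \<open>The functions \<open>max 0 (1 - real (Suc n) * infdist x K)\<close> decrease to the
  indicator. Since \<open>Suc n \<ge> 1\<close>, all of them vanish at distance 1 from
  \<open>K\<close>, hence outside one ball.\<close>

lemma approximable_indicator_compact:
  fixes K :: "'a::euclidean_space set"
  assumes K: "compact K"
  shows "approximable (\<lambda>x. complex_of_real (indicator K x))"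
proof (cases "K = {}")
  case True thus ?thesis by (simp add: approximable_zero)
next
  case False
  obtain r where r: "\<And>x. x \<in> K \<Longrightarrow> norm x \<le> r" using compact_imp_bounded[OF K] by (auto simp: bounded_iff)
  define k where "k n x = complex_of_real (max 0 (1 - real (Suc n) * infdist x K))" for n x
  have supp: "k n x = 0" if "norm x > r + 1" for n x
  proof -
    obtain y where y: "y \<in> K" "infdist x K = dist x y"
      using infdist_attains_inf[OF compact_imp_closed[OF K] False] by metis
    have "dist x y \<ge> norm x - norm y" by (simp add: dist_norm norm_triangle_ineq2)
    hence "dist x y \<ge> 1" using r[OF y(1)] that by linarith
    hence "1 * 1 \<le> real (Suc n) * infdist x K" unfolding y(2) by (intro mult_mono) auto
    thus ?thesis by (simp add: k_def)
  qed
  have test: "test_function (k n)" for n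
    unfolding test_function_def using supp[of _ n]
    by (intro conjI exI[of _ "r + 1"]) (auto simp: k_def[abs_def] intro!: continuous_intros)
  have k01: "cmod (k n x) \<le> 1" for n x using infdist_nonneg[of x K] by (simp add: k_def)
  have I: "(\<lambda>x. complex_of_real (indicator K x)) \<in> L2" by (intro indicator_L2 lmeasurable_compact K)
  have lim: "(\<lambda>n. k n x) \<longlonglongrightarrow> complex_of_real (indicator K x)" for x
  proof (cases "x \<in> K")
    case True thus ?thesis by (simp add: k_def)
  next
    case xK: False
    hence d: "infdist x K > 0" using infdist_pos_not_in_closed[OF compact_imp_closed[OF K] False] by simp
    obtain N where N: "real N * infdist x K > 1" using reals_Archimedean3[OF d] by blast
    have "k n x = 0" if "n \<ge> N" for n
    proof -
      have "real N * infdist x K \<le> real (Suc n) * infdist x K" using d that by (intro mult_right_mono) auto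
      hence "1 \<le> real (Suc n) * infdist x K" using N by linarith
      thus ?thesis by (simp add: k_def)
    qed
    hence "eventually (\<lambda>n. k n x = complex_of_real (indicator K x)) sequentially"
      using xK unfolding eventually_sequentially by auto
    thus ?thesis by (rule tendsto_eventually)
  qed
  have "(\<lambda>n. L2_norm (\<lambda>x. complex_of_real (indicator K x) - k n x)) \<longlonglongrightarrow> 0"
  proof (rule L2_dominated_convergence(2)[OF I, where w="\<lambda>x. indicator (cball 0 (r + 1)) x *\<^sub>R 4"])
    show "k n \<in> borel_measurable lebesgue" for n by (rule L2D(1)[OF test_function_L2[OF test]])
    show "AE x in lebesgue. (\<lambda>n. k n x) \<longlonglongrightarrow> complex_of_real (indicator K x)" using lim by simp
    show "AE x in lebesgue. (cmod (complex_of_real (indicator K x) - k n x))\<^sup>2 \<le> indicator (cball 0 (r + 1)) x *\<^sub>R 4" for n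
    proof (rule AE_I2)
      fix x :: 'a
      show "(cmod (complex_of_real (indicator K x) - k n x))\<^sup>2 \<le> indicator (cball 0 (r + 1)) x *\<^sub>R 4"
      proof (cases "norm x > r + 1")
        case True
        hence "x \<notin> K" using r[of x] by auto
        thus ?thesis using supp[OF True, of n] True by simp
      next
        case False
        have "cmod (complex_of_real (indicator K x)) \<le> 1" by (auto split: split_indicator)
        hence "cmod (complex_of_real (indicator K x) - k n x) \<le> 2"
          using norm_triangle_ineq4[of "complex_of_real (indicator K x)" "k n x"] k01[of n x] by linarith
        hence "(cmod (complex_of_real (indicator K x) - k n x))\<^sup>2 \<le> 2\<^sup>2" by (intro power_mono) auto
        thus ?thesis using False by simp
      qed
    qed
    show "integrable lebesgue (\<lambda>x::'a. indicator (cball 0 (r + 1)) x *\<^sub>R (4::real))"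
      by (intro integrable_scaleR_left) (use lmeasurable_cball lmeasurable_iff_integrable in blast)
  qed
  moreover have "approximable (k n)" for n
    unfolding approximable_def using test[of n] by (auto simp: test_function_L2 L2_norm_def intro!: exI[of _ "k n"])
  ultimately show ?thesis by (rule approximable_limit[OF I])
qed

text \<open>Inner regularity supplies closed subsets with small defect, which are compact if the set
  is bounded. The general set is exhausted by its intersections with balls.\<close>

lemma approximable_indicator:
  fixes S :: "'a::euclidean_space set"
  assumes S: "S \<in> lmeasurable"
  shows "approximable (\<lambda>x. complex_of_real (indicator S x))"
proof -
  have bounded_case: "approximable (\<lambda>x. complex_of_real (indicator B x))" if B: "B \<in> lmeasurable" "bounded B" for B :: "'a set"
  proof -
    have "\<exists>T. closed T \<and> T \<subseteq> B \<and> emeasure lebesgue (B - T) < ennreal (1 / real (Suc n))" for n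
      using sets_lebesgue_inner_closed[of B "1 / real (Suc n)"] B(1) by (metis fmeasurableD of_nat_0_less_iff zero_less_Suc zero_less_divide_1_iff)
    then obtain T where T: "\<And>n. closed (T n)" "\<And>n. T n \<subseteq> B" "\<And>n. emeasure lebesgue (B - T n) < ennreal (1 / real (Suc n))"
      by metis
    have comp: "compact (T n)" for n
      using T(1,2) B(2) bounded_subset compact_eq_bounded_closed by blast
    have norm: "(L2_norm (\<lambda>x. complex_of_real (indicator B x) - complex_of_real (indicator (T n) x)))\<^sup>2 \<le> 1 / real (Suc n)" for n
    proof -
      have BT: "B - T n \<in> sets lebesgue" using B(1) comp[of n] by (auto intro: fmeasurableD lmeasurable_compact)
      have "(cmod (complex_of_real (indicator B x) - complex_of_real (indicator (T n) x)))\<^sup>2 = indicat_real (B - T n) x" for x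
        using T(2)[of n] by (auto split: split_indicator)
      hence "(L2_norm (\<lambda>x. complex_of_real (indicator B x) - complex_of_real (indicator (T n) x)))\<^sup>2 = measure lebesgue (B - T n)"
        unfolding L2_norm_power2 using BT by simp
      also have "\<dots> \<le> 1 / real (Suc n)"
        using T(3)[of n] unfolding measure_def by (intro enn2real_leI less_imp_le) auto
      finally show ?thesis .
    qed
    have sq: "(\<lambda>n. sqrt (1 / real (Suc n))) \<longlonglongrightarrow> 0"
      using tendsto_real_sqrt[OF LIMSEQ_Suc[OF lim_1_over_n]] by simp
    have "(\<lambda>n. L2_norm (\<lambda>x. complex_of_real (indicator B x) - complex_of_real (indicator (T n) x))) \<longlonglongrightarrow> 0"
    proof (rule tendsto_sandwich[OF _ _ tendsto_const sq])
      show "\<forall>\<^sub>F n in sequentially. L2_norm (\<lambda>x. complex_of_real (indicator B x) - complex_of_real (indicator (T n) x)) \<le> sqrt (1 / real (Suc n))"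
        by (intro always_eventually allI real_le_rsqrt norm)
    qed simp
    thus ?thesis by (rule approximable_limit[OF indicator_L2[OF B(1)] _ approximable_indicator_compact[OF comp]])
  qed
  have lm: "S \<inter> cball 0 (real n) \<in> lmeasurable" for n :: nat
    using S by (intro fmeasurable_Int_fmeasurable fmeasurableD lmeasurable_cball)
  have "(\<lambda>n. L2_norm (\<lambda>x. complex_of_real (indicator S x) - complex_of_real (indicator (S \<inter> cball 0 (real n)) x))) \<longlonglongrightarrow> 0"
  proof (rule L2_dominated_convergence(2)[OF indicator_L2[OF S], where w="indicat_real S"])
    show "(\<lambda>x. complex_of_real (indicator (S \<inter> cball 0 (real n)) x)) \<in> borel_measurable lebesgue" for n
      by (rule L2D(1)[OF indicator_L2[OF lm]])
    show "integrable lebesgue (indicat_real S)" using S by (simp add: lmeasurable_iff_integrable)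
    show "AE x in lebesgue. (cmod (complex_of_real (indicator S x) - complex_of_real (indicator (S \<inter> cball 0 (real n)) x)))\<^sup>2 \<le> indicat_real S x" for n
      by (intro AE_I2) (auto split: split_indicator)
    show "AE x in lebesgue. (\<lambda>n. complex_of_real (indicator (S \<inter> cball 0 (real n)) x)) \<longlonglongrightarrow> complex_of_real (indicator S x)"
    proof (rule AE_I2)
      fix x :: 'a
      obtain N where "norm x \<le> real N" using real_arch_simple by blast
      hence "complex_of_real (indicator (S \<inter> cball 0 (real n)) x) = complex_of_real (indicator S x)" if "n \<ge> N" for n
        using that by (auto split: split_indicator)
      thus "(\<lambda>n. complex_of_real (indicator (S \<inter> cball 0 (real n)) x)) \<longlonglongrightarrow> complex_of_real (indicator S x)"
        by (intro tendsto_eventually) (auto simp: eventually_sequentially)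
    qed
  qed
  moreover have "bounded (S \<inter> cball 0 (real n))" for n :: nat by (rule bounded_subset[OF bounded_cball]) auto
  ultimately show ?thesis
    by (rule approximable_limit[OF indicator_L2[OF S] _ bounded_case[OF lm]])
qed

text \<open>The approximating simple functions satisfy \<open>|s i| \<le> 2 |g|\<close>, so the
  squared error is dominated by \<open>9 |g|^2\<close>. Level sets of nonzero values have finite
  measure by the Chebyshev inequality.\<close>

lemma L2_approximable:
  assumes g: "g \<in> L2"
  shows "approximable g"
proof -
  obtain s where s: "\<And>i. simple_function lebesgue (s i)" "\<And>x. (\<lambda>i. s i x) \<longlonglongrightarrow> g x" "\<And>i x. cmod (s i x) \<le> 2 * cmod (g x)"
    using borel_measurable_implies_sequence_metric[OF L2D(1)[OF g], of 0] by (auto simp: dist_norm)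
  have sm [measurable]: "s i \<in> borel_measurable lebesgue" for i using s(1) by (rule borel_measurable_simple_function)
  have w: "integrable lebesgue (\<lambda>x. 9 * (cmod (g x))\<^sup>2)" using L2D(2)[OF g] by simp
  have dom: "AE x in lebesgue. (cmod (g x - s i x))\<^sup>2 \<le> 9 * (cmod (g x))\<^sup>2" for i
  proof (rule AE_I2)
    fix x
    have "cmod (g x - s i x) \<le> 3 * cmod (g x)" using norm_triangle_ineq4[of "g x" "s i x"] s(3)[of i x] by linarith
    hence "(cmod (g x - s i x))\<^sup>2 \<le> (3 * cmod (g x))\<^sup>2" by (intro power_mono) auto
    thus "(cmod (g x - s i x))\<^sup>2 \<le> 9 * (cmod (g x))\<^sup>2" by (simp add: power_mult_distrib)
  qed
  have lim: "AE x in lebesgue. (\<lambda>i. s i x) \<longlonglongrightarrow> g x" using s(2) by simp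
  note L = L2_dominated_convergence[OF g sm lim dom w]
  have "approximable (s i)" for i
  proof -
    have fin: "finite (range (s i))" using s(1)[of i] by (simp add: simple_function_def)
    \<comment> \<open>The value 0 is left out, since its level set may have infinite
      measure.\<close>
    define V where "V = range (s i) - {0}"
    have finV: "finite V" using fin by (simp add: V_def)
    have lm: "s i -` {y} \<in> lmeasurable" if "y \<in> V" for y
    proof -
      have y: "cmod y > 0" using that by (simp add: V_def)
      have m: "s i -` {y} \<in> sets lebesgue" using measurable_sets[OF sm[of i], of "{y}"] by simp
      have "integrable lebesgue (indicat_real (s i -` {y}))"
      proof (rule Bochner_Integration.integrable_bound)
        show "integrable lebesgue (\<lambda>x. (cmod (s i x))\<^sup>2 / (cmod y)\<^sup>2)" using L2D(2)[OF L(1)[of i]] by auto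
        show "indicat_real (s i -` {y}) \<in> borel_measurable lebesgue" using m by simp
        show "AE x in lebesgue. norm (indicat_real (s i -` {y}) x) \<le> norm ((cmod (s i x))\<^sup>2 / (cmod y)\<^sup>2)"
          using y by (intro AE_I2) (auto split: split_indicator)
      qed
      thus ?thesis by (simp add: lmeasurable_iff_integrable)
    qed
    have "approximable (\<lambda>x. \<Sum>y\<in>W. y * complex_of_real (indicator (s i -` {y}) x))" if "W \<subseteq> V" for W
      using finite_subset[OF that finV] that
    proof (induction W rule: finite_induct)
      case empty show ?case by (simp add: approximable_zero)
    next
      case (insert y W)
      thus ?case by (auto intro!: approximable_add approximable_scale approximable_indicator lm)
    qed
    moreover have "(\<lambda>x. \<Sum>y\<in>V. y * complex_of_real (indicator (s i -` {y}) x)) = s i"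
    proof
      fix x
      have "(\<Sum>y\<in>V. y * complex_of_real (indicator (s i -` {y}) x)) = (\<Sum>y\<in>V. if y = s i x then y else 0)"
        by (intro sum.cong) (auto split: split_indicator)
      also have "\<dots> = s i x" using finV by (auto simp: V_def)
      finally show "(\<Sum>y\<in>V. y * complex_of_real (indicator (s i -` {y}) x)) = s i x" .
    qed
    ultimately show ?thesis by (metis subset_refl)
  qed
  thus ?thesis by (rule approximable_limit[OF g L(2)])
qed

section \<open>Density of biradial Gaussians\<close>

lemma L2_borel_version:
  assumes "g \<in> L2"
  obtains g' where "g' \<in> borel_measurable borel" "AE x in lborel. g x = g' x"
proof -
  have "(\<lambda>x. Re (g x)) \<in> borel_measurable lebesgue" "(\<lambda>x. Im (g x)) \<in> borel_measurable lebesgue"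
    using L2D(1)[OF assms] by measurable
  from this[THEN completion_ex_borel_measurable_real]
  obtain u v where uv: "u \<in> borel_measurable lborel" "AE x in lborel. Re (g x) = u x"
    "v \<in> borel_measurable lborel" "AE x in lborel. Im (g x) = v x" by blast
  show thesis
  proof (rule that)
    show "(\<lambda>x. complex_of_real (u x) + \<i> * complex_of_real (v x)) \<in> borel_measurable borel"
      using uv by simp
    show "AE x in lborel. g x = complex_of_real (u x) + \<i> * complex_of_real (v x)"
      using uv(2,4) by eventually_elim (simp add: complex_eq_iff)
  qed
qed

lemma norm_angle_integral_le:
  fixes f :: "real \<Rightarrow> complex"
  assumes [measurable]: "f \<in> borel_measurable borel" and B: "\<And>\<theta>. cmod (f \<theta>) \<le> B"
  shows "cmod (\<integral>\<theta>. f \<theta> \<partial>angle) \<le> B * (2 * pi)"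
proof -
  have "integrable angle (\<lambda>\<theta>. cmod (f \<theta>))"
    by (rule angle.integrable_const_bound[where B=B]) (auto simp: B)
  hence "(\<integral>\<theta>. cmod (f \<theta>) \<partial>angle) \<le> (\<integral>\<theta>. B \<partial>angle)" using B by (intro integral_mono) auto
  hence "(\<integral>\<theta>. cmod (f \<theta>) \<partial>angle) \<le> B * (2 * pi)" by (simp add: mult.commute)
  thus ?thesis by (rule order_trans[OF Bochner_Integration.integral_norm_bound])
qed

definition angle_average :: "(real \<Rightarrow> 'a \<Rightarrow> 'a) \<Rightarrow> ('a \<Rightarrow> complex) \<Rightarrow> 'a \<Rightarrow> complex" where
  "angle_average T k z = (\<integral>\<theta>. k (T \<theta> z) \<partial>angle) / of_real (2 * pi)"

text \<open>If \<open>g\<close> is invariant, \<open>g\<close> minus the average of \<open>k\<close>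
  is the average of \<open>g - k\<close> along the orbit. Cauchy-Schwarz on the circle and
  invariance of the measure then show that averaging does not increase the distance to
  \<open>g\<close>. Invariance of \<open>g\<close> is asked only almost everywhere for each angle,
  which suffices after Fubini.\<close>

lemma
  fixes T :: "real \<Rightarrow> 'a::euclidean_space \<Rightarrow> 'a"
  assumes T: "(\<lambda>p. T (fst p) (snd p)) \<in> borel_measurable (borel \<Otimes>\<^sub>M borel)"
    and k [measurable]: "k \<in> borel_measurable borel" and B: "\<And>z. cmod (k z) \<le> B"
  shows angle_average_measurable: "angle_average T k \<in> borel_measurable borel"
    and angle_average_bounded: "cmod (angle_average T k z) \<le> B"
    and angle_average_le: "(\<And>\<theta>. distr lborel borel (T \<theta>) = lborel) \<Longrightarrow> g \<in> borel_measurable borel \<Longrightarrow>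
       (\<And>\<theta>. AE z in lborel. g (T \<theta> z) = g z) \<Longrightarrow>
       (\<integral>\<^sup>+z. ennreal ((cmod (g z - angle_average T k z))\<^sup>2) \<partial>lborel) \<le> (\<integral>\<^sup>+z. ennreal ((cmod (g z - k z))\<^sup>2) \<partial>lborel)"
proof -
  have [measurable]: "(\<lambda>x. T (f x) (h x)) \<in> borel_measurable N"
    if [measurable]: "f \<in> borel_measurable N" "h \<in> borel_measurable N" for f h and N :: "'c measure"
    using measurable_compose[of "\<lambda>x. (f x, h x)" N "borel \<Otimes>\<^sub>M borel" "\<lambda>p. T (fst p) (snd p)" borel] T by simp
  show av [measurable]: "angle_average T k \<in> borel_measurable borel"
    unfolding angle_average_def[abs_def] by measurable
  have kint: "integrable angle (\<lambda>\<theta>. k (T \<theta> z))" for z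
    by (rule angle.integrable_const_bound[where B=B]) (auto simp: B)
  show "cmod (angle_average T k z) \<le> B"
  proof -
    have "cmod (\<integral>\<theta>. k (T \<theta> z) \<partial>angle) \<le> B * (2 * pi)"
      by (rule norm_angle_integral_le) (simp_all add: B)
    thus ?thesis by (simp add: angle_average_def norm_divide field_simps)
  qed
  assume inv: "\<And>\<theta>. distr lborel borel (T \<theta>) = lborel" and [measurable]: "g \<in> borel_measurable borel"
    and g: "\<And>\<theta>. AE z in lborel. g (T \<theta> z) = g z"
  have point: "ennreal ((cmod (g z - angle_average T k z))\<^sup>2) \<le> ennreal (1 / (2 * pi)) * (\<integral>\<^sup>+\<theta>. ennreal ((cmod (g z - k (T \<theta> z)))\<^sup>2) \<partial>angle)" for z
  proof -
    define f where "f \<theta> = g z - k (T \<theta> z)" for \<theta>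
    have [measurable]: "f \<in> borel_measurable angle" unfolding f_def[abs_def] by measurable
    have "cmod (f \<theta>) \<le> cmod (g z) + B" for \<theta>
      using norm_triangle_ineq4[of "g z" "k (T \<theta> z)"] B[of "T \<theta> z"] by (simp add: f_def)
    hence f2: "integrable angle (\<lambda>\<theta>. (cmod (f \<theta>))\<^sup>2)"
      by (intro angle.integrable_const_bound[where B="(cmod (g z) + B)\<^sup>2"]) (auto intro!: power_mono)
    \<comment> \<open>Nonnegativity of the double integral in the variance identity is
      Cauchy-Schwarz on the circle.\<close>
    have "0 \<le> (\<integral>x. (\<integral>y. (cmod (f x - f y))\<^sup>2 \<partial>angle) \<partial>angle)"
      by (intro Bochner_Integration.integral_nonneg) auto
    hence CS: "(cmod (\<integral>\<theta>. f \<theta> \<partial>angle))\<^sup>2 \<le> 2 * pi * (\<integral>\<theta>. (cmod (f \<theta>))\<^sup>2 \<partial>angle)"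
      using variance_identity[OF angle.finite_measure_axioms _ f2] by simp
    have "(\<integral>\<theta>. f \<theta> \<partial>angle) = of_real (2 * pi) * (g z - angle_average T k z)"
      using kint[of z] by (simp add: f_def angle_average_def scaleR_conv_of_real right_diff_distrib)
    hence "(2 * pi)\<^sup>2 * (cmod (g z - angle_average T k z))\<^sup>2 \<le> 2 * pi * (\<integral>\<theta>. (cmod (f \<theta>))\<^sup>2 \<partial>angle)"
      using CS by (simp only: norm_mult power_mult_distrib norm_of_real) simp
    hence "(cmod (g z - angle_average T k z))\<^sup>2 \<le> 1 / (2 * pi) * (\<integral>\<theta>. (cmod (f \<theta>))\<^sup>2 \<partial>angle)"
      by (simp add: power2_eq_square field_simps)
    hence "ennreal ((cmod (g z - angle_average T k z))\<^sup>2) \<le> ennreal (1 / (2 * pi)) * ennreal (\<integral>\<theta>. (cmod (f \<theta>))\<^sup>2 \<partial>angle)"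
      by (subst ennreal_mult[symmetric]) (auto intro: ennreal_leI)
    thus ?thesis using nn_integral_eq_integral[OF f2] by (simp add: f_def)
  qed
  have "(\<integral>\<^sup>+z. ennreal ((cmod (g z - angle_average T k z))\<^sup>2) \<partial>lborel)
     \<le> (\<integral>\<^sup>+z. ennreal (1 / (2 * pi)) * (\<integral>\<^sup>+\<theta>. ennreal ((cmod (g z - k (T \<theta> z)))\<^sup>2) \<partial>angle) \<partial>lborel)"
    by (intro nn_integral_mono point)
  also have "\<dots> = ennreal (1 / (2 * pi)) * (\<integral>\<^sup>+z. (\<integral>\<^sup>+\<theta>. ennreal ((cmod (g z - k (T \<theta> z)))\<^sup>2) \<partial>angle) \<partial>lborel)"
    by (rule nn_integral_cmult) measurable
  also have "(\<integral>\<^sup>+z. (\<integral>\<^sup>+\<theta>. ennreal ((cmod (g z - k (T \<theta> z)))\<^sup>2) \<partial>angle) \<partial>lborel)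
     = (\<integral>\<^sup>+\<theta>. (\<integral>\<^sup>+z. ennreal ((cmod (g z - k (T \<theta> z)))\<^sup>2) \<partial>lborel) \<partial>angle)"
    by (rule angle_lborel.Fubini') measurable
  also have "\<dots> = (\<integral>\<^sup>+\<theta>. (\<integral>\<^sup>+z. ennreal ((cmod (g z - k z))\<^sup>2) \<partial>lborel) \<partial>angle)"
  proof (rule nn_integral_cong)
    fix \<theta> :: real
    have "(\<integral>\<^sup>+z. ennreal ((cmod (g z - k (T \<theta> z)))\<^sup>2) \<partial>lborel) = (\<integral>\<^sup>+z. ennreal ((cmod (g (T \<theta> z) - k (T \<theta> z)))\<^sup>2) \<partial>lborel)"
      using g[of \<theta>] by (intro nn_integral_cong_AE) (auto elim: eventually_mono)
    also have "\<dots> = (\<integral>\<^sup>+z. ennreal ((cmod (g z - k z))\<^sup>2) \<partial>distr lborel borel (T \<theta>))"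
      by (rule nn_integral_distr[symmetric]) measurable
    finally show "(\<integral>\<^sup>+z. ennreal ((cmod (g z - k (T \<theta> z)))\<^sup>2) \<partial>lborel) = (\<integral>\<^sup>+z. ennreal ((cmod (g z - k z))\<^sup>2) \<partial>lborel)"
      by (simp only: inv)
  qed
  also have "\<dots> = (\<integral>\<^sup>+z. ennreal ((cmod (g z - k z))\<^sup>2) \<partial>lborel) * ennreal (2 * pi)" by simp
  also have "ennreal (1 / (2 * pi)) * ((\<integral>\<^sup>+z. ennreal ((cmod (g z - k z))\<^sup>2) \<partial>lborel) * ennreal (2 * pi))
     = (\<integral>\<^sup>+z. ennreal ((cmod (g z - k z))\<^sup>2) \<partial>lborel)"
  proof -
    have one: "ennreal (1 / (2 * pi)) * ennreal (2 * pi) = 1" by (subst ennreal_mult[symmetric]) auto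
    have "ennreal (1 / (2 * pi)) * (X * ennreal (2 * pi)) = (ennreal (1 / (2 * pi)) * ennreal (2 * pi)) * X" for X
      by (simp only: mult_ac)
    thus ?thesis by (simp only: one mult_1)
  qed
  finally show "(\<integral>\<^sup>+z. ennreal ((cmod (g z - angle_average T k z))\<^sup>2) \<partial>lborel) \<le> (\<integral>\<^sup>+z. ennreal ((cmod (g z - k z))\<^sup>2) \<partial>lborel)" .
qed

section \<open>Rotations of the two planes and biradial test functions\<close>

definition rot1 :: "real \<Rightarrow> (real^2) \<times> (real^2) \<Rightarrow> (real^2) \<times> (real^2)" where
  "rot1 \<theta> z = (rot \<theta> (fst z), snd z)"

definition rot2 :: "real \<Rightarrow> (real^2) \<times> (real^2) \<Rightarrow> (real^2) \<times> (real^2)" where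
  "rot2 \<theta> z = (fst z, rot \<theta> (snd z))"

lemma rot12_measurable:
  "(\<lambda>p. rot1 (fst p) (snd p)) \<in> borel_measurable (borel \<Otimes>\<^sub>M borel)"
  "(\<lambda>p. rot2 (fst p) (snd p)) \<in> borel_measurable (borel \<Otimes>\<^sub>M borel)"
  unfolding rot1_def rot2_def by measurable

lemma rot12_measurable' [measurable]:
  "rot1 \<theta> \<in> borel_measurable borel" "rot2 \<theta> \<in> borel_measurable borel"
  unfolding rot1_def[abs_def] rot2_def[abs_def] by measurable

lemma distr_eq_lborelI:
  fixes T :: "'a::euclidean_space \<Rightarrow> 'a"
  assumes [measurable]: "T \<in> borel_measurable borel"
    and eq: "\<And>f. f \<in> borel_measurable borel \<Longrightarrow> (\<integral>\<^sup>+z. f (T z) \<partial>lborel) = (\<integral>\<^sup>+z. f z \<partial>lborel)"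
  shows "distr lborel borel T = lborel"
proof (rule measure_eqI)
  fix A assume "A \<in> sets (distr lborel borel T)"
  hence [measurable]: "A \<in> sets borel" by simp
  have "emeasure (distr lborel borel T) A = (\<integral>\<^sup>+z. indicator A (T z) \<partial>lborel)"
    by (subst nn_integral_indicator[symmetric], simp, subst nn_integral_distr) auto
  also have "\<dots> = (\<integral>\<^sup>+z. indicator A z \<partial>lborel)" by (rule eq) measurable
  finally show "emeasure (distr lborel borel T) A = emeasure lborel A" by simp
qed simp

lemma distr_rot1: "distr lborel borel (rot1 \<theta>) = lborel"
proof (rule distr_eq_lborelI)
  fix f :: "(real^2) \<times> (real^2) \<Rightarrow> ennreal" assume [measurable]: "f \<in> borel_measurable borel"
  have "(\<integral>\<^sup>+z. f (rot1 \<theta> z) \<partial>lborel) = (\<integral>\<^sup>+x. \<integral>\<^sup>+y. f (rot \<theta> x, y) \<partial>lborel \<partial>lborel)"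
    by (subst nn_integral_lborel_pair) (simp_all add: rot1_def)
  also have "\<dots> = (\<integral>\<^sup>+x. \<integral>\<^sup>+y. f (x, y) \<partial>lborel \<partial>lborel)"
    by (rule nn_integral_rot[of "\<lambda>x. \<integral>\<^sup>+y. f (x, y) \<partial>lborel"]) measurable
  also have "\<dots> = (\<integral>\<^sup>+z. f z \<partial>lborel)" by (rule nn_integral_lborel_pair[symmetric]) measurable
  finally show "(\<integral>\<^sup>+z. f (rot1 \<theta> z) \<partial>lborel) = (\<integral>\<^sup>+z. f z \<partial>lborel)" .
qed measurable

lemma distr_rot2: "distr lborel borel (rot2 \<theta>) = lborel"
proof (rule distr_eq_lborelI)
  fix f :: "(real^2) \<times> (real^2) \<Rightarrow> ennreal" assume [measurable]: "f \<in> borel_measurable borel"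
  have "(\<integral>\<^sup>+z. f (rot2 \<theta> z) \<partial>lborel) = (\<integral>\<^sup>+x. \<integral>\<^sup>+y. f (x, rot \<theta> y) \<partial>lborel \<partial>lborel)"
    by (subst nn_integral_lborel_pair) (simp_all add: rot2_def)
  also have "\<dots> = (\<integral>\<^sup>+x. \<integral>\<^sup>+y. f (x, y) \<partial>lborel \<partial>lborel)"
    by (intro nn_integral_cong nn_integral_rot) measurable
  also have "\<dots> = (\<integral>\<^sup>+z. f z \<partial>lborel)" by (rule nn_integral_lborel_pair[symmetric]) measurable
  finally show "(\<integral>\<^sup>+z. f (rot2 \<theta> z) \<partial>lborel) = (\<integral>\<^sup>+z. f z \<partial>lborel)" .
qed measurable

text \<open>Dominated convergence along sequences; a constant is an integrable majorant because the
  circle has finite mass.\<close>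

lemma continuous_on_angle_integral:
  fixes f :: "'a::metric_space \<Rightarrow> real \<Rightarrow> complex"
  assumes cont: "\<And>\<theta>. continuous_on UNIV (\<lambda>x. f x \<theta>)" and m: "\<And>x. f x \<in> borel_measurable borel"
    and B: "\<And>x \<theta>. cmod (f x \<theta>) \<le> B"
  shows "continuous_on UNIV (\<lambda>x. \<integral>\<theta>. f x \<theta> \<partial>angle)"
proof -
  have m' [measurable]: "f x \<in> borel_measurable angle" for x using m by simp
  show ?thesis
    unfolding continuous_on_sequentially
  proof (intro allI ballI impI)
    fix X :: "nat \<Rightarrow> 'a" and a assume "(\<forall>n. X n \<in> UNIV) \<and> X \<longlonglongrightarrow> a"
    hence X: "X \<longlonglongrightarrow> a" by simp
    have "(\<lambda>n. \<integral>\<theta>. f (X n) \<theta> \<partial>angle) \<longlonglongrightarrow> (\<integral>\<theta>. f a \<theta> \<partial>angle)"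
    proof (rule integral_dominated_convergence[where w="\<lambda>_. B"])
      show "AE \<theta> in angle. (\<lambda>n. f (X n) \<theta>) \<longlonglongrightarrow> f a \<theta>"
      proof (rule AE_I2)
        fix \<theta> show "(\<lambda>n. f (X n) \<theta>) \<longlonglongrightarrow> f a \<theta>"
          using cont[of \<theta>] X unfolding continuous_on_sequentially by (auto simp: o_def)
      qed
    qed (use B in auto)
    thus "((\<lambda>x. \<integral>\<theta>. f x \<theta> \<partial>angle) \<circ> X) \<longlonglongrightarrow> (\<integral>\<theta>. f a \<theta> \<partial>angle)" by (simp add: o_def)
  qed
qed

text \<open>A test function close to \<open>g\<close> is averaged over the rotations of each plane
  in turn. This keeps continuity and the bound on the support, does not increase the distance to
  \<open>g\<close>, and leaves a function of the two squared norms.\<close>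

lemma biradial_test_approximation:
  fixes g :: "(real^2) \<times> (real^2) \<Rightarrow> complex"
  assumes g: "g \<in> L2" and G: "AE z in lborel. g z = G (norm (fst z)) (norm (snd z))" and e: "e > 0"
  obtains \<kappa> :: "real \<times> real \<Rightarrow> complex" and r where "continuous_on UNIV \<kappa>"
    "\<And>p q. p \<ge> 0 \<Longrightarrow> q \<ge> 0 \<Longrightarrow> p + q > r \<Longrightarrow> \<kappa> (p, q) = 0"
    "(\<lambda>z::(real^2) \<times> (real^2). \<kappa> ((norm (fst z))\<^sup>2, (norm (snd z))\<^sup>2)) \<in> L2"
    "L2_norm (\<lambda>z. g z - \<kappa> ((norm (fst z))\<^sup>2, (norm (snd z))\<^sup>2)) < e"
proof -
  \<comment> \<open>A Borel representative, so that composing with rotations stays within Borel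
    functions.\<close>
  obtain g' where [measurable]: "g' \<in> borel_measurable borel" and gg': "AE x in lborel. g x = g' x"
    by (rule L2_borel_version[OF g])
  obtain k where k: "test_function k" "L2_norm (\<lambda>x. g x - k x) < e"
    using L2_approximable[OF g] e unfolding approximable_def by blast
  obtain B where B: "\<And>x. cmod (k x) \<le> B" using test_function_bounded[OF k(1)] by blast
  obtain r where r: "\<And>z. norm z > r \<Longrightarrow> k z = 0" and kc: "continuous_on UNIV k"
    using k(1) by (auto simp: test_function_def)
  have km [measurable]: "k \<in> borel_measurable borel" using kc by (rule borel_measurable_continuous_onI)
  have G': "AE z in lborel. g' z = G (norm (fst z)) (norm (snd z))" using G gg' by eventually_elim simp
  \<comment> \<open>The biradial form holds almost everywhere, hence also almost everywhere at the
    rotated point because the rotation preserves the measure; the norms there are unchanged.\<close>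
  have inv1: "AE z in lborel. g' (rot1 \<theta> z) = g' z" for \<theta>
  proof -
    have "AE z in lborel. g' (rot1 \<theta> z) = G (norm (fst (rot1 \<theta> z))) (norm (snd (rot1 \<theta> z)))"
      proof (rule AE_distrD[where P="\<lambda>z. g' z = G (norm (fst z)) (norm (snd z))"])
        show "rot1 \<theta> \<in> lborel \<rightarrow>\<^sub>M borel" by simp
      qed (simp only: distr_rot1 G')
    with G' show ?thesis by eventually_elim (simp add: rot1_def)
  qed
  have inv2: "AE z in lborel. g' (rot2 \<theta> z) = g' z" for \<theta>
  proof -
    have "AE z in lborel. g' (rot2 \<theta> z) = G (norm (fst (rot2 \<theta> z))) (norm (snd (rot2 \<theta> z)))"
      proof (rule AE_distrD[where P="\<lambda>z. g' z = G (norm (fst z)) (norm (snd z))"])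
        show "rot2 \<theta> \<in> lborel \<rightarrow>\<^sub>M borel" by simp
      qed (simp only: distr_rot2 G')
    with G' show ?thesis by eventually_elim (simp add: rot2_def)
  qed
  define k1 where "k1 = angle_average rot1 k"
  define k2 where "k2 = angle_average rot2 k1"
  note avg1 = rot12_measurable(1) km B
  have k1m [measurable]: "k1 \<in> borel_measurable borel"
    unfolding k1_def by (rule angle_average_measurable[OF avg1])
  have B1: "cmod (k1 z) \<le> B" for z
    unfolding k1_def by (rule angle_average_bounded[OF avg1])
  have le1: "(\<integral>\<^sup>+z. ennreal ((cmod (g' z - k1 z))\<^sup>2) \<partial>lborel) \<le> (\<integral>\<^sup>+z. ennreal ((cmod (g' z - k z))\<^sup>2) \<partial>lborel)"
    unfolding k1_def by (rule angle_average_le[OF avg1 distr_rot1 _ inv1]) measurable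
  note avg2 = rot12_measurable(2) k1m B1
  have [measurable]: "k2 \<in> borel_measurable borel"
    unfolding k2_def by (rule angle_average_measurable[OF avg2])
  have le2: "(\<integral>\<^sup>+z. ennreal ((cmod (g' z - k2 z))\<^sup>2) \<partial>lborel) \<le> (\<integral>\<^sup>+z. ennreal ((cmod (g' z - k1 z))\<^sup>2) \<partial>lborel)"
    unfolding k2_def by (rule angle_average_le[OF avg2 distr_rot2 _ inv2]) measurable
  have le: "(\<integral>\<^sup>+z. ennreal ((cmod (g' z - k2 z))\<^sup>2) \<partial>lborel) \<le> (\<integral>\<^sup>+z. ennreal ((cmod (g' z - k z))\<^sup>2) \<partial>lborel)"
    by (rule order_trans[OF le2 le1])
  \<comment> \<open>As \<open>sqrt\<close> is continuous on all reals, this formula defines a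
    continuous function on the whole plane, which equals \<open>k2\<close> at pairs of squared
    norms.\<close>
  define \<kappa> where "\<kappa> = (\<lambda>(p, q). (\<integral>\<theta>'. (\<integral>\<theta>. k (sqrt p *\<^sub>R dir \<theta>, sqrt q *\<^sub>R dir \<theta>') \<partial>angle) / of_real (2 * pi) \<partial>angle) / complex_of_real (2 * pi))"
  have eq: "k2 z = \<kappa> ((norm (fst z))\<^sup>2, (norm (snd z))\<^sup>2)" for z
  proof -
    have "k1 (fst z, v) = (\<integral>\<theta>. k (norm (fst z) *\<^sub>R dir \<theta>, v) \<partial>angle) / of_real (2 * pi)" for v
      unfolding k1_def angle_average_def rot1_def fst_conv snd_conv
      by (subst integral_angle_rot[of "\<lambda>x. k (x, v)"]) simp_all
    hence "k2 z = (\<integral>\<theta>'. (\<integral>\<theta>. k (norm (fst z) *\<^sub>R dir \<theta>, rot \<theta>' (snd z)) \<partial>angle) / of_real (2 * pi) \<partial>angle) / of_real (2 * pi)"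
      by (simp add: k2_def angle_average_def rot2_def)
    also have "\<dots> = (\<integral>\<theta>'. (\<integral>\<theta>. k (norm (fst z) *\<^sub>R dir \<theta>, norm (snd z) *\<^sub>R dir \<theta>') \<partial>angle) / of_real (2 * pi) \<partial>angle) / of_real (2 * pi)"
      by (subst integral_angle_rot[of "\<lambda>y. (\<integral>\<theta>. k (norm (fst z) *\<^sub>R dir \<theta>, y) \<partial>angle) / of_real (2 * pi)"]) simp_all
    finally show ?thesis by (simp add: \<kappa>_def)
  qed
  have cont: "continuous_on UNIV \<kappa>"
  proof -
    have "continuous_on UNIV (\<lambda>x. \<integral>\<theta>. k (sqrt (fst x) *\<^sub>R dir \<theta>, sqrt (snd x) *\<^sub>R dir \<theta>') \<partial>angle)" for \<theta>'
    proof (rule continuous_on_angle_integral[where f="\<lambda>x \<theta>. k (sqrt (fst x) *\<^sub>R dir \<theta>, sqrt (snd x) *\<^sub>R dir \<theta>')"])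
      show "continuous_on UNIV (\<lambda>x. k (sqrt (fst x) *\<^sub>R dir \<theta>, sqrt (snd x) *\<^sub>R dir \<theta>'))" for \<theta>
        by (rule continuous_on_compose2[OF kc]) (auto intro!: continuous_intros)
      show "cmod (k (sqrt (fst x) *\<^sub>R dir \<theta>, sqrt (snd x) *\<^sub>R dir \<theta>')) \<le> B" for x \<theta> by (rule B)
    qed measurable
    hence c1: "continuous_on UNIV (\<lambda>x. (\<integral>\<theta>. k (sqrt (fst x) *\<^sub>R dir \<theta>, sqrt (snd x) *\<^sub>R dir \<theta>') \<partial>angle) / complex_of_real (2 * pi))" for \<theta>'
      by (intro continuous_on_divide continuous_on_const) auto
    have "continuous_on UNIV (\<lambda>x. (\<integral>\<theta>'. (\<integral>\<theta>. k (sqrt (fst x) *\<^sub>R dir \<theta>, sqrt (snd x) *\<^sub>R dir \<theta>') \<partial>angle) / complex_of_real (2 * pi) \<partial>angle) / complex_of_real (2 * pi))"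
    proof (rule continuous_on_divide[OF continuous_on_angle_integral[where B=B, OF c1] continuous_on_const])
      fix x :: "real \<times> real" and \<theta>' :: real
      have "cmod (\<integral>\<theta>. k (sqrt (fst x) *\<^sub>R dir \<theta>, sqrt (snd x) *\<^sub>R dir \<theta>') \<partial>angle) \<le> B * (2 * pi)"
        by (rule norm_angle_integral_le) (simp_all add: B)
      thus "cmod ((\<integral>\<theta>. k (sqrt (fst x) *\<^sub>R dir \<theta>, sqrt (snd x) *\<^sub>R dir \<theta>') \<partial>angle) / complex_of_real (2 * pi)) \<le> B"
        by (simp add: norm_divide field_simps)
    qed simp_all
    thus ?thesis by (simp add: \<kappa>_def case_prod_unfold)
  qed
  have supp: "\<kappa> (p, q) = 0" if "p \<ge> 0" "q \<ge> 0" "p + q > r\<^sup>2" for p q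
  proof -
    have "k (sqrt p *\<^sub>R dir \<theta>, sqrt q *\<^sub>R dir \<theta>') = 0" for \<theta> \<theta>'
    proof (rule r)
      have "norm (sqrt p *\<^sub>R dir \<theta>, sqrt q *\<^sub>R dir \<theta>') = sqrt (p + q)"
        using that by (simp add: norm_Pair)
      thus "norm (sqrt p *\<^sub>R dir \<theta>, sqrt q *\<^sub>R dir \<theta>') > r"
        using that by (simp add: real_less_rsqrt)
    qed
    thus ?thesis by (simp add: \<kappa>_def)
  qed
  have gk: "(\<lambda>z. g z - k z) \<in> L2" by (intro L2_diff g test_function_L2 k(1))
  have "(\<integral>\<^sup>+z. ennreal ((cmod (g z - k2 z))\<^sup>2) \<partial>lebesgue) = (\<integral>\<^sup>+z. ennreal ((cmod (g' z - k2 z))\<^sup>2) \<partial>lborel)"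
    unfolding nn_integral_completion using gg' by (intro nn_integral_cong_AE) (auto elim: eventually_mono)
  also have "\<dots> \<le> (\<integral>\<^sup>+z. ennreal ((cmod (g' z - k z))\<^sup>2) \<partial>lborel)" by (rule le)
  also have "\<dots> = (\<integral>\<^sup>+z. ennreal ((cmod (g z - k z))\<^sup>2) \<partial>lebesgue)"
    unfolding nn_integral_completion using gg' by (intro nn_integral_cong_AE) (auto elim: eventually_mono)
  also have "\<dots> = ennreal ((L2_norm (\<lambda>x. g x - k x))\<^sup>2)" by (rule nn_integral_L2[OF gk])
  finally have fin: "(\<integral>\<^sup>+z. ennreal ((cmod (g z - k2 z))\<^sup>2) \<partial>lebesgue) \<le> ennreal ((L2_norm (\<lambda>x. g x - k x))\<^sup>2)" .
  have "k2 \<in> borel_measurable lebesgue" by (intro measurable_completion) simp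
  hence "(\<lambda>z. g z - k2 z) \<in> borel_measurable lebesgue" using L2D(1)[OF g] by measurable
  note L = L2_nn_integralI[OF this fin L2_norm_nonneg]
  show thesis
  proof (rule that[OF cont supp])
    have "(\<lambda>z. g z - (g z - k2 z)) \<in> L2" by (intro L2_diff g L(1))
    hence "(\<lambda>z. k2 z) \<in> L2" by simp
    thus "(\<lambda>z::(real^2) \<times> (real^2). \<kappa> ((norm (fst z))\<^sup>2, (norm (snd z))\<^sup>2)) \<in> L2" by (simp only: eq)
    show "L2_norm (\<lambda>z. g z - \<kappa> ((norm (fst z))\<^sup>2, (norm (snd z))\<^sup>2)) < e"
      using le_less_trans[OF L(2) k(2)] by (simp only: eq)
  qed
qed

section \<open>Approximation by combinations of biradial Gaussians\<close>

inductive biradial_gaussian :: "((real^2) \<times> (real^2) \<Rightarrow> complex) \<Rightarrow> bool" where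
  gaussian: "a > 0 \<Longrightarrow> b > 0 \<Longrightarrow> biradial_gaussian (\<lambda>z. of_real (exp (- a * (norm (fst z))\<^sup>2 - b * (norm (snd z))\<^sup>2)))"
| add: "biradial_gaussian f \<Longrightarrow> biradial_gaussian g \<Longrightarrow> biradial_gaussian (\<lambda>z. f z + g z)"
| scale: "biradial_gaussian f \<Longrightarrow> biradial_gaussian (\<lambda>z. c * f z)"

lemma biradial_gaussian_mult_exp:
  assumes "biradial_gaussian f"
  shows "biradial_gaussian (\<lambda>z. f z * of_real (exp (- (norm (fst z))\<^sup>2)))"
    and "biradial_gaussian (\<lambda>z. f z * of_real (exp (- (norm (snd z))\<^sup>2)))"
  using assms
proof (induction)
  case (gaussian a b)
  case 1
  have "(\<lambda>z::(real^2) \<times> (real^2). complex_of_real (exp (- a * (norm (fst z))\<^sup>2 - b * (norm (snd z))\<^sup>2)) * of_real (exp (- (norm (fst z))\<^sup>2)))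
    = (\<lambda>z. of_real (exp (- (a + 1) * (norm (fst z))\<^sup>2 - b * (norm (snd z))\<^sup>2)))"
    by (simp add: fun_eq_iff exp_add[symmetric] algebra_simps flip: of_real_mult)
  thus ?case using biradial_gaussian.gaussian[of "a + 1" b] gaussian by simp
next
  case (gaussian a b)
  case 2
  have "(\<lambda>z::(real^2) \<times> (real^2). complex_of_real (exp (- a * (norm (fst z))\<^sup>2 - b * (norm (snd z))\<^sup>2)) * of_real (exp (- (norm (snd z))\<^sup>2)))
    = (\<lambda>z. of_real (exp (- a * (norm (fst z))\<^sup>2 - (b + 1) * (norm (snd z))\<^sup>2)))"
    by (simp add: fun_eq_iff exp_add[symmetric] algebra_simps flip: of_real_mult)
  thus ?case using biradial_gaussian.gaussian[of a "b + 1"] gaussian by simp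
next
  case (add f g)
  { case 1 show ?case using biradial_gaussian.add[OF add.IH(1) add.IH(3)] by (simp add: distrib_right) }
  { case 2 show ?case using biradial_gaussian.add[OF add.IH(2) add.IH(4)] by (simp add: distrib_right) }
next
  case (scale f c)
  { case 1 show ?case using biradial_gaussian.scale[OF scale.IH(1), of c] by (simp add: mult.assoc) }
  { case 2 show ?case using biradial_gaussian.scale[OF scale.IH(2), of c] by (simp add: mult.assoc) }
qed

text \<open>In the variables u = exp (- |x|^2) and v = exp (- |y|^2) a monomial only raises the
  coefficients of a Gaussian by integers, so the class is a module over polynomials in
  \<open>u\<close> and \<open>v\<close>. This is why Stone-Weierstrass is applied in these
  variables.\<close>

lemma biradial_gaussian_mult_polynomial:
  assumes "real_polynomial_function (P :: real \<times> real \<Rightarrow> real)" "biradial_gaussian f"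
  shows "biradial_gaussian (\<lambda>z. f z * of_real (P (exp (- (norm (fst z))\<^sup>2), exp (- (norm (snd z))\<^sup>2))))"
  using assms
proof (induction arbitrary: f)
  case (linear P)
  have P: "P (u, v) = u * P (1, 0) + v * P (0, 1)" for u v
  proof -
    have "P (u *\<^sub>R (1, 0) + v *\<^sub>R (0, 1)) = u * P (1, 0) + v * P (0, 1)"
      using bounded_linear.linear[OF linear.hyps] by (simp only: linear_add linear_cmul real_scaleR_def)
    thus ?thesis by simp
  qed
  show ?case
    using biradial_gaussian.add[OF biradial_gaussian.scale[OF biradial_gaussian_mult_exp(1)[OF linear.prems], of "of_real (P (1, 0))"]
        biradial_gaussian.scale[OF biradial_gaussian_mult_exp(2)[OF linear.prems], of "of_real (P (0, 1))"]]
    by (subst P) (simp add: algebra_simps)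
next
  case (const c)
  show ?case using biradial_gaussian.scale[OF const.prems, of "of_real c"] by (simp add: mult.commute)
next
  case (add P Q)
  show ?case using biradial_gaussian.add[OF add.IH(1)[OF add.prems] add.IH(2)[OF add.prems]] by (simp add: distrib_left)
next
  case (mult P Q)
  show ?case using mult.IH(2)[OF mult.IH(1)[OF mult.prems]] by (simp add: mult.assoc)
qed

lemma L2_norm_mono:
  assumes "f \<in> borel_measurable lebesgue" "h \<in> L2" "\<And>x. cmod (f x) \<le> cmod (h x)"
  shows "f \<in> L2" "L2_norm f \<le> L2_norm h"
proof -
  have le: "(cmod (f x))\<^sup>2 \<le> (cmod (h x))\<^sup>2" for x using assms(3) by (intro power_mono) auto
  show f: "f \<in> L2" unfolding L2_def
  proof (intro CollectI conjI assms(1))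
    show "integrable lebesgue (\<lambda>x. (cmod (f x))\<^sup>2)"
      by (rule Bochner_Integration.integrable_bound[OF L2D(2)[OF assms(2)]]) (use assms(1) le in auto)
  qed
  show "L2_norm f \<le> L2_norm h" unfolding L2_norm_def
    by (intro real_sqrt_le_mono integral_mono L2D(2) f assms(2) le)
qed

text \<open>The function \<kappa> is divided by the Gaussian E = u v before the polynomial
  approximation: an error \<delta> in the quotient \<open>m\<close>, uniform on the unit square,
  becomes an error \<delta> E, small in norm because \<open>E\<close> is in \<open>L2\<close>. The
  quotient is continuous up to \<open>u = 0\<close> and \<open>v = 0\<close> because \<kappa>
  vanishes for large arguments.\<close>

lemma biradial_gaussian_dense:
  fixes g :: "(real^2) \<times> (real^2) \<Rightarrow> complex"
  assumes g: "g \<in> L2" and G: "AE z in lborel. g z = G (norm (fst z)) (norm (snd z))" and e: "e > 0"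
  obtains f where "biradial_gaussian f" "L2_norm (\<lambda>z. g z - f z) < e"
proof -
  obtain \<kappa> :: "real \<times> real \<Rightarrow> complex" and r where \<kappa>: "continuous_on UNIV \<kappa>"
    and supp: "\<And>p q. p \<ge> 0 \<Longrightarrow> q \<ge> 0 \<Longrightarrow> p + q > r \<Longrightarrow> \<kappa> (p, q) = 0"
    and h: "(\<lambda>z::(real^2) \<times> (real^2). \<kappa> ((norm (fst z))\<^sup>2, (norm (snd z))\<^sup>2)) \<in> L2"
    and gh: "L2_norm (\<lambda>z. g z - \<kappa> ((norm (fst z))\<^sup>2, (norm (snd z))\<^sup>2)) < e / 2"
    using biradial_test_approximation[OF g G, of "e / 2"] e by auto
  define E where "E = (\<lambda>z::(real^2) \<times> (real^2). complex_of_real (exp (- 1 * (norm (fst z))\<^sup>2 - 1 * (norm (snd z))\<^sup>2)))"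
  have E: "biradial_gaussian E" unfolding E_def by (intro biradial_gaussian.gaussian) auto
  have EL: "E \<in> L2"
  proof -
    have "E = (\<lambda>z. of_real (gaussian (\<lambda>_. 1) z))"
      by (auto simp: E_def gaussian_const norm_Pair fun_eq_iff)
    moreover have "polynomial_gaussian (\<lambda>z::(real^2) \<times> (real^2). complex_of_real (gaussian (\<lambda>_. 1) z))"
      by (intro polynomial_gaussian.gaussian) auto
    ultimately have "admissible E" using polynomial_gaussian_schwartz schwartz_admissible by metis
    thus ?thesis by (intro L2_borelI) (auto simp: admissible_def dest: borel_measurable_integrable)
  qed
  \<comment> \<open>The summand 1 keeps the denominator positive and makes the final bound
    strict.\<close>
  define \<delta> where "\<delta> = e / (2 * (L2_norm E + 1))"
  have \<delta>: "\<delta> > 0" using e L2_norm_nonneg[of E] by (simp add: \<delta>_def add_nonneg_pos)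
  \<comment> \<open>A cut-off for the logarithms and the division: if \<open>u\<close> or
    \<open>v\<close> falls below \<open>c\<close>, then |x|^2 or |y|^2 exceeds
    \<open>|r| + 1\<close>. In that region \<kappa> vanishes both at the true and at the truncated
    arguments, so the truncation does not alter the product of \<open>E\<close> and
    \<open>m\<close>.\<close>
  define c where "c = exp (- (\<bar>r\<bar> + 1))"
  have c: "0 < c" "c \<le> 1" by (auto simp: c_def)
  define m where "m x = \<kappa> (- ln (max (fst x) c), - ln (max (snd x) c)) / of_real (max (fst x) c * max (snd x) c)" for x :: "real \<times> real"
  have "continuous_on ({0..1} \<times> {0..1}) m"
  proof -
    have "max (fst x) c \<noteq> 0" "max (snd x) c \<noteq> 0" for x :: "real \<times> real" using c by (auto simp: max_def)
    hence "continuous_on UNIV m" unfolding m_def[abs_def]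
      by (intro continuous_on_divide continuous_on_compose2[OF \<kappa>] continuous_intros) auto
    thus ?thesis by (rule continuous_on_subset) auto
  qed
  then obtain P where P: "polynomial_function P" "\<And>x. x \<in> {0..1} \<times> {0..1} \<Longrightarrow> norm (m x - P x) < \<delta>"
    using Stone_Weierstrass_polynomial_function[of "{0..1} \<times> {0..1}" m \<delta>] \<delta> by (auto simp: compact_Times)
  have PR: "real_polynomial_function (Re \<circ> P)" "real_polynomial_function (Im \<circ> P)"
    using P(1) bounded_linear_Re bounded_linear_Im unfolding polynomial_function_def by blast+
  define x where "x z = (exp (- (norm (fst z))\<^sup>2), exp (- (norm (snd z))\<^sup>2))" for z :: "(real^2) \<times> (real^2)"
  define f where "f z = E z * P (x z)" for z
  have f: "biradial_gaussian f"
  proof -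
    have "biradial_gaussian (\<lambda>z. E z * of_real ((Re \<circ> P) (x z)) + \<i> * (E z * of_real ((Im \<circ> P) (x z))))"
      unfolding x_def by (intro biradial_gaussian.add biradial_gaussian.scale biradial_gaussian_mult_polynomial PR E)
    moreover have "(\<lambda>z. E z * of_real ((Re \<circ> P) (x z)) + \<i> * (E z * of_real ((Im \<circ> P) (x z)))) = f"
    proof
      fix z
      have "E z * of_real ((Re \<circ> P) (x z)) + \<i> * (E z * of_real ((Im \<circ> P) (x z))) = E z * Complex (Re (P (x z))) (Im (P (x z)))"
        by (simp only: Complex_eq o_apply) (simp add: algebra_simps)
      thus "E z * of_real ((Re \<circ> P) (x z)) + \<i> * (E z * of_real ((Im \<circ> P) (x z))) = f z" by (simp add: f_def)
    qed
    ultimately show ?thesis by simp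
  qed
  have key: "cmod (\<kappa> ((norm (fst z))\<^sup>2, (norm (snd z))\<^sup>2) - f z) \<le> \<delta> * cmod (E z)" for z
  proof -
    define p where "p = (norm (fst z))\<^sup>2"
    define q where "q = (norm (snd z))\<^sup>2"
    have pq: "p \<ge> 0" "q \<ge> 0" by (auto simp: p_def q_def)
    have Ez: "E z = of_real (exp (- p) * exp (- q))" by (simp add: E_def p_def q_def exp_add[symmetric])
    have xz: "x z = (exp (- p), exp (- q))" by (simp add: x_def p_def q_def)
    have in01: "x z \<in> {0..1} \<times> {0..1}" using pq by (simp add: xz)
    have "\<kappa> (p, q) = E z * m (x z)"
    proof (cases "exp (- p) \<ge> c \<and> exp (- q) \<ge> c")
      case True
      hence "m (x z) = \<kappa> (p, q) / of_real (exp (- p) * exp (- q))" by (simp add: m_def xz max_absorb1)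
      thus ?thesis by (simp add: Ez)
    next
      case False
      hence *: "p > \<bar>r\<bar> + 1 \<or> q > \<bar>r\<bar> + 1" by (auto simp: c_def)
      hence "p + q > r" using pq by auto
      hence k0: "\<kappa> (p, q) = 0" using supp pq by blast
      define p' where "p' = - ln (max (exp (- p)) c)"
      define q' where "q' = - ln (max (exp (- q)) c)"
      have pp: "p' = min p (\<bar>r\<bar> + 1)" unfolding p'_def c_def by (auto simp: max_def min_def)
      have qq: "q' = min q (\<bar>r\<bar> + 1)" unfolding q'_def c_def by (auto simp: max_def min_def)
      have "p' \<ge> 0" "q' \<ge> 0" "p' + q' > r" using pq * by (auto simp: pp qq min_def)
      hence "\<kappa> (p', q') = 0" using supp by blast
      hence "m (x z) = 0" by (simp add: m_def xz p'_def q'_def)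
      thus ?thesis using k0 by simp
    qed
    hence "\<kappa> (p, q) - f z = E z * (m (x z) - P (x z))" by (simp add: f_def right_diff_distrib)
    hence "cmod (\<kappa> (p, q) - f z) = cmod (E z) * cmod (m (x z) - P (x z))" by (simp add: norm_mult)
    also have "\<dots> \<le> cmod (E z) * \<delta>" using P(2)[OF in01] by (intro mult_left_mono) auto
    finally show ?thesis by (simp add: p_def q_def mult.commute)
  qed
  have fm: "f \<in> borel_measurable borel"
  proof -
    have "continuous_on UNIV P" using P(1) by (rule continuous_on_polymonial_function)
    hence [measurable]: "P \<in> borel_measurable borel" by (rule borel_measurable_continuous_onI)
    show ?thesis unfolding f_def[abs_def] E_def x_def by measurable
  qed
  have hf: "(\<lambda>z. \<kappa> ((norm (fst z))\<^sup>2, (norm (snd z))\<^sup>2) - f z) \<in> borel_measurable lebesgue"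
  proof -
    have "f \<in> borel_measurable lebesgue" using fm by (intro measurable_completion) simp
    from borel_measurable_diff[OF L2D(1)[OF h] this] show ?thesis .
  qed
  have d: "(\<lambda>z. \<kappa> ((norm (fst z))\<^sup>2, (norm (snd z))\<^sup>2) - f z) \<in> L2"
    "L2_norm (\<lambda>z. \<kappa> ((norm (fst z))\<^sup>2, (norm (snd z))\<^sup>2) - f z) \<le> L2_norm (\<lambda>z. of_real \<delta> * E z)"
    using L2_norm_mono[OF hf L2_scale[OF EL, of "of_real \<delta>"]] key \<delta> by (simp_all add: norm_mult)
  have "L2_norm (\<lambda>z. of_real \<delta> * E z) < e / 2"
  proof -
    have "\<delta> * L2_norm E < \<delta> * (L2_norm E + 1)" using \<delta> by simp
    also have "\<dots> = e / 2" using L2_norm_nonneg[of E] by (simp add: \<delta>_def field_simps add_nonneg_eq_0_iff)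
    finally show ?thesis using \<delta> by (simp add: L2_norm_scale)
  qed
  moreover have fL: "f \<in> L2"
    using L2_diff[OF h d(1)] by simp
  moreover have "L2_norm (\<lambda>z. g z - f z) \<le> L2_norm (\<lambda>z. g z - \<kappa> ((norm (fst z))\<^sup>2, (norm (snd z))\<^sup>2))
      + L2_norm (\<lambda>z. \<kappa> ((norm (fst z))\<^sup>2, (norm (snd z))\<^sup>2) - f z)"
    by (rule L2_norm_triangle[OF g h fL])
  ultimately have "L2_norm (\<lambda>z. g z - f z) < e" using gh d(2) by linarith
  thus thesis using f that by blast
qed

section \<open>The sharpened Strichartz inequality\<close>

lemma fourier_add:
  assumes "integrable lborel f" "integrable lborel g"
  shows "fourier (\<lambda>x. f x + g x) \<xi> = fourier f \<xi> + fourier g \<xi>"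
proof -
  have "integrable lborel (\<lambda>x. cis (- (x \<bullet> \<xi>)) * f x)" "integrable lborel (\<lambda>x. cis (- (x \<bullet> \<xi>)) * g x)"
    by (intro integrable_cis_mult assms, measurable)+
  thus ?thesis by (simp add: fourier_def distrib_left)
qed

lemma fourier_scale: "fourier (\<lambda>x. c * f x) \<xi> = c * fourier f \<xi>"
  by (simp add: fourier_def mult.left_commute)

lemma fourier_diff:
  assumes "integrable lborel f" "integrable lborel g"
  shows "fourier (\<lambda>x. f x - g x) \<xi> = fourier f \<xi> - fourier g \<xi>"
  using fourier_add[of f "\<lambda>x. (-1) * g x" \<xi>] fourier_scale[of "-1" g \<xi>] assms by simp

text \<open>The map from \<open>a\<close> to \<open>1 / (4 * a)\<close> is an involution, and the
  two square roots multiply to \<open>2 * pi\<close> in every coordinate. Gaussians are even, so the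
  reflection of Fourier inversion is invisible.\<close>

lemma fourier_fourier_gaussian:
  fixes a :: "'a::euclidean_space \<Rightarrow> real"
  assumes a: "\<And>b. b \<in> Basis \<Longrightarrow> a b > 0"
  shows "fourier (fourier (\<lambda>x. of_real (gaussian a x))) z = of_real ((2 * pi) ^ DIM('a) * gaussian a z)"
proof -
  define a' where "a' b = 1 / (4 * a b)" for b
  have a': "\<And>b. b \<in> Basis \<Longrightarrow> a' b > 0" using a by (simp add: a'_def)
  have g: "gaussian (\<lambda>b. 1 / (4 * a' b)) = gaussian a" by (simp add: gaussian_def fun_eq_iff a'_def)
  have F: "fourier (\<lambda>x. of_real (gaussian a x)) = (\<lambda>\<xi>. of_real (\<Prod>b\<in>Basis. sqrt (pi / a b)) * of_real (gaussian a' \<xi>))"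
    unfolding fun_eq_iff a'_def by (simp add: fourier_gaussian[OF a])
  have "(\<Prod>b\<in>(Basis::'a set). sqrt (pi / a b)) * (\<Prod>b\<in>(Basis::'a set). sqrt (pi / a' b)) = (\<Prod>b\<in>(Basis::'a set). 2 * pi)"
    unfolding prod.distrib[symmetric]
  proof (rule prod.cong)
    fix b :: 'a assume b: "b \<in> Basis"
    have "sqrt (pi / a b) * sqrt (pi / a' b) = sqrt ((2 * pi)\<^sup>2)"
      using a[OF b] by (simp add: a'_def real_sqrt_mult[symmetric] power2_eq_square)
    thus "sqrt (pi / a b) * sqrt (pi / a' b) = 2 * pi" by (simp only: real_sqrt_abs) simp
  qed simp
  hence "(\<Prod>b\<in>(Basis::'a set). sqrt (pi / a b)) * (\<Prod>b\<in>(Basis::'a set). sqrt (pi / a' b)) = (2 * pi) ^ DIM('a)" by simp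
  moreover have "fourier (\<lambda>\<xi>. complex_of_real (gaussian a' \<xi>)) z = of_real ((\<Prod>b\<in>(Basis::'a set). sqrt (pi / a' b)) * gaussian a z)"
    using fourier_gaussian[of a' z] a' g by simp
  ultimately show ?thesis unfolding F fourier_scale
    by (simp only: of_real_mult[symmetric] mult.assoc[symmetric])
qed

text \<open>A basis vector of the product has exactly one nonzero component; the test
  \<open>snd c = 0\<close> selects those of the first plane.\<close>

lemma biradial_gaussian_base:
  fixes a b :: real
  shows "exp (- a * (norm (fst z))\<^sup>2 - b * (norm (snd z))\<^sup>2)
    = gaussian (\<lambda>c. if snd c = 0 then a else b) (z :: (real^2) \<times> (real^2))"
proof -
  have n: "(norm v)\<^sup>2 = (\<Sum>c\<in>Basis. (v \<bullet> c)\<^sup>2)" for v :: "real^2"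
    unfolding power2_norm_eq_inner by (subst euclidean_inner) (simp add: power2_eq_square)
  have "(\<Sum>c\<in>Basis. (if snd c = 0 then a else b) * (z \<bullet> c)\<^sup>2)
     = (\<Sum>i\<in>Basis. a * (fst z \<bullet> i)\<^sup>2) + (\<Sum>j\<in>Basis. b * (snd z \<bullet> j)\<^sup>2)"
  proof -
    have inj: "inj_on (\<lambda>u::real^2. (u, 0 :: real^2)) Basis" "inj_on (\<lambda>v::real^2. (0 :: real^2, v)) Basis"
      by (auto intro: inj_onI)
    have "sum f Basis = sum f ((\<lambda>u. (u, 0)) ` Basis) + sum f ((\<lambda>v. (0, v)) ` Basis)" for f :: "(real^2) \<times> (real^2) \<Rightarrow> real"
      unfolding Basis_prod_def by (rule sum.union_disjoint) auto
    thus ?thesis unfolding sum.reindex[OF inj(1)] sum.reindex[OF inj(2)] o_def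
      by (auto simp: inner_prod_def intro!: arg_cong2[where f="(+)"] sum.cong)
  qed
  also have "\<dots> = a * (norm (fst z))\<^sup>2 + b * (norm (snd z))\<^sup>2" by (simp add: n sum_distrib_left)
  finally show ?thesis by (simp add: gaussian_def)
qed

lemma biradial_gaussian_polynomial_gaussian:
  assumes "biradial_gaussian f"
  shows "polynomial_gaussian f"
  using assms
proof induction
  case (gaussian a b)
  thus ?case unfolding biradial_gaussian_base by (intro polynomial_gaussian.gaussian) auto
qed (auto intro: polynomial_gaussian.intros)

lemma biradial_gaussian_admissible: "biradial_gaussian f \<Longrightarrow> admissible f"
  by (intro schwartz_admissible polynomial_gaussian_schwartz biradial_gaussian_polynomial_gaussian)

text \<open>Linearity extends the computation for one Gaussian to combinations. The second half
  recovers the datum from its transform, so that an estimate on the frequency side can be carried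
  back by the Plancherel inequality.\<close>

lemma biradial_gaussian_fourier:
  assumes "biradial_gaussian f"
  shows "biradial_gaussian (fourier f) \<and> fourier (fourier f) = (\<lambda>z. of_real ((2 * pi) ^ 4) * f z)"
  using assms
proof induction
  case (gaussian a b)
  define w where "w c = (if snd c = 0 then a else b)" for c :: "(real^2) \<times> (real^2)"
  have w: "w c > 0" for c using gaussian by (simp add: w_def)
  have F: "fourier (\<lambda>z::(real^2) \<times> (real^2). complex_of_real (exp (- a * (norm (fst z))\<^sup>2 - b * (norm (snd z))\<^sup>2)))
    = (\<lambda>z. of_real (\<Prod>c\<in>Basis. sqrt (pi / w c)) * of_real (exp (- (1 / (4 * a)) * (norm (fst z))\<^sup>2 - 1 / (4 * b) * (norm (snd z))\<^sup>2)))"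
  proof
    fix z :: "(real^2) \<times> (real^2)"
    have "(\<lambda>c. 1 / (4 * w c)) = (\<lambda>c. if snd c = 0 then 1 / (4 * a) else 1 / (4 * b))" by (auto simp: w_def)
    thus "fourier (\<lambda>z::(real^2) \<times> (real^2). complex_of_real (exp (- a * (norm (fst z))\<^sup>2 - b * (norm (snd z))\<^sup>2))) z
      = of_real (\<Prod>c\<in>Basis. sqrt (pi / w c)) * of_real (exp (- (1 / (4 * a)) * (norm (fst z))\<^sup>2 - 1 / (4 * b) * (norm (snd z))\<^sup>2))"
      unfolding biradial_gaussian_base w_def[symmetric] by (subst fourier_gaussian) (use w in auto)
  qed
  have "biradial_gaussian (fourier (\<lambda>z::(real^2) \<times> (real^2). complex_of_real (exp (- a * (norm (fst z))\<^sup>2 - b * (norm (snd z))\<^sup>2))))"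
    unfolding F using gaussian by (intro biradial_gaussian.intros) auto
  moreover have "fourier (fourier (\<lambda>z::(real^2) \<times> (real^2). complex_of_real (exp (- a * (norm (fst z))\<^sup>2 - b * (norm (snd z))\<^sup>2))))
     = (\<lambda>z. of_real ((2 * pi) ^ 4) * complex_of_real (exp (- a * (norm (fst z))\<^sup>2 - b * (norm (snd z))\<^sup>2)))"
    unfolding biradial_gaussian_base w_def[symmetric]
    by (subst fun_eq_iff, subst fourier_fourier_gaussian) (use w in \<open>auto simp: eval_nat_numeral\<close>)
  ultimately show ?case by blast
next
  case (add f g)
  have i: "integrable lborel f" "integrable lborel g" "integrable lborel (fourier f)" "integrable lborel (fourier g)"
    using add biradial_gaussian_admissible by (auto simp: admissible_def)
  have F: "fourier (\<lambda>z. f z + g z) = (\<lambda>z. fourier f z + fourier g z)"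
    using i by (intro ext fourier_add)
  have "fourier (\<lambda>z. fourier f z + fourier g z) = (\<lambda>z. fourier (fourier f) z + fourier (fourier g) z)"
    using i by (intro ext fourier_add)
  thus ?case using add.IH by (auto simp: F algebra_simps intro: biradial_gaussian.add)
next
  case (scale f c)
  have F: "fourier (\<lambda>z. c * f z) = (\<lambda>z. c * fourier f z)" by (intro ext fourier_scale)
  have "fourier (\<lambda>z. c * fourier f z) = (\<lambda>z. c * fourier (fourier f) z)" by (intro ext fourier_scale)
  thus ?case using scale.IH by (auto simp: F mult.left_commute intro: biradial_gaussian.scale)
qed

section \<open>The transform of the mean over spheres\<close>

lemma shell_mean_eq:
  assumes [measurable]: "case_prod \<Phi> \<in> borel_measurable (borel \<Otimes>\<^sub>M borel)" and q: "q > 0"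
  shows "shell_mean \<Phi> q = (\<integral>s. indicator {0<..<1} s *\<^sub>R \<Phi> (q * s) (q * (1 - s)) \<partial>lborel)"
proof -
  \<comment> \<open>The substitution v = - q + 2 q s makes the range of integration independent of
    \<open>q\<close>, and the two squared norms become q s and q (1 - s).\<close>
  have "(\<integral>v. indicator {-q<..<q} v *\<^sub>R \<Phi> ((q + v) / 2) ((q - v) / 2) \<partial>lborel)
    = \<bar>2 * q\<bar> *\<^sub>R (\<integral>s. indicator {-q<..<q} (- q + 2 * q * s) *\<^sub>R \<Phi> ((q + (- q + 2 * q * s)) / 2) ((q - (- q + 2 * q * s)) / 2) \<partial>lborel)"
    using q by (intro lborel_integral_real_affine) auto
  also have "(\<integral>s. indicator {-q<..<q} (- q + 2 * q * s) *\<^sub>R \<Phi> ((q + (- q + 2 * q * s)) / 2) ((q - (- q + 2 * q * s)) / 2) \<partial>lborel)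
    = (\<integral>s. indicator {0<..<1} s *\<^sub>R \<Phi> (q * s) (q * (1 - s)) \<partial>lborel)"
  proof (rule Bochner_Integration.integral_cong)
    fix s :: real
    have "(- q < - q + 2 * q * s \<and> - q + 2 * q * s < q) \<longleftrightarrow> (0 < s \<and> s < 1)"
      using q by (auto simp: zero_less_mult_iff)
    hence "indicat_real {-q<..<q} (- q + 2 * q * s) = indicat_real {0<..<1} s"
      by (simp only: indicator_def greaterThanLessThan_iff)
    moreover have "(q + (- q + 2 * q * s)) / 2 = q * s" "(q - (- q + 2 * q * s)) / 2 = q * (1 - s)"
      by (simp_all add: field_simps)
    ultimately show "indicator {-q<..<q} (- q + 2 * q * s) *\<^sub>R \<Phi> ((q + (- q + 2 * q * s)) / 2) ((q - (- q + 2 * q * s)) / 2)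
      = indicator {0<..<1} s *\<^sub>R \<Phi> (q * s) (q * (1 - s))" by (simp only:)
  qed simp
  finally show ?thesis using q by (simp add: shell_mean_def scaleR_conv_of_real)
qed

text \<open>Collects what the gap estimate asks of the transform \<open>F\<close>: a bounded profile
  \<Phi>, a mean over spheres that is integrable and square integrable, and a radial transform of
  that mean. These conditions survive linear combinations, so one Gaussian decides.\<close>

definition radializable :: "((real^2) \<times> (real^2) \<Rightarrow> complex) \<Rightarrow> (real \<Rightarrow> real \<Rightarrow> complex) \<Rightarrow> bool" where
  "radializable F \<Phi> \<longleftrightarrow> case_prod \<Phi> \<in> borel_measurable (borel \<Otimes>\<^sub>M borel) \<and> (\<exists>B. \<forall>p r. cmod (\<Phi> p r) \<le> B) \<and>
     F = (\<lambda>z. \<Phi> ((norm (fst z))\<^sup>2) ((norm (snd z))\<^sup>2)) \<and>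
     integrable lborel (\<lambda>z::(real^2) \<times> (real^2). shell_mean \<Phi> ((norm z)\<^sup>2)) \<and>
     integrable lborel (\<lambda>z::(real^2) \<times> (real^2). (cmod (shell_mean \<Phi> ((norm z)\<^sup>2)))\<^sup>2) \<and>
     (\<exists>H. \<forall>z. fourier (\<lambda>z::(real^2) \<times> (real^2). shell_mean \<Phi> ((norm z)\<^sup>2)) z = H (norm z))"

text \<open>The mean over |z|^2 = q is the integral over \<open>s\<close> in (0, 1) of exp (- c(s)
  q) with c(s) = a s + b (1 - s): a superposition of isotropic Gaussians, whose transform is radial
  by Fubini. The minimum \<open>m\<close> of \<open>a\<close> and \<open>b\<close> bounds c(s) below
  and supplies all majorants. The absolute values keep the profile bounded on the whole plane and
  agree with it on squared norms.\<close>

lemma radializable_gaussian: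
  fixes a b :: real
  assumes a: "a > 0" and b: "b > 0"
  shows "radializable (\<lambda>z. of_real (exp (- a * (norm (fst z))\<^sup>2 - b * (norm (snd z))\<^sup>2)))
    (\<lambda>p r. of_real (exp (- a * \<bar>p\<bar> - b * \<bar>r\<bar>)))"
proof -
  define \<Phi> where "\<Phi> p r = complex_of_real (exp (- a * \<bar>p\<bar> - b * \<bar>r\<bar>))" for p r
  define m where "m = min a b"
  have m: "m > 0" using a b by (simp add: m_def)
  define c where "c s = a * s + b * (1 - s)" for s
  have cm: "c s \<ge> m" if "s \<in> {0<..<1}" for s
  proof -
    have "m * s + m * (1 - s) \<le> c s" unfolding c_def m_def using that by (intro add_mono mult_right_mono) auto
    thus ?thesis by (simp add: algebra_simps)
  qed
  have \<Phi>m [measurable]: "case_prod \<Phi> \<in> borel_measurable (borel \<Otimes>\<^sub>M borel)"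
    unfolding \<Phi>_def case_prod_unfold by measurable
  define I where "I s = complex_of_real (indicator {0<..<1} s)" for s :: real
  have [measurable]: "I \<in> borel_measurable borel" unfolding I_def[abs_def] by measurable
  have Ii: "integrable lborel I" unfolding I_def[abs_def]
    by (intro integrable_of_real integrable_real_indicator) auto
  have gi: "integrable lborel (\<lambda>z::(real^2) \<times> (real^2). complex_of_real (gaussian (\<lambda>_. m) z))"
    using m by (intro integrable_of_real integrable_gaussian) simp
  have gi2: "integrable lborel (\<lambda>z::(real^2) \<times> (real^2). (gaussian (\<lambda>_. m) z)\<^sup>2)"
  proof -
    have "(gaussian (\<lambda>_. m) z)\<^sup>2 = gaussian (\<lambda>_. 2 * m) z" for z :: "(real^2) \<times> (real^2)"
      by (simp add: gaussian_const power2_eq_square exp_add[symmetric])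
    thus ?thesis using m integrable_gaussian[of "\<lambda>_. 2 * m"] by simp
  qed
  \<comment> \<open>A fixed Gaussian of parameter \<open>m\<close> is split off to carry the
    integrability in \<zeta>; what is left is a kernel of modulus at most 1.\<close>
  define K where "K z p = cis (- (fst p \<bullet> z)) * (I (snd p) * of_real (exp (- (c (snd p) - m) * (norm (fst p))\<^sup>2)))"
    for z :: "(real^2) \<times> (real^2)" and p :: "((real^2) \<times> (real^2)) \<times> real"
  have [measurable]: "c \<in> borel_measurable borel" unfolding c_def[abs_def] by measurable
  have Km: "K z \<in> borel_measurable (lborel \<Otimes>\<^sub>M lborel)" for z
    unfolding K_def[abs_def] by measurable
  have Kb: "cmod (K z p) \<le> 1" for z p
  proof (cases "snd p \<in> {0<..<1}")
    case True
    hence "(c (snd p) - m) * (norm (fst p))\<^sup>2 \<ge> 0" using cm by (intro mult_nonneg_nonneg) auto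
    hence "exp (- ((c (snd p) - m) * (norm (fst p))\<^sup>2)) \<le> 1" by simp
    thus ?thesis using True by (simp only: K_def I_def norm_mult norm_cis norm_of_real minus_mult_left) simp
  qed (simp add: K_def I_def)
  have Keq: "K z (\<zeta>, s) * (of_real (gaussian (\<lambda>_. m) \<zeta>) * I s) = cis (- (\<zeta> \<bullet> z)) * (I s * of_real (exp (- c s * (norm \<zeta>)\<^sup>2)))" for z \<zeta> s
  proof -
    have "I s * I s = I s" by (auto simp: I_def split: split_indicator)
    moreover have "exp (- (c s - m) * (norm \<zeta>)\<^sup>2) * gaussian (\<lambda>_. m) \<zeta> = exp (- c s * (norm \<zeta>)\<^sup>2)"
      by (simp add: gaussian_const exp_add[symmetric] algebra_simps)
    ultimately have e: "I s * I s = I s" "complex_of_real (exp (- (c s - m) * (norm \<zeta>)\<^sup>2)) * of_real (gaussian (\<lambda>_. m) \<zeta>) = of_real (exp (- c s * (norm \<zeta>)\<^sup>2))"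
      by (simp_all only: of_real_mult[symmetric])
    have "K z (\<zeta>, s) * (of_real (gaussian (\<lambda>_. m) \<zeta>) * I s)
      = cis (- (\<zeta> \<bullet> z)) * ((I s * I s) * (of_real (exp (- (c s - m) * (norm \<zeta>)\<^sup>2)) * of_real (gaussian (\<lambda>_. m) \<zeta>)))"
      unfolding K_def fst_conv snd_conv by (simp only: mult_ac)
    thus ?thesis by (simp only: e)
  qed
  have int2: "integrable (lborel \<Otimes>\<^sub>M lborel) (\<lambda>(\<zeta>, s). cis (- (\<zeta> \<bullet> z)) * (I s * of_real (exp (- c s * (norm \<zeta>)\<^sup>2))))" for z :: "(real^2) \<times> (real^2)"
    using integrable_prod_tensor[OF gi Ii Km Kb, of z] by (simp only: Keq)
  define R where "R \<zeta> = (\<integral>s. I s * of_real (exp (- c s * (norm \<zeta>)\<^sup>2)) \<partial>lborel)" for \<zeta> :: "(real^2) \<times> (real^2)"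
  have R: "shell_mean \<Phi> ((norm \<zeta>)\<^sup>2) = R \<zeta>" if "\<zeta> \<noteq> 0" for \<zeta> :: "(real^2) \<times> (real^2)"
  proof -
    define q where "q = (norm \<zeta>)\<^sup>2"
    have q: "q > 0" using that by (simp add: q_def)
    have "indicator {0<..<1} s *\<^sub>R \<Phi> (q * s) (q * (1 - s)) = I s * of_real (exp (- c s * q))" for s
      using q by (auto simp: I_def \<Phi>_def c_def abs_mult algebra_simps split: split_indicator)
    thus ?thesis using shell_mean_eq[OF \<Phi>m q] by (simp add: R_def q_def)
  qed
  \<comment> \<open>At the origin the two sides differ, \<open>shell_mean\<close> being 0 there and
    \<open>R\<close> being 1, so equality is claimed almost everywhere.\<close>
  hence AER: "AE \<zeta> in lborel. shell_mean \<Phi> ((norm \<zeta>)\<^sup>2) = R \<zeta>"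
    using AE_lborel_singleton[of 0] by (auto elim: eventually_mono)
  note shell_mean_measurable[OF \<Phi>m, measurable]
  have [measurable]: "R \<in> borel_measurable borel" unfolding R_def[abs_def] by measurable
  have Rb: "cmod (R \<zeta>) \<le> gaussian (\<lambda>_. m) \<zeta>" for \<zeta>
  proof -
    have i: "integrable lborel (\<lambda>s. I s * of_real (gaussian (\<lambda>_. m) \<zeta>))" using Ii by simp
    have le: "cmod (I s * of_real (exp (- c s * (norm \<zeta>)\<^sup>2))) \<le> cmod (I s * of_real (gaussian (\<lambda>_. m) \<zeta>))" for s
      using cm[of s] by (auto simp: I_def norm_mult gaussian_const intro!: mult_right_mono split: split_indicator)
    have i': "integrable lborel (\<lambda>s. I s * of_real (exp (- c s * (norm \<zeta>)\<^sup>2)))"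
      by (rule Bochner_Integration.integrable_bound[OF i]) (use le in auto)
    have "cmod (R \<zeta>) \<le> (\<integral>s. cmod (I s * of_real (exp (- c s * (norm \<zeta>)\<^sup>2))) \<partial>lborel)"
      unfolding R_def by (rule Bochner_Integration.integral_norm_bound)
    also have "\<dots> \<le> (\<integral>s. cmod (I s * of_real (gaussian (\<lambda>_. m) \<zeta>)) \<partial>lborel)"
      by (intro integral_mono integrable_norm i i' le)
    also have "\<dots> = (\<integral>s. indicat_real {0<..<1::real} s * gaussian (\<lambda>_. m) \<zeta> \<partial>lborel)"
      by (simp only: I_def norm_mult norm_of_real abs_of_pos[OF gaussian_pos] abs_indicator)
    also have "\<dots> = (\<integral>s. indicat_real {0<..<1::real} s \<partial>lborel) * gaussian (\<lambda>_. m) \<zeta>"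
      by (rule integral_mult_left_zero)
    also have "(\<integral>s. indicat_real {0<..<1::real} s \<partial>lborel) = 1" by (simp add: measure_lborel_Ioo)
    also have "1 * gaussian (\<lambda>_. m) \<zeta> = gaussian (\<lambda>_. m) \<zeta>" by simp
    finally show ?thesis .
  qed
  have Ri: "integrable lborel R"
    by (rule Bochner_Integration.integrable_bound[OF gi]) (use Rb in \<open>auto simp: gaussian_pos less_imp_le\<close>)
  have R2: "integrable lborel (\<lambda>\<zeta>. (cmod (R \<zeta>))\<^sup>2)"
    by (rule Bochner_Integration.integrable_bound[OF gi2]) (use Rb in \<open>auto intro!: power_mono\<close>)
  have "fourier (\<lambda>z. shell_mean \<Phi> ((norm z)\<^sup>2)) z = (\<integral>s. I s * of_real (sqrt (pi / c s) ^ 4 * exp (- (1 / (4 * c s)) * (norm z)\<^sup>2)) \<partial>lborel)" for z :: "(real^2) \<times> (real^2)"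
  proof -
    have "fourier (\<lambda>z. shell_mean \<Phi> ((norm z)\<^sup>2)) z = fourier R z"
      unfolding fourier_def by (rule integral_cong_AE) (use AER in \<open>auto elim: eventually_mono\<close>)
    also have "\<dots> = (\<integral>\<zeta>. (\<integral>s. cis (- (\<zeta> \<bullet> z)) * (I s * of_real (exp (- c s * (norm \<zeta>)\<^sup>2))) \<partial>lborel) \<partial>lborel)"
      by (simp only: fourier_def R_def integral_mult_right_zero)
    also have "\<dots> = (\<integral>s. (\<integral>\<zeta>. cis (- (\<zeta> \<bullet> z)) * (I s * of_real (exp (- c s * (norm \<zeta>)\<^sup>2))) \<partial>lborel) \<partial>lborel)"
      by (rule lborel_pair.Fubini_integral[OF int2, symmetric])
    also have "\<dots> = (\<integral>s. I s * of_real (sqrt (pi / c s) ^ 4 * exp (- (1 / (4 * c s)) * (norm z)\<^sup>2)) \<partial>lborel)"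
    proof (rule Bochner_Integration.integral_cong)
      fix s :: real
      show "(\<integral>\<zeta>. cis (- (\<zeta> \<bullet> z)) * (I s * of_real (exp (- c s * (norm \<zeta>)\<^sup>2))) \<partial>lborel)
        = I s * of_real (sqrt (pi / c s) ^ 4 * exp (- (1 / (4 * c s)) * (norm z)\<^sup>2))"
      proof (cases "s \<in> {0<..<1}")
        case True
        hence cs: "c s > 0" using cm[OF True] m by linarith
        have "(\<integral>\<zeta>. cis (- (\<zeta> \<bullet> z)) * (I s * of_real (exp (- c s * (norm \<zeta>)\<^sup>2))) \<partial>lborel) = I s * fourier (\<lambda>\<zeta>. of_real (gaussian (\<lambda>_. c s) \<zeta>)) z"
          unfolding fourier_def integral_mult_right_zero[symmetric] gaussian_const by (simp only: mult.left_commute)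
        also have "fourier (\<lambda>\<zeta>. of_real (gaussian (\<lambda>_. c s) \<zeta>)) z = of_real (sqrt (pi / c s) ^ 4 * exp (- (1 / (4 * c s)) * (norm z)\<^sup>2))"
          using cs by (subst fourier_gaussian) (auto simp: gaussian_const)
        finally show ?thesis .
      qed (simp add: I_def)
    qed simp
    finally show ?thesis .
  qed
  hence H: "\<exists>H. \<forall>z. fourier (\<lambda>z::(real^2) \<times> (real^2). shell_mean \<Phi> ((norm z)\<^sup>2)) z = H (norm z)"
    by (intro exI[of _ "\<lambda>r. \<integral>s. I s * of_real (sqrt (pi / c s) ^ 4 * exp (- (1 / (4 * c s)) * r\<^sup>2)) \<partial>lborel"]) simp
  have s1: "integrable lborel (\<lambda>z::(real^2) \<times> (real^2). shell_mean \<Phi> ((norm z)\<^sup>2))"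
    using Ri by (subst integrable_cong_AE[OF _ _ AER]) auto
  have AER2: "AE \<zeta> in lborel. (cmod (shell_mean \<Phi> ((norm \<zeta>)\<^sup>2)))\<^sup>2 = (cmod (R \<zeta>))\<^sup>2"
    using AER by eventually_elim simp
  have s2: "integrable lborel (\<lambda>z::(real^2) \<times> (real^2). (cmod (shell_mean \<Phi> ((norm z)\<^sup>2)))\<^sup>2)"
    using R2 by (subst integrable_cong_AE[OF _ _ AER2]) auto
  have bnd: "cmod (\<Phi> p r) \<le> 1" for p r
  proof -
    have "a * \<bar>p\<bar> \<ge> 0" "b * \<bar>r\<bar> \<ge> 0" using a b by (auto intro: mult_nonneg_nonneg)
    thus ?thesis by (simp add: \<Phi>_def)
  qed
  have "radializable (\<lambda>z. of_real (exp (- a * (norm (fst z))\<^sup>2 - b * (norm (snd z))\<^sup>2))) \<Phi>"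
    unfolding radializable_def
  proof (intro conjI \<Phi>m s1 s2 H)
    show "\<exists>B. \<forall>p r. cmod (\<Phi> p r) \<le> B" using bnd by blast
    show "(\<lambda>z. of_real (exp (- a * (norm (fst z))\<^sup>2 - b * (norm (snd z))\<^sup>2))) = (\<lambda>z. \<Phi> ((norm (fst z))\<^sup>2) ((norm (snd z))\<^sup>2))"
      by (simp add: \<Phi>_def)
  qed
  thus ?thesis by (simp add: \<Phi>_def[abs_def])
qed

lemma radializable_add:
  assumes F: "radializable F \<Phi>" and G: "radializable G \<Psi>"
  shows "radializable (\<lambda>z. F z + G z) (\<lambda>p r. \<Phi> p r + \<Psi> p r)"
proof -
  have m: "case_prod \<Phi> \<in> borel_measurable (borel \<Otimes>\<^sub>M borel)" "case_prod \<Psi> \<in> borel_measurable (borel \<Otimes>\<^sub>M borel)"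
    using F G by (auto simp: radializable_def)
  note [measurable] = m
  obtain B C where B: "\<And>p r. cmod (\<Phi> p r) \<le> B" and C: "\<And>p r. cmod (\<Psi> p r) \<le> C"
    using F G unfolding radializable_def by blast
  have m': "(\<lambda>(p, r). \<Phi> p r + \<Psi> p r) \<in> borel_measurable (borel \<Otimes>\<^sub>M borel)"
    using borel_measurable_add[OF m] by (simp add: case_prod_unfold)
  \<comment> \<open>Boundedness of the profiles makes the integrals over each shell converge, whence
    additivity of \<open>shell_mean\<close>.\<close>
  have int: "integrable lborel (\<lambda>v. indicator {-q<..<q} v *\<^sub>R \<Theta> ((q + v) / 2) ((q - v) / 2))"
    if \<Theta>: "case_prod \<Theta> \<in> borel_measurable (borel \<Otimes>\<^sub>M borel)" and bd: "\<And>p r. cmod (\<Theta> p r) \<le> D" for \<Theta> D and q :: real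
  proof (rule Bochner_Integration.integrable_bound)
    show "integrable lborel (\<lambda>v. indicator {-q<..<q} v *\<^sub>R D)"
      by (cases "q \<ge> 0") (auto intro!: integrable_scaleR_left integrable_real_indicator)
    have "(\<lambda>v. \<Theta> ((q + v) / 2) ((q - v) / 2)) \<in> borel_measurable borel"
      using measurable_compose[of "\<lambda>v. ((q + v) / 2, (q - v) / 2)" borel "borel \<Otimes>\<^sub>M borel" "case_prod \<Theta>" borel] \<Theta> by simp
    thus "(\<lambda>v. indicator {-q<..<q} v *\<^sub>R \<Theta> ((q + v) / 2) ((q - v) / 2)) \<in> borel_measurable lborel" by simp
    have "D \<ge> 0" by (rule order_trans[OF norm_ge_zero bd])
    thus "AE v in lborel. norm (indicator {-q<..<q} v *\<^sub>R \<Theta> ((q + v) / 2) ((q - v) / 2)) \<le> norm (indicator {-q<..<q} v *\<^sub>R D)"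
      using bd by (intro AE_I2) (auto split: split_indicator)
  qed
  have sm: "shell_mean (\<lambda>p r. \<Phi> p r + \<Psi> p r) q = shell_mean \<Phi> q + shell_mean \<Psi> q" for q
    using int[OF m(1) B, of q] int[OF m(2) C, of q]
    by (simp add: shell_mean_def scaleR_add_right add_divide_distrib)
  obtain H1 H2 where H: "\<And>z. fourier (\<lambda>z::(real^2) \<times> (real^2). shell_mean \<Phi> ((norm z)\<^sup>2)) z = H1 (norm z)"
    "\<And>z. fourier (\<lambda>z::(real^2) \<times> (real^2). shell_mean \<Psi> ((norm z)\<^sup>2)) z = H2 (norm z)"
    using F G unfolding radializable_def by blast
  have i: "integrable lborel (\<lambda>z::(real^2) \<times> (real^2). shell_mean \<Phi> ((norm z)\<^sup>2))"
    "integrable lborel (\<lambda>z::(real^2) \<times> (real^2). shell_mean \<Psi> ((norm z)\<^sup>2))"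
    using F G by (auto simp: radializable_def)
  have i2: "(\<lambda>z::(real^2) \<times> (real^2). shell_mean \<Phi> ((norm z)\<^sup>2)) \<in> L2"
    "(\<lambda>z::(real^2) \<times> (real^2). shell_mean \<Psi> ((norm z)\<^sup>2)) \<in> L2"
    using F G borel_measurable_integrable[OF i(1)] borel_measurable_integrable[OF i(2)]
    by (auto simp: radializable_def intro!: L2_borelI)
  have "integrable lborel (\<lambda>z::(real^2) \<times> (real^2). (cmod (shell_mean \<Phi> ((norm z)\<^sup>2) + shell_mean \<Psi> ((norm z)\<^sup>2)))\<^sup>2)"
    using L2D(2)[OF L2_add[OF i2]] borel_measurable_integrable[OF i(1)] borel_measurable_integrable[OF i(2)]
    by (subst (asm) integrable_completion) auto
  moreover have "\<exists>H. \<forall>z. fourier (\<lambda>z::(real^2) \<times> (real^2). shell_mean \<Phi> ((norm z)\<^sup>2) + shell_mean \<Psi> ((norm z)\<^sup>2)) z = H (norm z)"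
    using H by (intro exI[of _ "\<lambda>r. H1 r + H2 r"]) (simp add: fourier_add[OF i])
  moreover have "\<exists>D. \<forall>p r. cmod (\<Phi> p r + \<Psi> p r) \<le> D"
    using norm_add_rule_thm[OF B C] by blast
  moreover have "F = (\<lambda>z. \<Phi> ((norm (fst z))\<^sup>2) ((norm (snd z))\<^sup>2))" "G = (\<lambda>z. \<Psi> ((norm (fst z))\<^sup>2) ((norm (snd z))\<^sup>2))"
    using F G unfolding radializable_def by blast+
  ultimately show ?thesis
    unfolding radializable_def sm using m' i by (simp add: fun_eq_iff)
qed

lemma radializable_scale:
  assumes F: "radializable F \<Phi>"
  shows "radializable (\<lambda>z. c * F z) (\<lambda>p r. c * \<Phi> p r)"
proof -
  have sm: "shell_mean (\<lambda>p r. c * \<Phi> p r) q = c * shell_mean \<Phi> q" for q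
    by (simp add: shell_mean_def flip: mult_scaleR_right)
  obtain B where B: "\<And>p r. cmod (\<Phi> p r) \<le> B" using F unfolding radializable_def by blast
  obtain H where H: "\<And>z. fourier (\<lambda>z::(real^2) \<times> (real^2). shell_mean \<Phi> ((norm z)\<^sup>2)) z = H (norm z)"
    using F unfolding radializable_def by blast
  have 1: "\<exists>D. \<forall>p r. cmod (c * \<Phi> p r) \<le> D"
    using mult_left_mono[OF B, of "cmod c"] by (intro exI[of _ "cmod c * B"]) (simp add: norm_mult)
  have 2: "\<exists>H. \<forall>z. fourier (\<lambda>z::(real^2) \<times> (real^2). c * shell_mean \<Phi> ((norm z)\<^sup>2)) z = H (norm z)"
    using H by (intro exI[of _ "\<lambda>r. c * H r"]) (simp add: fourier_scale)
  have "(\<lambda>x. c * case_prod \<Phi> x) \<in> borel_measurable (borel \<Otimes>\<^sub>M borel)"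
    using F unfolding radializable_def by (intro borel_measurable_times) auto
  hence 3: "(\<lambda>(p, r). c * \<Phi> p r) \<in> borel_measurable (borel \<Otimes>\<^sub>M borel)" by (simp add: case_prod_unfold)
  show ?thesis using F 1 2 3 unfolding radializable_def sm
    by (simp add: norm_mult power_mult_distrib)
qed

lemma biradial_gaussian_radializable:
  assumes "biradial_gaussian F"
  shows "\<exists>\<Phi>. radializable F \<Phi>"
  using assms
proof induction
  case (gaussian a b)
  thus ?case using radializable_gaussian by blast
qed (blast intro: radializable_add radializable_scale)+

section \<open>Distance to the radial functions\<close>

lemma L2_rad_subset: "L2_rad \<subseteq> L2"
  by (auto simp: L2_rad_def)

lemma L2_rad_nonempty: "L2_rad \<noteq> {}"
proof -
  have "(\<lambda>_. 0) \<in> L2_rad" by (auto simp: L2_rad_def L2_def)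
  thus ?thesis by blast
qed

lemma L2_dist_le: "h \<in> F \<Longrightarrow> L2_dist g F \<le> L2_norm (\<lambda>x. g x - h x)"
  unfolding L2_dist_def by (intro cINF_lower bdd_belowI[of _ 0]) auto

lemma L2_dist_nonneg: "F \<noteq> {} \<Longrightarrow> L2_dist g F \<ge> 0"
  unfolding L2_dist_def by (intro cINF_greatest) auto

lemma L2_dist_triangle:
  assumes "f \<in> L2" "g \<in> L2" "F \<subseteq> L2" "F \<noteq> {}"
  shows "L2_dist g F \<le> L2_dist f F + L2_norm (\<lambda>x. g x - f x)"
proof -
  have "L2_dist g F - L2_norm (\<lambda>x. g x - f x) \<le> L2_dist f F"
    unfolding L2_dist_def[of f]
  proof (rule cINF_greatest[OF assms(4)])
    fix h assume h: "h \<in> F"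
    have "L2_dist g F \<le> L2_norm (\<lambda>x. g x - h x)" by (rule L2_dist_le[OF h])
    also have "\<dots> \<le> L2_norm (\<lambda>x. g x - f x) + L2_norm (\<lambda>x. f x - h x)"
      using assms h by (intro L2_norm_triangle) auto
    finally show "L2_dist g F - L2_norm (\<lambda>x. g x - f x) \<le> L2_norm (\<lambda>x. f x - h x)" by simp
  qed
  thus ?thesis by simp
qed

section \<open>Bounds for the restriction to the diagonal\<close>

lemma diagonal_L2:
  assumes "admissible f"
  shows "diagonal f \<in> L2"
  by (rule L2_borelI[OF diagonal_measurable[OF assms] diagonal_square_integrable[OF assms]])

lemma admissible_L2: "admissible f \<Longrightarrow> f \<in> L2"
  by (intro L2_borelI) (auto simp: admissible_def dest: borel_measurable_integrable)

lemma admissible_norm_fourier: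
  assumes f: "admissible f"
  shows "(\<integral>x. (cmod (fourier f x))\<^sup>2 \<partial>lborel) \<le> (2 * pi) ^ 4 * (L2_norm (f :: (real^2) \<times> (real^2) \<Rightarrow> complex))\<^sup>2"
proof -
  have m: "f \<in> borel_measurable borel" using f borel_measurable_integrable by (auto simp: admissible_def)
  have "(L2_norm f)\<^sup>2 = (\<integral>x. (cmod (f x))\<^sup>2 \<partial>lborel)" unfolding L2_norm_borel[OF m] by simp
  thus ?thesis using plancherel_le[of f] f by (simp add: admissible_def eval_nat_numeral)
qed

lemma diagonal_norm_power2: "admissible f \<Longrightarrow> (L2_norm (diagonal f))\<^sup>2 = (\<integral>p. (cmod (diagonal f p))\<^sup>2 \<partial>lborel)"
  unfolding L2_norm_borel[OF diagonal_measurable] by simp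

text \<open>Dropping the nonnegative spread leaves \<open>pi / 2\<close> times
  \<open>(2 * pi) ^ 4 / (2 * pi) ^ 5\<close>, that is \<open>1 / 4\<close> for the squares. Symmetry
  plays no part here, which makes \<open>diagonal\<close> a Lipschitz map on all admissible
  functions.\<close>

lemma diagonal_norm_le:
  assumes f: "admissible f"
  shows "L2_norm (diagonal f) \<le> 1 / 2 * L2_norm f"
proof -
  have "fibre_spread (fourier f) p \<ge> 0" for p
    unfolding fibre_spread_def by (intro Bochner_Integration.integral_nonneg) auto
  hence s: "(\<integral>p. wt p * fibre_spread (fourier f) p \<partial>lborel) \<ge> 0"
    by (intro Bochner_Integration.integral_nonneg) simp
  have "(L2_norm (diagonal f))\<^sup>2 \<le> (pi / 2 * ((2 * pi) ^ 4 * (L2_norm f)\<^sup>2)) / (2 * pi) ^ 5"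
    unfolding diagonal_norm_power2[OF f]
  proof (rule order_trans[OF diagonal_square_integral_le[OF f]], rule divide_right_mono)
    have "pi / 2 * (\<integral>x. (cmod (fourier f x))\<^sup>2 \<partial>lborel) \<le> pi / 2 * ((2 * pi) ^ 4 * (L2_norm f)\<^sup>2)"
      by (intro mult_left_mono admissible_norm_fourier f) auto
    thus "pi / 2 * (\<integral>x. (cmod (fourier f x))\<^sup>2 \<partial>lborel) - 1 / 8 * (\<integral>p. wt p * fibre_spread (fourier f) p \<partial>lborel)
       \<le> pi / 2 * ((2 * pi) ^ 4 * (L2_norm f)\<^sup>2)" using s by linarith
  qed simp
  also have "\<dots> = (1 / 2 * L2_norm f)\<^sup>2" by (simp add: field_simps power2_eq_square eval_nat_numeral)
  finally have sq: "(L2_norm (diagonal f))\<^sup>2 \<le> (1 / 2 * L2_norm f)\<^sup>2" .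
  show ?thesis by (rule power2_le_imp_le[OF sq]) simp
qed

lemma
  assumes f: "admissible f" and g: "admissible g"
  shows admissible_diff: "admissible (\<lambda>x. f x - g x)"
    and diagonal_diff: "diagonal (\<lambda>x. f x - g x) = (\<lambda>p. diagonal f p - diagonal g p)"
proof -
  have F: "fourier (\<lambda>x. f x - g x) = (\<lambda>\<xi>. fourier f \<xi> - fourier g \<xi>)"
    using f g by (intro ext fourier_diff) (auto simp: admissible_def)
  have m: "f \<in> borel_measurable borel" "g \<in> borel_measurable borel"
    using f g borel_measurable_integrable by (auto simp: admissible_def)
  have "integrable lborel (\<lambda>x. (cmod (f x - g x))\<^sup>2)"
    using L2D(2)[OF L2_diff[OF admissible_L2[OF f] admissible_L2[OF g]]] m
    by (subst (asm) integrable_completion) auto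
  thus "admissible (\<lambda>x. f x - g x)"
    using f g by (auto simp: admissible_def F)
  have "schroedinger t (\<lambda>x. f x - g x) z = schroedinger t f z - schroedinger t g z" for t z
  proof -
    have i: "integrable lborel (\<lambda>\<xi>. cis (z \<bullet> \<xi>) * (cis (- (t * (norm \<xi>)\<^sup>2)) * fourier h \<xi>))" if "admissible h" for h
      using that by (intro integrable_cis_mult) (auto simp: admissible_def)
    show ?thesis using i[OF f] i[OF g]
      by (simp add: schroedinger_def F right_diff_distrib diff_divide_distrib)
  qed
  thus "diagonal (\<lambda>x. f x - g x) = (\<lambda>p. diagonal f p - diagonal g p)"
    by (auto simp: diagonal_def fun_eq_iff)
qed

lemma diagonal_dist_le:
  assumes "admissible f" "admissible g"
  shows "L2_norm (\<lambda>p. diagonal f p - diagonal g p) \<le> 1 / 2 * L2_norm (\<lambda>x. f x - g x)"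
  using diagonal_norm_le[OF admissible_diff[OF assms]] by (simp add: diagonal_diff[OF assms])

text \<open>The competitor is the transform of the spherical mean \<open>R\<close>, and its
  difference from \<open>f\<close> is the transform of \<open>F - R\<close> up to
  \<open>(2 * pi) ^ 4\<close>; so Plancherel bounds the distance by the norm of
  \<open>F - R\<close>. The latter is at most half the spread in square, hence the spread term is at
  most - 1/4 of it, and 1/4 divided by \<open>2 * pi\<close> is \<open>1 / (8 * pi)\<close>.\<close>

lemma biradial_gaussian_gap:
  assumes f: "biradial_gaussian f"
  shows "(L2_norm (diagonal f))\<^sup>2 \<le> 1 / 4 * (L2_norm f)\<^sup>2 - 1 / (8 * pi) * (L2_dist f L2_rad)\<^sup>2"
proof -
  have af: "admissible f" by (rule biradial_gaussian_admissible[OF f])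
  define F where "F = fourier f"
  have bF: "biradial_gaussian F" and FF: "fourier F = (\<lambda>z. of_real ((2 * pi) ^ 4) * f z)"
    using biradial_gaussian_fourier[OF f] by (auto simp: F_def)
  have aF: "admissible F" by (rule biradial_gaussian_admissible[OF bF])
  obtain \<Phi> where \<Phi>: "radializable F \<Phi>" using biradial_gaussian_radializable[OF bF] by blast
  define R where "R z = shell_mean \<Phi> ((norm z)\<^sup>2)" for z :: "(real^2) \<times> (real^2)"
  have \<Phi>m: "case_prod \<Phi> \<in> borel_measurable (borel \<Otimes>\<^sub>M borel)"
    and F\<Phi>: "F = (\<lambda>z. \<Phi> ((norm (fst z))\<^sup>2) ((norm (snd z))\<^sup>2))"
    and R: "integrable lborel R" "integrable lborel (\<lambda>z. (cmod (R z))\<^sup>2)"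
    using \<Phi> by (auto simp: radializable_def R_def[abs_def])
  obtain B where B: "\<And>p r. cmod (\<Phi> p r) \<le> B" using \<Phi> unfolding radializable_def by blast
  obtain H where H: "\<And>z. fourier R z = H (norm z)" using \<Phi> unfolding radializable_def R_def[abs_def] by blast
  have Fi: "integrable lborel F" "integrable lborel (\<lambda>z. (cmod (F z))\<^sup>2)" using aF by (auto simp: admissible_def)
  have [measurable]: "F \<in> borel_measurable borel" "R \<in> borel_measurable borel"
    using borel_measurable_integrable[OF Fi(1)] borel_measurable_integrable[OF R(1)] by auto
  define D where "D z = F z - R z" for z
  have D: "integrable lborel D" using Fi R by (simp add: D_def[abs_def])
  have [measurable]: "D \<in> borel_measurable borel" unfolding D_def[abs_def] by measurable
  have "D \<in> L2" unfolding D_def[abs_def] using Fi R by (intro L2_diff L2_borelI) auto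
  hence D2: "integrable lborel (\<lambda>z. (cmod (D z))\<^sup>2)"
    by (subst integrable_completion[symmetric]) (auto dest: L2D)
  define S where "S = (\<integral>p. wt p * fibre_spread F p \<partial>lborel)"
  have Sint: "integrable lborel (\<lambda>p. wt p * fibre_spread F p)" by (rule integrable_fibre_spread[OF Fi])
  have spread: "fibre_spread F p \<ge> 0" for p
    unfolding fibre_spread_def by (intro Bochner_Integration.integral_nonneg) auto
  have S0: "S \<ge> 0" unfolding S_def using spread by (intro Bochner_Integration.integral_nonneg) simp
  have DS: "2 * (\<integral>z. (cmod (D z))\<^sup>2 \<partial>lborel) \<le> S"
  proof -
    have "2 * (\<integral>\<^sup>+z. ennreal ((cmod (D z))\<^sup>2) \<partial>lborel) \<le> (\<integral>\<^sup>+p. ennreal (wt p * fibre_spread F p) \<partial>lborel)"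
      using nn_integral_shell_mean_le[OF \<Phi>m B] unfolding D_def R_def F\<Phi> by simp
    also have "(\<integral>\<^sup>+p. ennreal (wt p * fibre_spread F p) \<partial>lborel) = ennreal S"
      unfolding S_def using spread by (intro nn_integral_eq_integral Sint) simp
    also have "(\<integral>\<^sup>+z. ennreal ((cmod (D z))\<^sup>2) \<partial>lborel) = ennreal (\<integral>z. (cmod (D z))\<^sup>2 \<partial>lborel)"
      by (intro nn_integral_eq_integral D2) simp
    also have "2 * ennreal (\<integral>z. (cmod (D z))\<^sup>2 \<partial>lborel) = ennreal (2 * (\<integral>z. (cmod (D z))\<^sup>2 \<partial>lborel))"
      by (simp add: ennreal_mult')
    finally show ?thesis using S0 by simp
  qed
  \<comment> \<open>A second transform takes the place of the inverse one, in accordance with the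
    identity for \<open>fourier F\<close>. This function is radial because the transform of
    \<open>R\<close> is.\<close>
  define h where "h z = fourier R z / of_real ((2 * pi) ^ 4)" for z
  have [measurable]: "h \<in> borel_measurable borel" unfolding h_def[abs_def] by measurable
  have "integrable lborel (\<lambda>z. (cmod (h z))\<^sup>2)"
    unfolding h_def norm_divide power_divide by (intro integrable_divide plancherel_integrable R)
  hence hL: "h \<in> L2" by (intro L2_borelI) auto
  hence hrad: "h \<in> L2_rad" unfolding L2_rad_def h_def H
    by (auto intro!: exI[of _ "\<lambda>r. H r / of_real ((2 * pi) ^ 4)"])
  have fh: "f z - h z = fourier D z / of_real ((2 * pi) ^ 4)" for z
  proof -
    have "fourier D z = fourier F z - fourier R z" unfolding D_def by (rule fourier_diff[OF Fi(1) R(1)])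
    thus ?thesis by (simp add: FF h_def diff_divide_distrib)
  qed
  have "(L2_dist f L2_rad)\<^sup>2 \<le> (L2_norm (\<lambda>z. f z - h z))\<^sup>2"
    by (intro power_mono L2_dist_le hrad L2_dist_nonneg L2_rad_nonempty)
  also have "\<dots> = (\<integral>z. (cmod (fourier D z / of_real ((2 * pi) ^ 4)))\<^sup>2 \<partial>lborel)"
    unfolding fh by (subst L2_norm_borel) simp_all
  also have "\<dots> = (\<integral>z. (cmod (fourier D z))\<^sup>2 \<partial>lborel) / (2 * pi) ^ 8"
    by (simp add: norm_divide power_divide norm_mult norm_power power_mult_distrib flip: power_mult)
  also have "\<dots> \<le> ((2 * pi) ^ 4 * (\<integral>z. (cmod (D z))\<^sup>2 \<partial>lborel)) / (2 * pi) ^ 8"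
    using plancherel_le[OF D D2] by (intro divide_right_mono) (auto simp: eval_nat_numeral)
  also have "\<dots> = (\<integral>z. (cmod (D z))\<^sup>2 \<partial>lborel) / (2 * pi) ^ 4"
    by (simp add: field_simps eval_nat_numeral)
  finally have dist: "(2 * pi) ^ 4 * (L2_dist f L2_rad)\<^sup>2 \<le> (\<integral>z. (cmod (D z))\<^sup>2 \<partial>lborel)"
    by (simp add: field_simps)
  have "(L2_norm (diagonal f))\<^sup>2 \<le> (pi / 2 * (\<integral>x. (cmod (F x))\<^sup>2 \<partial>lborel) - 1 / 8 * S) / (2 * pi) ^ 5"
    using diagonal_square_integral_le[OF af] by (simp add: diagonal_norm_power2[OF af] F_def S_def)
  also have "\<dots> \<le> (pi / 2 * ((2 * pi) ^ 4 * (L2_norm f)\<^sup>2) - 1 / 4 * ((2 * pi) ^ 4 * (L2_dist f L2_rad)\<^sup>2)) / (2 * pi) ^ 5"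
  proof (rule divide_right_mono)
    have "pi / 2 * (\<integral>x. (cmod (F x))\<^sup>2 \<partial>lborel) \<le> pi / 2 * ((2 * pi) ^ 4 * (L2_norm f)\<^sup>2)"
      unfolding F_def by (intro mult_left_mono admissible_norm_fourier af) auto
    moreover have "1 / 4 * ((2 * pi) ^ 4 * (L2_dist f L2_rad)\<^sup>2) \<le> 1 / 8 * S" using dist DS by linarith
    ultimately show "pi / 2 * (\<integral>x. (cmod (F x))\<^sup>2 \<partial>lborel) - 1 / 8 * S
      \<le> pi / 2 * ((2 * pi) ^ 4 * (L2_norm f)\<^sup>2) - 1 / 4 * ((2 * pi) ^ 4 * (L2_dist f L2_rad)\<^sup>2)" by linarith
  qed simp
  also have "\<dots> = 1 / 4 * (L2_norm f)\<^sup>2 - 1 / (8 * pi) * (L2_dist f L2_rad)\<^sup>2"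
    by (simp add: field_simps eval_nat_numeral)
  finally show ?thesis .
qed

section \<open>Passage from Gaussians to general data\<close>

lemma L2_norm_tendsto:
  assumes f: "\<And>n::nat. f n \<in> L2" and g: "g \<in> L2" and lim: "(\<lambda>n. L2_norm (\<lambda>x. f n x - g x)) \<longlonglongrightarrow> 0"
  shows "(\<lambda>n. L2_norm (f n)) \<longlonglongrightarrow> L2_norm g"
proof (rule Lim_transform2[OF tendsto_const Lim_null_comparison[OF _ lim]])
  have "\<bar>L2_norm g - L2_norm (f n)\<bar> \<le> L2_norm (\<lambda>x. f n x - g x)" for n
    using L2_norm_le_add_diff[OF f g, of n] L2_norm_le_add_diff[OF g f, of n]
    by (simp add: L2_norm_minus_commute[of g "f n"])
  thus "\<forall>\<^sub>F n in sequentially. norm (L2_norm g - L2_norm (f n)) \<le> L2_norm (\<lambda>x. f n x - g x)"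
    by (intro always_eventually allI) simp
qed

lemma L2_dist_tendsto:
  assumes f: "\<And>n::nat. f n \<in> L2" and g: "g \<in> L2" and lim: "(\<lambda>n. L2_norm (\<lambda>x. f n x - g x)) \<longlonglongrightarrow> 0"
    and F: "F \<subseteq> L2" "F \<noteq> {}"
  shows "(\<lambda>n. L2_dist (f n) F) \<longlonglongrightarrow> L2_dist g F"
proof (rule Lim_transform2[OF tendsto_const Lim_null_comparison[OF _ lim]])
  have "\<bar>L2_dist g F - L2_dist (f n) F\<bar> \<le> L2_norm (\<lambda>x. f n x - g x)" for n
    using L2_dist_triangle[OF f g F, of n] L2_dist_triangle[OF g f F, of n]
    by (simp add: L2_norm_minus_commute[of g "f n"])
  thus "\<forall>\<^sub>F n in sequentially. norm (L2_dist g F - L2_dist (f n) F) \<le> L2_norm (\<lambda>x. f n x - g x)"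
    by (intro always_eventually allI) simp
qed

lemma biradial_gaussian_schwartz: "biradial_gaussian f \<Longrightarrow> schwartz f"
  by (intro polynomial_gaussian_schwartz biradial_gaussian_polynomial_gaussian)

text \<open>The Lipschitz bound makes the restrictions of the approximating Gaussians a Cauchy
  sequence, and the same bound compares any other Schwartz function near \<open>g\<close> with them;
  so the limit does not depend on the approximation.\<close>

lemma diagonal_trace_exists:
  assumes g: "g \<in> L2" and f: "\<And>n::nat. biradial_gaussian (f n)"
    and lim: "(\<lambda>n. L2_norm (\<lambda>x. f n x - g x)) \<longlonglongrightarrow> 0"
  shows "\<exists>h. diagonal_trace g h"
proof -
  have af: "admissible (f n)" for n by (rule biradial_gaussian_admissible[OF f])
  have fL: "f n \<in> L2" for n by (rule admissible_L2[OF af])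
  have small: "\<exists>N. \<forall>n\<ge>N. L2_norm (\<lambda>x. f n x - g x) < e" if "e > 0" for e
    using order_tendstoD(2)[OF lim that] by (simp add: eventually_sequentially)
  obtain h where h: "h \<in> L2" and hlim: "(\<lambda>n. L2_norm (\<lambda>p. diagonal (f n) p - h p)) \<longlonglongrightarrow> 0"
  proof (rule Riesz_Fischer[of "\<lambda>n. diagonal (f n)"])
    show "diagonal (f n) \<in> L2" for n by (rule diagonal_L2[OF af])
    fix e :: real assume e: "e > 0"
    then obtain N where N: "\<And>n. n \<ge> N \<Longrightarrow> L2_norm (\<lambda>x. f n x - g x) < e" using small by blast
    have "L2_norm (\<lambda>p. diagonal (f m) p - diagonal (f n) p) < e" if "m \<ge> N" "n \<ge> N" for m n
    proof -
      have "L2_norm (\<lambda>x. f m x - f n x) \<le> L2_norm (\<lambda>x. f m x - g x) + L2_norm (\<lambda>x. g x - f n x)"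
        by (rule L2_norm_triangle[OF fL g fL])
      also have "\<dots> < 2 * e" using N[OF that(1)] N[OF that(2)] by (simp add: L2_norm_minus_commute[of g])
      finally show ?thesis using diagonal_dist_le[OF af af, of m n] by linarith
    qed
    thus "\<exists>N. \<forall>m\<ge>N. \<forall>n\<ge>N. L2_norm (\<lambda>p. diagonal (f m) p - diagonal (f n) p) < e" by blast
  qed (use that in blast)
  \<comment> \<open>In the definition of the trace \<delta> = \<epsilon> suffices: the Lipschitz
    constant \<open>1/2\<close> gives (e + e/4) / 2 + e/4, which is below \<open>e\<close>.\<close>
  have "diagonal f' \<in> L2 \<and> L2_norm (\<lambda>p. diagonal f' p - h p) < e"
    if e: "e > 0" and f': "schwartz f'" "L2_norm (\<lambda>z. f' z - g z) < e" for e f'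
  proof
    have a': "admissible f'" by (rule schwartz_admissible[OF f'(1)])
    show dL: "diagonal f' \<in> L2" by (rule diagonal_L2[OF a'])
    obtain N where N: "\<And>n. n \<ge> N \<Longrightarrow> L2_norm (\<lambda>x. f n x - g x) < e / 4" using small[of "e/4"] e by auto
    have "eventually (\<lambda>n. L2_norm (\<lambda>p. diagonal (f n) p - h p) < e / 4) sequentially"
      using order_tendstoD(2)[OF hlim, of "e/4"] e by simp
    then obtain M where M: "\<And>n. n \<ge> M \<Longrightarrow> L2_norm (\<lambda>p. diagonal (f n) p - h p) < e / 4"
      by (auto simp: eventually_sequentially)
    define n where "n = max N M"
    have "L2_norm (\<lambda>p. diagonal f' p - h p) \<le> L2_norm (\<lambda>p. diagonal f' p - diagonal (f n) p) + L2_norm (\<lambda>p. diagonal (f n) p - h p)"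
      by (rule L2_norm_triangle[OF dL diagonal_L2[OF af] h])
    moreover have "L2_norm (\<lambda>p. diagonal f' p - diagonal (f n) p) \<le> 1 / 2 * L2_norm (\<lambda>x. f' x - f n x)"
      by (rule diagonal_dist_le[OF a' af])
    moreover have "L2_norm (\<lambda>x. f' x - f n x) \<le> L2_norm (\<lambda>x. f' x - g x) + L2_norm (\<lambda>x. g x - f n x)"
      by (rule L2_norm_triangle[OF admissible_L2[OF a'] g fL])
    moreover have "L2_norm (\<lambda>x. f n x - g x) < e / 4" "L2_norm (\<lambda>p. diagonal (f n) p - h p) < e / 4"
      by (rule N M, simp add: n_def)+
    ultimately show "L2_norm (\<lambda>p. diagonal f' p - h p) < e"
      using e f'(2) L2_norm_minus_commute[of g "f n"] by linarith
  qed
  hence "diagonal_trace g h" unfolding diagonal_trace_def using h by blast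
  thus ?thesis by blast
qed

text \<open>Norms and the distance to \<open>L2_rad\<close> are continuous in \<open>L2\<close>, and
  Gaussian approximants of \<open>g\<close> are among the Schwartz functions by which the trace is
  defined; so the gap estimate for Gaussians passes to the limit.\<close>

theorem theorem3:
  "\<exists>\<gamma>::real. \<gamma> > 0 \<and>
     (\<forall>g :: (real^2) \<times> (real^2) \<Rightarrow> complex.
        g \<in> L2 \<and>
        (\<exists>G :: real \<Rightarrow> real \<Rightarrow> complex. AE (x, y) in lebesgue. g (x, y) = G (norm x) (norm y)) \<longrightarrow>
        (\<exists>h. diagonal_trace g h) \<and>
        (\<forall>h. diagonal_trace g h \<longrightarrow>
           (\<integral>p. (cmod (h p))\<^sup>2 \<partial>lebesgue)
             \<le> 1 / 4 * (\<integral>z. (cmod (g z))\<^sup>2 \<partial>lebesgue) - \<gamma> / 4 * (L2_dist g L2_rad)\<^sup>2))"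
proof (intro exI[of _ "1 / (2 * pi)"] conjI allI impI)
  \<comment> \<open>A quarter of this constant is the \<open>1 / (8 * pi)\<close> of the Gaussian
    estimate.\<close>
  show "1 / (2 * pi) > 0" by simp
  fix g :: "(real^2) \<times> (real^2) \<Rightarrow> complex"
  assume asm: "g \<in> L2 \<and> (\<exists>G :: real \<Rightarrow> real \<Rightarrow> complex. AE (x, y) in lebesgue. g (x, y) = G (norm x) (norm y))"
  hence g: "g \<in> L2" by blast
  from asm obtain G :: "real \<Rightarrow> real \<Rightarrow> complex"
    where "AE (x, y) in lebesgue. g (x, y) = G (norm x) (norm y)" by blast
  hence "AE z in lebesgue. g z = G (norm (fst z)) (norm (snd z))" by (simp add: case_prod_unfold)
  hence G: "AE z in lborel. g z = G (norm (fst z)) (norm (snd z))" by (simp add: AE_completion_iff)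
  have "\<exists>f. biradial_gaussian f \<and> L2_norm (\<lambda>x. f x - g x) < 1 / real (Suc n)" for n
    using biradial_gaussian_dense[OF g G, of "1 / real (Suc n)"] L2_norm_minus_commute
    by (metis of_nat_0_less_iff zero_less_Suc zero_less_divide_1_iff)
  then obtain f where f: "\<And>n. biradial_gaussian (f n)" and fg: "\<And>n. L2_norm (\<lambda>x. f n x - g x) < 1 / real (Suc n)"
    by metis
  have lim: "(\<lambda>n. L2_norm (\<lambda>x. f n x - g x)) \<longlonglongrightarrow> 0"
    by (rule tendsto_sandwich[OF _ _ tendsto_const LIMSEQ_Suc[OF lim_1_over_n]])
       (use fg in \<open>auto intro!: always_eventually less_imp_le simp del: of_nat_Suc\<close>)
  show "\<exists>h. diagonal_trace g h" by (rule diagonal_trace_exists[OF g f lim])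
  fix h assume h: "diagonal_trace g h"
  hence hL: "h \<in> L2" by (simp add: diagonal_trace_def)
  have af: "admissible (f n)" for n by (rule biradial_gaussian_admissible[OF f])
  have fL: "f n \<in> L2" for n by (rule admissible_L2[OF af])
  \<comment> \<open>Here \<open>h\<close> is an arbitrary trace of \<open>g\<close>. Its definition,
    tested on the Gaussian approximants alone, already identifies it as the limit of their
    restrictions.\<close>
  have "(\<lambda>n. L2_norm (\<lambda>p. diagonal (f n) p - h p)) \<longlonglongrightarrow> 0"
  proof (rule LIMSEQ_I)
    fix e :: real assume "e > 0"
    with h obtain d where d: "d > 0"
      "\<And>f. schwartz f \<Longrightarrow> L2_norm (\<lambda>z. f z - g z) < d \<Longrightarrow> L2_norm (\<lambda>p. diagonal f p - h p) < e"
      unfolding diagonal_trace_def by blast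
    from order_tendstoD(2)[OF lim d(1)] obtain N where "\<And>n. n \<ge> N \<Longrightarrow> L2_norm (\<lambda>x. f n x - g x) < d"
      by (auto simp: eventually_sequentially)
    hence "\<And>n. n \<ge> N \<Longrightarrow> L2_norm (\<lambda>p. diagonal (f n) p - h p) < e"
      using d(2) biradial_gaussian_schwartz[OF f] by blast
    thus "\<exists>no. \<forall>n\<ge>no. norm (L2_norm (\<lambda>p. diagonal (f n) p - h p) - 0) < e" by auto
  qed
  hence l1: "(\<lambda>n. L2_norm (diagonal (f n))) \<longlonglongrightarrow> L2_norm h"
    by (rule L2_norm_tendsto[OF diagonal_L2[OF af] hL])
  have l2: "(\<lambda>n. L2_norm (f n)) \<longlonglongrightarrow> L2_norm g" by (rule L2_norm_tendsto[OF fL g lim])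
  have l3: "(\<lambda>n. L2_dist (f n) L2_rad) \<longlonglongrightarrow> L2_dist g L2_rad"
    by (rule L2_dist_tendsto[OF fL g lim L2_rad_subset L2_rad_nonempty])
  have "(L2_norm h)\<^sup>2 \<le> 1 / 4 * (L2_norm g)\<^sup>2 - 1 / (8 * pi) * (L2_dist g L2_rad)\<^sup>2"
  proof (rule LIMSEQ_le)
    show "(\<lambda>n. (L2_norm (diagonal (f n)))\<^sup>2) \<longlonglongrightarrow> (L2_norm h)\<^sup>2" by (intro tendsto_power l1)
    show "(\<lambda>n. 1 / 4 * (L2_norm (f n))\<^sup>2 - 1 / (8 * pi) * (L2_dist (f n) L2_rad)\<^sup>2)
        \<longlonglongrightarrow> 1 / 4 * (L2_norm g)\<^sup>2 - 1 / (8 * pi) * (L2_dist g L2_rad)\<^sup>2"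
      by (intro tendsto_intros l2 l3)
    show "\<exists>N. \<forall>n\<ge>N. (L2_norm (diagonal (f n)))\<^sup>2 \<le> 1 / 4 * (L2_norm (f n))\<^sup>2 - 1 / (8 * pi) * (L2_dist (f n) L2_rad)\<^sup>2"
      using biradial_gaussian_gap[OF f] by blast
  qed
  thus "(\<integral>p. (cmod (h p))\<^sup>2 \<partial>lebesgue)
      \<le> 1 / 4 * (\<integral>z. (cmod (g z))\<^sup>2 \<partial>lebesgue) - 1 / (2 * pi) / 4 * (L2_dist g L2_rad)\<^sup>2"
    by (simp add: L2_norm_power2)
qed

end
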